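(* Let $\Omega\subset\mathbb{R}^2$ be a bounded polygonal domain, let $f\in L^2(\Omega)$ and let $\chi\in H^2(\Omega)$ with $\max_{x\in\partial\Omega}\chi(x)<0$. Let $K:=\{\varphi\in H^2_0(\Omega):\varphi\ge\chi \text{ a.e. in }\Omega\}$. Then the functional $$j(\xi):=\tfrac12|\!|\!|\xi|\!|\!|^2+\tfrac12|\!|\!|G(\xi)|\!|\!|^2-(f,\xi)_{L^2(\Omega)},\qquad \xi\in K,$$ has a minimizer in $K$. Moreover, for each minimizer $u$ of $j$ in $K$, the pair $(u,v)$ with $v:=G(u)$ solves the von Kármán obstacle problem: $(u,v)\in K\times H^2_0(\Omega)$ and $$a(u,u-\varphi_1)+2b(u,v,u-\varphi_1)\le (f,u-\varphi_1)_{L^2(\Omega)}\ \ \forall\varphi_1\in K,\qquad a(v,\varphi_2)-b(u,u,\varphi_2)=0\ \ \forall \varphi_2\in H^2_0(\Omega).$$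
   Context: $|\!|\!|\varphi|\!|\!|:=\|D^2\varphi\|_{L^2(\Omega)}$ (energy norm on $H^2_0(\Omega)$, $D^2$ the Hessian). For $\varphi_1,\varphi_2,\varphi_3\in H^2_0(\Omega)$: $a(\varphi_1,\varphi_2):=(D^2\varphi_1,D^2\varphi_2)_{L^2(\Omega)}$, $b(\varphi_1,\varphi_2,\varphi_3):=-\tfrac12([\varphi_1,\varphi_2],\varphi_3)_{L^2(\Omega)}$, where $[\varphi_1,\varphi_2]:=\varphi_{1,xx}\varphi_{2,yy}+\varphi_{1,yy}\varphi_{2,xx}-2\varphi_{1,xy}\varphi_{2,xy}$ is the von Kármán bracket. $G:H^2_0(\Omega)\to H^2_0(\Omega)$ is defined by $a(G(\varphi),\psi)=b(\varphi,\varphi,\psi)$ for all $\psi\in H^2_0(\Omega)$ (Riesz representation of $b(\varphi,\varphi,\cdot)$). *)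

theory Defs
  imports "HOL-Analysis.Analysis"
begin

type_synonym pt = "real \<times> real"

definition polygonal_domain :: "pt set \<Rightarrow> bool" where
  "polygonal_domain \<Omega> \<longleftrightarrow> open \<Omega> \<and> connected \<Omega> \<and> bounded \<Omega> \<and> \<Omega> \<noteq> {} \<and>
     (\<exists>S. finite S \<and> frontier \<Omega> = (\<Union>(p,q)\<in>S. closed_segment p q))"

definition pdx :: "(pt \<Rightarrow> real) \<Rightarrow> pt \<Rightarrow> real" where
  "pdx g z = deriv (\<lambda>t. g (t, snd z)) (fst z)"
definition pdy :: "(pt \<Rightarrow> real) \<Rightarrow> pt \<Rightarrow> real" where
  "pdy g z = deriv (\<lambda>t. g (fst z, t)) (snd z)"

fun ipd :: "bool list \<Rightarrow> (pt \<Rightarrow> real) \<Rightarrow> pt \<Rightarrow> real" where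
  "ipd [] g = g"
| "ipd (True # ds) g = pdx (ipd ds g)"
| "ipd (False # ds) g = pdy (ipd ds g)"

definition smooth2 :: "(pt \<Rightarrow> real) \<Rightarrow> bool" where
  "smooth2 g \<longleftrightarrow> (\<forall>ds. continuous_on UNIV (ipd ds g) \<and>
     (\<forall>z. (\<lambda>t. ipd ds g (t, snd z)) differentiable (at (fst z)) \<and>
          (\<lambda>t. ipd ds g (fst z, t)) differentiable (at (snd z))))"

definition csupp :: "(pt \<Rightarrow> real) \<Rightarrow> pt set" where
  "csupp g = closure {z. g z \<noteq> 0}"

definition test_fun :: "pt set \<Rightarrow> (pt \<Rightarrow> real) \<Rightarrow> bool" where
  "test_fun \<Omega> g \<longleftrightarrow> smooth2 g \<and> compact (csupp g) \<and> csupp g \<subseteq> \<Omega>"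

definition L2 :: "pt set \<Rightarrow> (pt \<Rightarrow> real) \<Rightarrow> bool" where
  "L2 \<Omega> g \<longleftrightarrow> g \<in> borel_measurable (lebesgue_on \<Omega>) \<and> integrable (lebesgue_on \<Omega>) (\<lambda>z. (g z)\<^sup>2)"

definition L2inner :: "pt set \<Rightarrow> (pt \<Rightarrow> real) \<Rightarrow> (pt \<Rightarrow> real) \<Rightarrow> real" where
  "L2inner \<Omega> g h = (LINT z|lebesgue_on \<Omega>. g z * h z)"

definition is_weak_deriv :: "pt set \<Rightarrow> (pt \<Rightarrow> real) \<Rightarrow> bool list \<Rightarrow> (pt \<Rightarrow> real) \<Rightarrow> bool" where
  "is_weak_deriv \<Omega> \<phi> ds g \<longleftrightarrow> L2 \<Omega> g \<and>
     (\<forall>\<psi>. test_fun \<Omega> \<psi> \<longrightarrow> L2inner \<Omega> \<phi> (ipd ds \<psi>) = (-1) ^ length ds * L2inner \<Omega> g \<psi>)"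

definition wd :: "pt set \<Rightarrow> (pt \<Rightarrow> real) \<Rightarrow> bool list \<Rightarrow> pt \<Rightarrow> real" where
  "wd \<Omega> \<phi> ds = (SOME g. is_weak_deriv \<Omega> \<phi> ds g)"

definition H2 :: "pt set \<Rightarrow> (pt \<Rightarrow> real) set" where
  "H2 \<Omega> = {\<phi>. L2 \<Omega> \<phi> \<and> (\<forall>ds. length ds \<le> 2 \<longrightarrow> (\<exists>g. is_weak_deriv \<Omega> \<phi> ds g))}"

definition H2_normsq :: "pt set \<Rightarrow> (pt \<Rightarrow> real) \<Rightarrow> real" where
  "H2_normsq \<Omega> \<phi> = (\<Sum>ds\<in>{ds. length ds \<le> 2}. L2inner \<Omega> (wd \<Omega> \<phi> ds) (wd \<Omega> \<phi> ds))"

definition H20 :: "pt set \<Rightarrow> (pt \<Rightarrow> real) set" where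
  "H20 \<Omega> = {\<phi> \<in> H2 \<Omega>. \<exists>s. (\<forall>n. test_fun \<Omega> (s n)) \<and>
      (\<lambda>n. H2_normsq \<Omega> (\<lambda>z. s n z - \<phi> z)) \<longlonglongrightarrow> 0}"

definition a_form :: "pt set \<Rightarrow> (pt \<Rightarrow> real) \<Rightarrow> (pt \<Rightarrow> real) \<Rightarrow> real" where
  "a_form \<Omega> \<phi>1 \<phi>2 = (LINT z|lebesgue_on \<Omega>.
      wd \<Omega> \<phi>1 [True,True] z * wd \<Omega> \<phi>2 [True,True] z
    + wd \<Omega> \<phi>1 [True,False] z * wd \<Omega> \<phi>2 [True,False] z
    + wd \<Omega> \<phi>1 [False,True] z * wd \<Omega> \<phi>2 [False,True] z
    + wd \<Omega> \<phi>1 [False,False] z * wd \<Omega> \<phi>2 [False,False] z)"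

definition enorm :: "pt set \<Rightarrow> (pt \<Rightarrow> real) \<Rightarrow> real" where
  "enorm \<Omega> \<phi> = sqrt (a_form \<Omega> \<phi> \<phi>)"

definition vkb :: "pt set \<Rightarrow> (pt \<Rightarrow> real) \<Rightarrow> (pt \<Rightarrow> real) \<Rightarrow> pt \<Rightarrow> real" where
  "vkb \<Omega> \<phi>1 \<phi>2 z = wd \<Omega> \<phi>1 [True,True] z * wd \<Omega> \<phi>2 [False,False] z
     + wd \<Omega> \<phi>1 [False,False] z * wd \<Omega> \<phi>2 [True,True] z
     - 2 * wd \<Omega> \<phi>1 [True,False] z * wd \<Omega> \<phi>2 [True,False] z"

definition b_form :: "pt set \<Rightarrow> (pt \<Rightarrow> real) \<Rightarrow> (pt \<Rightarrow> real) \<Rightarrow> (pt \<Rightarrow> real) \<Rightarrow> real" where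
  "b_form \<Omega> \<phi>1 \<phi>2 \<phi>3 = - (1/2) * L2inner \<Omega> (vkb \<Omega> \<phi>1 \<phi>2) \<phi>3"

definition G_op :: "pt set \<Rightarrow> (pt \<Rightarrow> real) \<Rightarrow> pt \<Rightarrow> real" where
  "G_op \<Omega> \<phi> = (SOME g. g \<in> H20 \<Omega> \<and> (\<forall>\<psi>\<in>H20 \<Omega>. a_form \<Omega> g \<psi> = b_form \<Omega> \<phi> \<phi> \<psi>))"

definition obstacle_set :: "pt set \<Rightarrow> (pt \<Rightarrow> real) \<Rightarrow> (pt \<Rightarrow> real) set" where
  "obstacle_set \<Omega> obs = {\<phi> \<in> H20 \<Omega>. AE z in lebesgue_on \<Omega>. obs z \<le> \<phi> z}"

definition j_fun :: "pt set \<Rightarrow> (pt \<Rightarrow> real) \<Rightarrow> (pt \<Rightarrow> real) \<Rightarrow> real" where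
  "j_fun \<Omega> f \<xi> = 1/2 * (enorm \<Omega> \<xi>)\<^sup>2 + 1/2 * (enorm \<Omega> (G_op \<Omega> \<xi>))\<^sup>2 - L2inner \<Omega> f \<xi>"

end

(*
  Direct method. A test function satisfies g(x,y) = integral of g_xy over the quadrant {s <= x, t <= y};
  by density this gives on H20 the embedding into bounded functions, the Poincare inequality, and the
  weak continuity of point evaluation, so weak convergence in H20 implies pointwise a.e. and hence
  (dominated convergence) strong L2 convergence. Since [u,v] is a null Lagrangian, b is symmetric in all
  three arguments, and for a test function p the value b(w,w,p) = b(p,w,w) involves only first
  derivatives of w, whence |b(w,w,p)| <= C |w|_L2 |||w|||. Therefore b(u_n,u_n,p) -> b(u,u,p) along weakly
  convergent sequences, and |||G(u_n)|||^2 >= 2 b(u_n,u_n,p) - |||p|||^2 with p close to G(u) yields lower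
  semicontinuity of j. For a minimiser u and a direction w, |||G(u + t w)|||^2 is a polynomial in t with
  linear coefficient 4 b(u,w,G(u)) = 4 b(u,G(u),w), which gives the variational inequality.
*)

theory Submission
  imports Defs "HOL-Library.Diagonal_Subsequence" "HOL-Computational_Algebra.Polynomial"
begin

section \<open>Semi-inner product spaces\<close>

text \<open>Functions that agree a.e. are not identified, and \<open>wd\<close> and
  \<open>G_op\<close> are arbitrary choices, so none of the forms below is definite and neither
  limits nor representers are unique. Hilbert space theory is therefore developed for semidefinite
  forms on sets of functions, without quotients; identities for \<open>wd\<close> hold a.e. only and
  become usable under an integral.

  Quadrant integrals do more than give the embedding. The symmetry of mixed partials is not part of
  \<open>smooth2\<close>; it is recovered because both orders have the same quadrant integrals.
  Quadrants also generate the Borel sets, and the resulting criterion for vanishing a.e. underlies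
  the fundamental lemma that makes weak derivatives a.e. unique.

  The obstacle to lower semicontinuity is that \<open>b_form\<close> is quadratic in second
  derivatives, which converge only weakly; the plain energy estimate does not become small along
  such a sequence. Smooth third arguments allow derivatives to be moved, and they suffice because a
  squared norm is a supremum of affine functions indexed by a dense set.\<close>

locale semi_inner =
  fixes H :: "('a \<Rightarrow> real) set" and B :: "('a \<Rightarrow> real) \<Rightarrow> ('a \<Rightarrow> real) \<Rightarrow> real"
  assumes zero_mem: "(\<lambda>z. 0) \<in> H"
    and lin_mem: "\<And>u v c d. u \<in> H \<Longrightarrow> v \<in> H \<Longrightarrow> (\<lambda>z. c * u z + d * v z) \<in> H"
    and form_lin: "\<And>u v w c d. u \<in> H \<Longrightarrow> v \<in> H \<Longrightarrow> w \<in> H \<Longrightarrow>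
        B (\<lambda>z. c * u z + d * v z) w = c * B u w + d * B v w"
    and form_sym: "\<And>u v. B u v = B v u"
    and form_nonneg: "\<And>u. u \<in> H \<Longrightarrow> 0 \<le> B u u"
begin

definition nrm :: "('a \<Rightarrow> real) \<Rightarrow> real" where "nrm u = sqrt (B u u)"

lemma diff_mem: "u \<in> H \<Longrightarrow> v \<in> H \<Longrightarrow> (\<lambda>z. u z - v z) \<in> H"
  using lin_mem[of u v 1 "-1"] by simp

lemma scale_mem: "u \<in> H \<Longrightarrow> (\<lambda>z. c * u z) \<in> H"
  using lin_mem[of u u c 0] by simp

lemma form_lin_right:
  "u \<in> H \<Longrightarrow> v \<in> H \<Longrightarrow> w \<in> H \<Longrightarrow> B w (\<lambda>z. c * u z + d * v z) = c * B w u + d * B w v"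
  using form_lin[of u v w c d] form_sym by metis

lemma form_diff_left: "u \<in> H \<Longrightarrow> v \<in> H \<Longrightarrow> w \<in> H \<Longrightarrow> B (\<lambda>z. u z - v z) w = B u w - B v w"
  using form_lin[of u v w 1 "-1"] by simp

lemma form_diff_right: "u \<in> H \<Longrightarrow> v \<in> H \<Longrightarrow> w \<in> H \<Longrightarrow> B w (\<lambda>z. u z - v z) = B w u - B w v"
  using form_lin_right[of u v w 1 "-1"] by simp

lemma form_quad:
  assumes "u \<in> H" "v \<in> H"
  shows "B (\<lambda>z. c * u z + d * v z) (\<lambda>z. c * u z + d * v z) = c\<^sup>2 * B u u + 2 * c * d * B u v + d\<^sup>2 * B v v"
  using assms by (simp add: form_lin form_lin_right lin_mem form_sym[of v u] power2_eq_square algebra_simps)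

lemma form_quad_diff:
  assumes "u \<in> H" "v \<in> H"
  shows "B (\<lambda>z. u z - v z) (\<lambda>z. u z - v z) = B u u - 2 * B u v + B v v"
  using form_quad[OF assms, of 1 "-1"] by simp

lemma nrm_nonneg [simp]: "u \<in> H \<Longrightarrow> 0 \<le> nrm u"
  by (simp add: nrm_def form_nonneg)

lemma nrm_sq: "u \<in> H \<Longrightarrow> (nrm u)\<^sup>2 = B u u"
  by (simp add: nrm_def form_nonneg)

lemma Cauchy_Schwarz_sq:
  assumes u: "u \<in> H" and v: "v \<in> H"
  shows "(B u v)\<^sup>2 \<le> B u u * B v v"
proof (cases "B v v = 0")
  case True
  \<comment> \<open>A null vector need not be the zero function, so this case is genuine: an affine
    function of \<open>d\<close> that is never negative has slope zero.\<close>
  have ineq: "0 \<le> B u u + 2 * d * B u v" for d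
    using form_nonneg[OF lin_mem[OF u v, of 1 d]] form_quad[OF u v, of 1 d] True by simp
  have "B u v = 0"
  proof (rule ccontr)
    assume nz: "B u v \<noteq> 0"
    have "2 * (- (B u u + 1) / (2 * B u v)) * B u v = - (B u u + 1)" using nz by simp
    then show False
      using ineq[of "- (B u u + 1) / (2 * B u v)"] by linarith
  qed
  with True show ?thesis by simp
next
  case False
  then have pos: "B v v > 0" using form_nonneg[OF v] by simp
  \<comment> \<open>The coefficients \<open>B v v\<close> and \<open>- B u v\<close> are those of
    the projection away from \<open>v\<close>, cleared of the denominator.\<close>
  have "0 \<le> (B v v)\<^sup>2 * B u u + 2 * B v v * (- B u v) * B u v + (- B u v)\<^sup>2 * B v v"
    using form_nonneg[OF lin_mem[OF u v, of "B v v" "- B u v"]] form_quad[OF u v, of "B v v" "- B u v"] by simp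
  also have "\<dots> = B v v * (B v v * B u u - (B u v)\<^sup>2)"
    by (simp add: power2_eq_square algebra_simps)
  finally have "0 \<le> B v v * B u u - (B u v)\<^sup>2"
    using pos by (simp add: zero_le_mult_iff)
  then show ?thesis by (simp add: mult.commute)
qed

lemma Cauchy_Schwarz: "u \<in> H \<Longrightarrow> v \<in> H \<Longrightarrow> \<bar>B u v\<bar> \<le> nrm u * nrm v"
  using real_sqrt_le_mono[OF Cauchy_Schwarz_sq, of u v] by (simp add: nrm_def real_sqrt_mult)

lemma nrm_scale: "u \<in> H \<Longrightarrow> nrm (\<lambda>z. c * u z) = \<bar>c\<bar> * nrm u"
  using form_quad[of u u c 0] by (simp add: nrm_def real_sqrt_mult)

lemma nrm_add:
  assumes u: "u \<in> H" and v: "v \<in> H"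
  shows "nrm (\<lambda>z. u z + v z) \<le> nrm u + nrm v"
proof -
  have "B (\<lambda>z. u z + v z) (\<lambda>z. u z + v z) \<le> (nrm u + nrm v)\<^sup>2"
    using form_quad[OF u v, of 1 1] Cauchy_Schwarz[OF u v] nrm_sq[OF u] nrm_sq[OF v]
    by (simp add: power2_sum)
  then show ?thesis
    using u v by (simp add: nrm_def[of "\<lambda>z. u z + v z"] real_le_lsqrt)
qed

lemma nrm_diff_triangle:
  assumes "u \<in> H" "v \<in> H" "w \<in> H"
  shows "nrm (\<lambda>z. u z - w z) \<le> nrm (\<lambda>z. u z - v z) + nrm (\<lambda>z. v z - w z)"
  using nrm_add[OF diff_mem[OF assms(1,2)] diff_mem[OF assms(2,3)]] by simp

lemma nrm_minus_commute: "u \<in> H \<Longrightarrow> v \<in> H \<Longrightarrow> nrm (\<lambda>z. u z - v z) = nrm (\<lambda>z. v z - u z)"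
  using nrm_scale[OF diff_mem, of u v "-1"] by simp

lemma nrm_triangle_abs:
  assumes "u \<in> H" "v \<in> H"
  shows "\<bar>nrm u - nrm v\<bar> \<le> nrm (\<lambda>z. u z - v z)"
  using nrm_add[OF diff_mem[OF assms] assms(2)] nrm_add[OF diff_mem[OF assms(2,1)] assms(1)]
    nrm_minus_commute[OF assms] by simp

lemma nrm_tendsto:
  assumes "\<And>n. s n \<in> H" "u \<in> H" "(\<lambda>n. nrm (\<lambda>z. s n z - u z)) \<longlonglongrightarrow> 0"
  shows "(\<lambda>n. nrm (s n)) \<longlonglongrightarrow> nrm u"
proof -
  have "(\<lambda>n. nrm (s n) - nrm u) \<longlonglongrightarrow> 0"
    by (rule Lim_null_comparison[OF _ assms(3)]) (simp add: nrm_triangle_abs assms)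
  then show ?thesis by (simp add: LIM_zero_iff)
qed

text \<open>Relative to \<open>M\<close>, because one functional used below is a limit that is known
  to exist only on a subspace. The sign of \<open>C\<close> is left open; \<open>bdd_linE\<close>
  supplies a positive constant.\<close>

definition bdd_lin :: "(('a \<Rightarrow> real) \<Rightarrow> real) \<Rightarrow> ('a \<Rightarrow> real) set \<Rightarrow> bool" where
  "bdd_lin L M \<longleftrightarrow> (\<forall>u\<in>M. \<forall>v\<in>M. \<forall>c d. L (\<lambda>z. c * u z + d * v z) = c * L u + d * L v) \<and>
     (\<exists>C. \<forall>u\<in>M. \<bar>L u\<bar> \<le> C * nrm u)"

lemma bdd_lin_mono: "bdd_lin L M \<Longrightarrow> M' \<subseteq> M \<Longrightarrow> bdd_lin L M'"
  unfolding bdd_lin_def by blast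

lemma bdd_lin_form: "w \<in> H \<Longrightarrow> bdd_lin (B w) H"
  unfolding bdd_lin_def using form_lin_right Cauchy_Schwarz[of w] by blast

lemma bdd_linD: "bdd_lin L M \<Longrightarrow> u \<in> M \<Longrightarrow> v \<in> M \<Longrightarrow> L (\<lambda>z. c * u z + d * v z) = c * L u + d * L v"
  unfolding bdd_lin_def by blast

lemma bdd_lin_diff: "bdd_lin L M \<Longrightarrow> u \<in> M \<Longrightarrow> v \<in> M \<Longrightarrow> L (\<lambda>z. u z - v z) = L u - L v"
  using bdd_linD[of L M u v 1 "-1"] by simp

lemma bdd_linE:
  assumes "bdd_lin L M" "M \<subseteq> H"
  obtains C where "C > 0" "\<And>u. u \<in> M \<Longrightarrow> \<bar>L u\<bar> \<le> C * nrm u"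
proof -
  obtain C where C: "\<forall>u\<in>M. \<bar>L u\<bar> \<le> C * nrm u" using assms unfolding bdd_lin_def by blast
  have "\<bar>L u\<bar> \<le> (\<bar>C\<bar> + 1) * nrm u" if "u \<in> M" for u
  proof -
    have "C * nrm u \<le> (\<bar>C\<bar> + 1) * nrm u"
      using that assms(2) by (intro mult_right_mono) auto
    with C that show ?thesis by fastforce
  qed
  then show ?thesis using that[of "\<bar>C\<bar> + 1"] by fastforce
qed

lemma bdd_lin_tendsto:
  assumes "bdd_lin L H" "\<And>n. s n \<in> H" "u \<in> H" "(\<lambda>n. nrm (\<lambda>z. s n z - u z)) \<longlonglongrightarrow> 0"
  shows "(\<lambda>n. L (s n)) \<longlonglongrightarrow> L u"
proof -
  obtain C where C: "\<And>u. u \<in> H \<Longrightarrow> \<bar>L u\<bar> \<le> C * nrm u" using bdd_linE[OF assms(1)] by blast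
  have "(\<lambda>n. L (s n) - L u) \<longlonglongrightarrow> 0"
  proof (rule Lim_null_comparison)
    show "\<forall>\<^sub>F n in sequentially. norm (L (s n) - L u) \<le> C * nrm (\<lambda>z. s n z - u z)"
      using C[OF diff_mem[OF assms(2,3)]] by (simp add: bdd_lin_diff[OF assms(1)] assms)
    show "(\<lambda>n. C * nrm (\<lambda>z. s n z - u z)) \<longlonglongrightarrow> 0"
      using tendsto_mult_right_zero[OF assms(4)] .
  qed
  then show ?thesis by (simp add: LIM_zero_iff)
qed

end

locale complete_semi_inner = semi_inner +
  assumes complete: "\<And>s. (\<And>n. s n \<in> H) \<Longrightarrow>
      (\<forall>e>0. \<exists>N. \<forall>m\<ge>N. \<forall>n\<ge>N. nrm (\<lambda>z. s m z - s n z) < e) \<Longrightarrow>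
      \<exists>u\<in>H. (\<lambda>n. nrm (\<lambda>z. s n z - u z)) \<longlonglongrightarrow> 0"
begin

text \<open>Limits in a seminorm are not unique, so closedness asks that every limit in
  \<open>H\<close> belong to \<open>M\<close>. Completeness is assumed for \<open>H\<close> and
  carries over to \<open>M\<close> in this way.\<close>

definition csub :: "('a \<Rightarrow> real) set \<Rightarrow> bool" where
  "csub M \<longleftrightarrow> M \<subseteq> H \<and> M \<noteq> {} \<and> (\<forall>u\<in>M. \<forall>v\<in>M. \<forall>c d. (\<lambda>z. c * u z + d * v z) \<in> M) \<and>
     (\<forall>s u. (\<forall>n. s n \<in> M) \<longrightarrow> u \<in> H \<longrightarrow> (\<lambda>n. nrm (\<lambda>z. s n z - u z)) \<longlonglongrightarrow> 0 \<longrightarrow> u \<in> M)"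

lemma csub_whole: "csub H"
  unfolding csub_def using zero_mem lin_mem by blast

text \<open>Riesz by minimising \<open>q u = B u u - 2 * L u\<close>: the parallelogram law makes every minimising
  sequence Cauchy, and the first variation of \<open>q\<close> vanishes at the limit.\<close>

lemma Riesz:
  assumes M: "csub M" and L: "bdd_lin L M"
  shows "\<exists>g\<in>M. \<forall>\<psi>\<in>M. B g \<psi> = L \<psi>"
proof -
  have MH: "M \<subseteq> H" and linM: "\<And>u v c d. u \<in> M \<Longrightarrow> v \<in> M \<Longrightarrow> (\<lambda>z. c * u z + d * v z) \<in> M"
    and cl: "\<And>s u. (\<And>n. s n \<in> M) \<Longrightarrow> u \<in> H \<Longrightarrow> (\<lambda>n. nrm (\<lambda>z. s n z - u z)) \<longlonglongrightarrow> 0 \<Longrightarrow> u \<in> M"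
    and ne: "M \<noteq> {}"
    using M unfolding csub_def by blast+
  obtain C where C: "C > 0" "\<And>u. u \<in> M \<Longrightarrow> \<bar>L u\<bar> \<le> C * nrm u" using bdd_linE[OF L MH] by blast
  define q where "q u = B u u - 2 * L u" for u
  have qlow: "q u \<ge> - C\<^sup>2" if "u \<in> M" for u
  proof -
    have "q u \<ge> (nrm u)\<^sup>2 - 2 * (C * nrm u)"
      using C(2)[OF that] nrm_sq[of u] that MH unfolding q_def by auto
    moreover have "(nrm u)\<^sup>2 - 2 * (C * nrm u) = (nrm u - C)\<^sup>2 - C\<^sup>2"
      by (simp add: power2_eq_square algebra_simps)
    ultimately show ?thesis using zero_le_power2[of "nrm u - C"] by linarith
  qed
  define m where "m = Inf (q ` M)"
  have bdd: "bdd_below (q ` M)" using qlow by (intro bdd_belowI[of _ "- C\<^sup>2"]) auto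
  have mle: "m \<le> q u" if "u \<in> M" for u
    unfolding m_def using that bdd by (intro cInf_lower) auto
  have "\<exists>u\<in>M. q u < m + 1 / Suc n" for n
    using cInf_lessD[of "q ` M" "m + 1 / Suc n"] ne unfolding m_def by auto
  then obtain s where s: "\<And>n. s n \<in> M" "\<And>n. q (s n) < m + 1 / Suc n" by metis
  have sH: "s n \<in> H" for n using s(1) MH by auto
  \<comment> \<open>The linear parts cancel, since \<open>L\<close> at the midpoint is half of
    \<open>L u + L v\<close>.\<close>
  have par: "B (\<lambda>z. u z - v z) (\<lambda>z. u z - v z) = 2 * q u + 2 * q v - 4 * q (\<lambda>z. (1/2) * u z + (1/2) * v z)"
    if "u \<in> M" "v \<in> M" for u v
  proof -
    have h: "u \<in> H" "v \<in> H" using that MH by auto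
    show ?thesis
      unfolding q_def form_quad[OF h] form_quad_diff[OF h] bdd_linD[OF L that]
      by (simp add: power2_eq_square field_simps)
  qed
  have diffle: "(nrm (\<lambda>z. s i z - s j z))\<^sup>2 < 4 / Suc N" if "i \<ge> N" "j \<ge> N" for i j N
  proof -
    have "(nrm (\<lambda>z. s i z - s j z))\<^sup>2 \<le> 2 * q (s i) + 2 * q (s j) - 4 * m"
      using par[OF s(1) s(1), of i j] mle[OF linM[OF s(1) s(1), of "1/2" i "1/2" j]] nrm_sq[OF diff_mem[OF sH sH], of i j]
      by linarith
    also have "\<dots> < 2 / Suc i + 2 / Suc j" using s(2)[of i] s(2)[of j] by simp
    also have "\<dots> \<le> 2 / Suc N + 2 / Suc N"
      using that by (intro add_mono divide_left_mono) auto
    finally show ?thesis by simp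
  qed
  have "\<exists>N. \<forall>i\<ge>N. \<forall>j\<ge>N. nrm (\<lambda>z. s i z - s j z) < e" if "e > 0" for e
  proof -
    obtain N where N: "4 / e\<^sup>2 < real N" using reals_Archimedean2 by blast
    have "4 < real N * e\<^sup>2" using N that by (simp add: field_simps)
    then have "4 \<le> real (Suc N) * e\<^sup>2" using zero_le_power2[of e] by (simp only: of_nat_Suc distrib_right)
    then have "4 / Suc N \<le> e\<^sup>2" by (simp add: pos_divide_le_eq mult.commute)
    then have "(nrm (\<lambda>z. s i z - s j z))\<^sup>2 < e\<^sup>2" if "i \<ge> N" "j \<ge> N" for i j
      using diffle[OF that] by linarith
    then show ?thesis using that power2_less_imp_less by (metis less_imp_le)
  qed
  then obtain g where g: "g \<in> H" "(\<lambda>n. nrm (\<lambda>z. s n z - g z)) \<longlonglongrightarrow> 0"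
    using complete[of s] sH by blast
  have gM: "g \<in> M" using cl s(1) g by blast
  have "(\<lambda>n. L (s n)) \<longlonglongrightarrow> L g"
  proof -
    have "(\<lambda>n. L (s n) - L g) \<longlonglongrightarrow> 0"
    proof (rule Lim_null_comparison)
      show "\<forall>\<^sub>F n in sequentially. norm (L (s n) - L g) \<le> C * nrm (\<lambda>z. s n z - g z)"
        using C(2)[OF linM[OF s(1) gM, of 1 _ "-1"]] bdd_linD[OF L s(1) gM, of 1 _ "-1"] by simp
      show "(\<lambda>n. C * nrm (\<lambda>z. s n z - g z)) \<longlonglongrightarrow> 0"
        using tendsto_mult_right_zero[OF g(2)] .
    qed
    then show ?thesis by (simp add: LIM_zero_iff)
  qed
  moreover have "(\<lambda>n. B (s n) (s n)) \<longlonglongrightarrow> B g g"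
    using tendsto_power[OF nrm_tendsto[OF sH g], of 2] by (simp add: nrm_sq sH g)
  ultimately have "(\<lambda>n. q (s n)) \<longlonglongrightarrow> q g" unfolding q_def by (intro tendsto_intros)
  moreover have "(\<lambda>n. m + 1 / Suc n) \<longlonglongrightarrow> m + 0"
    using LIMSEQ_inverse_real_of_nat by (intro tendsto_intros) (simp add: inverse_eq_divide)
  ultimately have qg: "q g \<le> m"
    using s(2) less_imp_le by (intro LIMSEQ_le[of "\<lambda>n. q (s n)" _ "\<lambda>n. m + 1 / Suc n"]) auto
  have "B g \<psi> = L \<psi>" if psi: "\<psi> \<in> M" for \<psi>
  proof -
    have psiH: "\<psi> \<in> H" using psi MH by auto
    define d where "d = B g \<psi> - L \<psi>"
    have var: "0 \<le> 2 * t * d + t\<^sup>2 * B \<psi> \<psi>" for t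
      using mle[OF linM[OF gM psi, of 1 t]] qg form_quad[OF g(1) psiH, of 1 t] bdd_linD[OF L gM psi, of 1 t]
      unfolding q_def d_def by (simp add: algebra_simps)
    have "d = 0"
    proof (rule ccontr)
      assume d: "d \<noteq> 0"
      \<comment> \<open>The added 1 keeps the denominator positive when \<open>\<psi>\<close> is a
        null vector; \<open>- d / P\<close> minimises the quadratic of \<open>var\<close> with
        \<open>P\<close> in place of \<open>B \<psi> \<psi>\<close>.\<close>
      define P where "P = B \<psi> \<psi> + 1"
      have P: "P > 0" "B \<psi> \<psi> \<le> P" using form_nonneg[OF psiH] unfolding P_def by auto
      have "0 \<le> 2 * (- d / P) * d + (- d / P)\<^sup>2 * B \<psi> \<psi>" by (rule var)
      also have "\<dots> \<le> 2 * (- d / P) * d + (- d / P)\<^sup>2 * P"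
        using P by (intro add_left_mono mult_left_mono) auto
      also have "\<dots> = - (d\<^sup>2 / P)" using P by (simp add: power2_eq_square field_simps)
      finally have "d\<^sup>2 / P \<le> 0" by simp
      then show False using P(1) d by (simp add: divide_le_0_iff)
    qed
    then show ?thesis by (simp add: d_def)
  qed
  with gM show ?thesis by blast
qed

text \<open>Only the closed subspace \<open>M\<close> on which the diagonal subsequence converges is needed;
  it contains the sequence, so projecting a test vector onto \<open>M\<close> replaces separability.\<close>

lemma weakly_convergent_subsequence:
  assumes s: "\<And>n. s n \<in> H" and bnd: "\<And>n. nrm (s n) \<le> R"
  shows "\<exists>u r. u \<in> H \<and> strict_mono (r :: nat \<Rightarrow> nat) \<and> (\<forall>\<psi>\<in>H. (\<lambda>n. B (s (r n)) \<psi>) \<longlonglongrightarrow> B u \<psi>)"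
proof -
  have bndB: "\<bar>B (s n) v\<bar> \<le> R * nrm v" if "v \<in> H" for n v
    using Cauchy_Schwarz[OF s that, of n] mult_right_mono[OF bnd[of n] nrm_nonneg[OF that]] by linarith
  interpret dg: subseqs "\<lambda>k r. convergent (\<lambda>n. B (s (r n)) (s k))"
  proof
    fix k and t :: "nat \<Rightarrow> nat"
    have "bounded (range (\<lambda>n. B (s (t n)) (s k)))"
      using bndB[OF s] by (intro boundedI[of _ "R * nrm (s k)"]) auto
    then obtain l r where "strict_mono r" "((\<lambda>n. B (s (t n)) (s k)) \<circ> r) \<longlonglongrightarrow> l"
      using bounded_imp_convergent_subsequence by blast
    then show "\<exists>r'. strict_mono r' \<and> convergent (\<lambda>n. B (s ((t \<circ> r') n)) (s k))"
      unfolding convergent_def by (auto simp: o_def)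
  qed
  define r where "r = dg.diagseq"
  have r: "strict_mono r" unfolding r_def by (rule dg.subseq_diagseq)
  have conv: "convergent (\<lambda>n. B (s (r n)) (s k))" for k
  proof -
    \<comment> \<open>From index \<open>Suc k\<close> on, the diagonal sequence is a subsequence of
      the one selected at stage \<open>k\<close>; the shift drops the terms before that.\<close>
    have "convergent (\<lambda>n. B (s ((dg.diagseq \<circ> (+) (Suc k)) n)) (s k))"
    proof (rule dg.diagseq_holds)
      fix r t :: "nat \<Rightarrow> nat" and n
      assume "strict_mono r" "convergent (\<lambda>m. B (s (t m)) (s n))"
      then show "convergent (\<lambda>m. B (s ((t \<circ> r) m)) (s n))"
        using convergent_subseq_convergent[of "\<lambda>m. B (s (t m)) (s n)" r] by (simp add: o_def)
    qed
    then have "convergent (\<lambda>n. B (s (r (n + Suc k))) (s k))" by (simp add: r_def o_def add.commute)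
    then show ?thesis using convergent_ignore_initial_segment[of "\<lambda>n. B (s (r n)) (s k)" "Suc k"] by simp
  qed
  define M where "M = {v \<in> H. convergent (\<lambda>n. B (s (r n)) v)}"
  have sM: "s k \<in> M" for k using conv s by (simp add: M_def)
  have M: "csub M"
    unfolding csub_def
  proof (intro conjI allI impI ballI)
    show "M \<subseteq> H" "M \<noteq> {}" using sM unfolding M_def by auto
    fix u v c d assume uv: "u \<in> M" "v \<in> M"
    then show "(\<lambda>z. c * u z + d * v z) \<in> M"
      unfolding M_def by (auto simp: form_lin_right s lin_mem intro!: convergent_add convergent_mult convergent_const)
  next
    fix w u assume w: "\<forall>n. w n \<in> M" and u: "u \<in> H" and lim: "(\<lambda>n. nrm (\<lambda>z. w n z - u z)) \<longlonglongrightarrow> 0"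
    have wH: "w n \<in> H" for n using w by (simp add: M_def)
    have "Cauchy (\<lambda>n. B (s (r n)) u)"
    proof (rule metric_CauchyI)
      fix e :: real assume e: "e > 0"
      \<comment> \<open>A three-epsilon argument; \<open>\<bar>R\<bar> + 1\<close> replaces
        \<open>R\<close> to have a positive denominator.\<close>
      have R: "\<bar>R\<bar> + 1 > 0" by simp
      obtain k where k: "nrm (\<lambda>z. w k z - u z) < e / (3 * (\<bar>R\<bar> + 1))"
        using LIMSEQ_D[OF lim, of "e / (3 * (\<bar>R\<bar> + 1))"] e R nrm_nonneg[OF diff_mem[OF wH u]]
        by (metis abs_of_nonneg diff_zero divide_pos_pos le_refl mult_pos_pos real_norm_def zero_less_numeral)
      have small: "\<bar>B (s (r n)) (w k) - B (s (r n)) u\<bar> < e / 3" for n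
      proof -
        have "\<bar>B (s (r n)) (w k) - B (s (r n)) u\<bar> \<le> R * nrm (\<lambda>z. w k z - u z)"
          using bndB[OF diff_mem[OF wH u], of "r n" k] by (simp add: form_diff_right s wH u)
        also have "\<dots> \<le> (\<bar>R\<bar> + 1) * nrm (\<lambda>z. w k z - u z)"
          using nrm_nonneg[OF diff_mem[OF wH u]] by (intro mult_right_mono) auto
        also have "\<dots> < (\<bar>R\<bar> + 1) * (e / (3 * (\<bar>R\<bar> + 1)))"
          using k R by (intro mult_strict_left_mono)
        also have "\<dots> = e / 3" using R by (simp add: field_simps)
        finally show ?thesis .
      qed
      have "Cauchy (\<lambda>n. B (s (r n)) (w k))" using w by (simp add: M_def convergent_Cauchy)
      then obtain N where N: "\<And>m n. m \<ge> N \<Longrightarrow> n \<ge> N \<Longrightarrow> dist (B (s (r m)) (w k)) (B (s (r n)) (w k)) < e / 3"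
        using metric_CauchyD[of _ "e/3"] e by (metis divide_pos_pos zero_less_numeral)
      have "dist (B (s (r m)) u) (B (s (r n)) u) < e" if "m \<ge> N" "n \<ge> N" for m n
        using N[OF that] small[of m] small[of n] by (simp add: dist_real_def abs_if split: if_splits)
      then show "\<exists>N. \<forall>m\<ge>N. \<forall>n\<ge>N. dist (B (s (r m)) u) (B (s (r n)) u) < e" by blast
    qed
    then show "u \<in> M" using u by (simp add: M_def Cauchy_convergent_iff)
  qed
  have MH: "M \<subseteq> H" by (auto simp: M_def)
  \<comment> \<open>Off \<open>M\<close> the value of \<open>lim\<close> is unspecified; linearity
    and the bound are claimed on \<open>M\<close> only.\<close>
  define L where "L v = lim (\<lambda>n. B (s (r n)) v)" for v
  have Llim: "(\<lambda>n. B (s (r n)) v) \<longlonglongrightarrow> L v" if "v \<in> M" for v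
    using that by (simp add: M_def L_def convergent_LIMSEQ_iff)
  have "bdd_lin L M"
    unfolding bdd_lin_def
  proof (intro conjI ballI allI exI)
    fix u v c d assume uv: "u \<in> M" "v \<in> M"
    have "(\<lambda>n. c * B (s (r n)) u + d * B (s (r n)) v) \<longlonglongrightarrow> c * L u + d * L v"
      using Llim uv by (intro tendsto_intros)
    moreover have "(\<lambda>n. c * B (s (r n)) u + d * B (s (r n)) v) = (\<lambda>n. B (s (r n)) (\<lambda>z. c * u z + d * v z))"
      using uv MH by (auto simp: form_lin_right s subset_iff)
    ultimately show "L (\<lambda>z. c * u z + d * v z) = c * L u + d * L v"
      unfolding L_def[of "\<lambda>z. c * u z + d * v z"] using limI by auto
  next
    fix u assume u: "u \<in> M"
    show "\<bar>L u\<bar> \<le> R * nrm u"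
      using tendsto_rabs[OF Llim[OF u]] bndB u MH
      by (intro LIMSEQ_le_const2[of "\<lambda>n. \<bar>B (s (r n)) u\<bar>"]) auto
  qed
  from Riesz[OF M this] obtain u where u: "u \<in> M" "\<And>v. v \<in> M \<Longrightarrow> B u v = L v" by blast
  have "(\<lambda>n. B (s (r n)) \<psi>) \<longlonglongrightarrow> B u \<psi>" if psi: "\<psi> \<in> H" for \<psi>
  proof -
    \<comment> \<open>\<open>p\<close> is the projection of \<open>\<psi>\<close> to
      \<open>M\<close>. The sequence and \<open>u\<close> both lie in \<open>M\<close>, so the form
      cannot tell \<open>p\<close> from \<open>\<psi>\<close> against them.\<close>
    obtain p where p: "p \<in> M" "\<And>v. v \<in> M \<Longrightarrow> B p v = B \<psi> v"
      using Riesz[OF M bdd_lin_mono[OF bdd_lin_form[OF psi] MH]] by blast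
    have "B (s (r n)) \<psi> = B (s (r n)) p" for n using p(2)[OF sM] form_sym by metis
    moreover have "B u \<psi> = L p" using p(2)[OF u(1)] u(2)[OF p(1)] form_sym by metis
    ultimately show ?thesis using Llim[OF p(1)] by simp
  qed
  then show ?thesis using u MH r by blast
qed

text \<open>By Riesz on the whole space, \<open>L\<close> is the form against a fixed vector, and
  weak convergence is convergence of exactly these functionals.\<close>

lemma bdd_lin_weak_tendsto:
  assumes L: "bdd_lin L H" and w: "\<And>\<psi>. \<psi> \<in> H \<Longrightarrow> (\<lambda>n. B (s n) \<psi>) \<longlonglongrightarrow> B u \<psi>"
    and s: "\<And>n. s n \<in> H" and u: "u \<in> H"
  shows "(\<lambda>n. L (s n)) \<longlonglongrightarrow> L u"
proof -
  obtain g where g: "g \<in> H" "\<And>\<psi>. \<psi> \<in> H \<Longrightarrow> B g \<psi> = L \<psi>"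
    using Riesz[OF csub_whole L] by blast
  show ?thesis using w[OF g(1)] g(2) s u by (simp add: form_sym[of _ g])
qed

end

section \<open>Calculus of test functions\<close>

lemma smooth2_dx:
  assumes "smooth2 g"
  shows "((\<lambda>t. ipd ds g (t, y)) has_real_derivative ipd (True # ds) g (x, y)) (at x)"
proof -
  have "(\<lambda>t. ipd ds g (t, snd (x, y))) differentiable (at (fst (x, y)))"
    using assms unfolding smooth2_def by blast
  then show ?thesis
    using DERIV_deriv_iff_real_differentiable[of "\<lambda>t. ipd ds g (t, y)" x] by (simp add: pdx_def)
qed

lemma smooth2_dy:
  assumes "smooth2 g"
  shows "((\<lambda>t. ipd ds g (x, t)) has_real_derivative ipd (False # ds) g (x, y)) (at y)"
proof -
  have "(\<lambda>t. ipd ds g (fst (x, y), t)) differentiable (at (snd (x, y)))"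
    using assms unfolding smooth2_def by blast
  then show ?thesis
    using DERIV_deriv_iff_real_differentiable[of "\<lambda>t. ipd ds g (x, t)" y] by (simp add: pdy_def)
qed

lemma ipd_append: "ipd (ds @ es) g = ipd ds (ipd es g)"
proof (induction ds)
  case (Cons d ds)
  then show ?case by (cases d) auto
qed simp

lemma smooth2_ipd: "smooth2 g \<Longrightarrow> smooth2 (ipd ds g)"
  unfolding smooth2_def ipd_append[symmetric] by blast

lemma smooth2_continuous: "smooth2 g \<Longrightarrow> continuous_on UNIV (ipd ds g)"
  unfolding smooth2_def by blast

text \<open>A class of continuous functions that is closed under both partial derivatives contains
  all iterated partials of its members, so smoothness follows without a formula for the higher
  derivatives.\<close>

lemma smooth2_coinduct:
  assumes "g \<in> S"
    and cont: "\<And>g. g \<in> S \<Longrightarrow> continuous_on UNIV g"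
    and dx: "\<And>g. g \<in> S \<Longrightarrow> \<exists>h\<in>S. \<forall>x y. ((\<lambda>t. g (t, y)) has_real_derivative h (x, y)) (at x)"
    and dy: "\<And>g. g \<in> S \<Longrightarrow> \<exists>h\<in>S. \<forall>x y. ((\<lambda>t. g (x, t)) has_real_derivative h (x, y)) (at y)"
  shows "smooth2 g"
proof -
  have px: "pdx g \<in> S" if g: "g \<in> S" for g
  proof -
    obtain h where h: "h \<in> S" "\<And>x y. ((\<lambda>t. g (t, y)) has_real_derivative h (x, y)) (at x)" using dx[OF g] by blast
    then have "pdx g = h" by (auto simp: pdx_def fun_eq_iff intro!: DERIV_imp_deriv)
    with h show ?thesis by simp
  qed
  have py: "pdy g \<in> S" if g: "g \<in> S" for g
  proof -
    obtain h where h: "h \<in> S" "\<And>x y. ((\<lambda>t. g (x, t)) has_real_derivative h (x, y)) (at y)" using dy[OF g] by blast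
    then have "pdy g = h" by (auto simp: pdy_def fun_eq_iff intro!: DERIV_imp_deriv)
    with h show ?thesis by simp
  qed
  have mem: "ipd ds g \<in> S" for ds
  proof (induction ds)
    case (Cons d ds)
    then show ?case using px py by (cases d) auto
  qed (simp add: assms(1))
  show ?thesis
    unfolding smooth2_def real_differentiable_def using cont[OF mem] dx[OF mem] dy[OF mem] by blast
qed

lemma ipd_lincomb:
  assumes "smooth2 g" "smooth2 h"
  shows "ipd ds (\<lambda>z. c * g z + d * h z) = (\<lambda>z. c * ipd ds g z + d * ipd ds h z)"
proof (induction ds)
  case (Cons b ds)
  show ?case
  proof (cases b)
    case True
    have "((\<lambda>t. c * ipd ds g (t, y) + d * ipd ds h (t, y)) has_real_derivative
        c * ipd (True # ds) g (x, y) + d * ipd (True # ds) h (x, y)) (at x)" for x y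
      by (intro DERIV_add DERIV_cmult smooth2_dx assms)
    from DERIV_imp_deriv[OF this] show ?thesis
      by (simp add: Cons \<open>b\<close>) (auto simp: fun_eq_iff pdx_def[of "\<lambda>z. c * ipd ds g z + d * ipd ds h z"])
  next
    case False
    have "((\<lambda>t. c * ipd ds g (x, t) + d * ipd ds h (x, t)) has_real_derivative
        c * ipd (False # ds) g (x, y) + d * ipd (False # ds) h (x, y)) (at y)" for x y
      by (intro DERIV_add DERIV_cmult smooth2_dy assms)
    from DERIV_imp_deriv[OF this] show ?thesis
      by (simp add: Cons \<open>\<not> b\<close>) (auto simp: fun_eq_iff pdy_def[of "\<lambda>z. c * ipd ds g z + d * ipd ds h z"])
  qed
qed simp

lemma smooth2_lincomb:
  assumes "smooth2 g" "smooth2 h"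
  shows "smooth2 (\<lambda>z. c * g z + d * h z)"
  unfolding smooth2_def ipd_lincomb[OF assms] real_differentiable_def
proof (intro allI conjI exI)
  fix ds and z :: "real \<times> real"
  show "continuous_on UNIV (\<lambda>z. c * ipd ds g z + d * ipd ds h z)"
    using assms by (intro continuous_intros smooth2_continuous)
  show "((\<lambda>t. c * ipd ds g (t, snd z) + d * ipd ds h (t, snd z)) has_real_derivative
      c * ipd (True # ds) g (fst z, snd z) + d * ipd (True # ds) h (fst z, snd z)) (at (fst z))"
    by (intro DERIV_add DERIV_cmult smooth2_dx assms)
  show "((\<lambda>t. c * ipd ds g (fst z, t) + d * ipd ds h (fst z, t)) has_real_derivative
      c * ipd (False # ds) g (fst z, snd z) + d * ipd (False # ds) h (fst z, snd z)) (at (snd z))"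
    by (intro DERIV_add DERIV_cmult smooth2_dy assms)
qed

section \<open>Supports and the space of test functions\<close>

lemma csupp_closed: "closed (csupp g)" by (simp add: csupp_def)

lemma csupp_outside: "z \<notin> csupp g \<Longrightarrow> g z = 0"
  unfolding csupp_def using closure_subset[of "{z. g z \<noteq> 0}"] by blast

lemma csupp_subset: "(\<And>z. z \<notin> K \<Longrightarrow> g z = 0) \<Longrightarrow> closed K \<Longrightarrow> csupp g \<subseteq> K"
  unfolding csupp_def by (intro closure_minimal) auto

text \<open>The complement of the support is open, so \<open>g\<close> vanishes on a coordinate
  segment around \<open>z\<close> and not merely at \<open>z\<close>; that determines the
  derivative.\<close>

lemma pd_outside_csupp:
  assumes z: "z \<notin> csupp g"
  shows "pdx g z = 0" "pdy g z = 0"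
proof -
  obtain x y where xy: "z = (x, y)" by (cases z)
  have op: "open (- csupp g)" by (simp add: csupp_closed open_Compl)
  have o1: "open ((\<lambda>t. (t, y)) -` (- csupp g))" "open ((\<lambda>t. (x, t)) -` (- csupp g))"
    by (intro open_vimage op continuous_intros)+
  have e1: "\<forall>\<^sub>F t in nhds x. g (t, y) = 0"
    using eventually_nhds_in_open[OF o1(1), of x] z xy
    by (auto elim!: eventually_mono simp: csupp_outside)
  have e2: "\<forall>\<^sub>F t in nhds y. g (x, t) = 0"
    using eventually_nhds_in_open[OF o1(2), of y] z xy
    by (auto elim!: eventually_mono simp: csupp_outside)
  show "pdx g z = 0" using deriv_cong_ev[OF e1 refl] by (simp add: pdx_def xy)
  show "pdy g z = 0" using deriv_cong_ev[OF e2 refl] by (simp add: pdy_def xy)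
qed

lemma csupp_ipd: "csupp (ipd ds g) \<subseteq> csupp g"
proof (induction ds)
  case (Cons d ds)
  have "csupp (ipd (d # ds) g) \<subseteq> csupp (ipd ds g)"
    by (rule csupp_subset[OF _ csupp_closed]) (cases d; simp add: pd_outside_csupp)
  with Cons show ?case by blast
qed simp

lemma compact_csupp_subset: "compact (csupp g) \<Longrightarrow> csupp h \<subseteq> csupp g \<Longrightarrow> compact (csupp h)"
  using compact_Int_closed[OF _ csupp_closed[of h], of "csupp g"] by (simp add: Int_absorb1)

lemma test_fun_ipd: "test_fun \<Omega> g \<Longrightarrow> test_fun \<Omega> (ipd ds g)"
  unfolding test_fun_def using smooth2_ipd csupp_ipd compact_csupp_subset by blast

lemma test_fun_smooth: "test_fun \<Omega> g \<Longrightarrow> smooth2 g" by (simp add: test_fun_def)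

lemma test_fun_continuous: "test_fun \<Omega> g \<Longrightarrow> continuous_on UNIV (ipd ds g)"
  by (simp add: test_fun_def smooth2_continuous)

lemma test_fun_lincomb:
  assumes "test_fun \<Omega> g" "test_fun \<Omega> h"
  shows "test_fun \<Omega> (\<lambda>z. c * g z + d * h z)"
proof -
  have sub: "csupp (\<lambda>z. c * g z + d * h z) \<subseteq> csupp g \<union> csupp h"
    by (rule csupp_subset) (auto simp: csupp_outside csupp_closed)
  have "compact (csupp g \<union> csupp h)" using assms by (auto simp: test_fun_def)
  then have "compact (csupp (\<lambda>z. c * g z + d * h z))"
    using compact_Int_closed[OF _ csupp_closed[of "\<lambda>z. c * g z + d * h z"], of "csupp g \<union> csupp h"] sub
    by (simp add: Int_absorb1)
  then show ?thesis
    using assms sub smooth2_lincomb by (auto simp: test_fun_def)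
qed

lemma test_fun_zero: "test_fun \<Omega> (\<lambda>z. 0)"
proof -
  have "smooth2 (\<lambda>z. 0)"
    by (rule smooth2_coinduct[of _ "{\<lambda>z. 0}"]) auto
  then show ?thesis by (simp add: test_fun_def csupp_def)
qed

text \<open>Stated over any Euclidean space because it is applied both to functions on the plane and
  to their restrictions to lines. A vanishing radius is easier to combine than a compact
  support.\<close>

definition ccs :: "('a::euclidean_space \<Rightarrow> real) \<Rightarrow> bool" where
  "ccs F \<longleftrightarrow> continuous_on UNIV F \<and> (\<exists>R. \<forall>z. norm z > R \<longrightarrow> F z = 0)"

lemma ccsI: "continuous_on UNIV F \<Longrightarrow> (\<And>z. norm z > R \<Longrightarrow> F z = 0) \<Longrightarrow> ccs F"
  unfolding ccs_def by blast

lemma ccs_continuous: "ccs F \<Longrightarrow> continuous_on UNIV F" by (simp add: ccs_def)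

lemma ccs_test_fun:
  assumes "test_fun \<Omega> g"
  shows "ccs (ipd ds g)"
proof -
  have "bounded (csupp g)" using assms by (simp add: test_fun_def compact_imp_bounded)
  then obtain R where R: "\<And>z. z \<in> csupp g \<Longrightarrow> norm z \<le> R" by (auto simp: bounded_iff)
  have "ipd ds g z = 0" if "norm z > R" for z
    using csupp_outside[of z "ipd ds g"] csupp_ipd[of ds g] R[of z] that by force
  then show ?thesis using ccsI[OF test_fun_continuous[OF assms]] by blast
qed

lemma ccs_mult_right: "continuous_on UNIV F \<Longrightarrow> ccs G \<Longrightarrow> ccs (\<lambda>z. F z * G z)"
  unfolding ccs_def by (auto intro: continuous_on_mult)

lemma ccs_mult: "ccs F \<Longrightarrow> ccs G \<Longrightarrow> ccs (\<lambda>z. F z * G z)"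
  by (simp add: ccs_mult_right ccs_continuous)

lemma ccs_lincomb:
  assumes "ccs F" "ccs G"
  shows "ccs (\<lambda>z. c * F z + d * G z)"
proof -
  obtain R S where "\<And>z. norm z > R \<Longrightarrow> F z = 0" "\<And>z. norm z > S \<Longrightarrow> G z = 0"
    using assms unfolding ccs_def by blast
  then show ?thesis
    using assms by (intro ccsI[of _ "max R S"]) (auto simp: ccs_def intro!: continuous_intros)
qed

lemma ccs_add: "ccs F \<Longrightarrow> ccs G \<Longrightarrow> ccs (\<lambda>z. F z + G z)"
  using ccs_lincomb[of F G 1 1] by simp

lemma ccs_diff: "ccs F \<Longrightarrow> ccs G \<Longrightarrow> ccs (\<lambda>z. F z - G z)"
  using ccs_lincomb[of F G 1 "-1"] by simp

lemma integrable_ccs: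
  assumes "ccs F"
  shows "integrable lborel F"
proof -
  obtain R where R: "\<And>z. norm z > R \<Longrightarrow> F z = 0" using assms unfolding ccs_def by blast
  have "integrable lborel (\<lambda>z. indicator (cball 0 R) z *\<^sub>R F z)"
    using assms continuous_on_subset by (intro borel_integrable_compact) (auto simp: ccs_def)
  moreover have "(\<lambda>z. indicator (cball 0 R) z *\<^sub>R F z) = F"
    using R by (auto simp: fun_eq_iff indicator_def not_le)
  ultimately show ?thesis by simp
qed

lemma ccs_bounded:
  assumes "ccs F"
  obtains C where "C > 0" "\<And>z. \<bar>F z\<bar> \<le> C"
proof -
  obtain R where R: "\<And>z. norm z > R \<Longrightarrow> F z = 0" using assms unfolding ccs_def by blast
  have "compact (F ` cball 0 R)"
    using assms continuous_on_subset by (intro compact_continuous_image) (auto simp: ccs_def)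
  then obtain C where C: "\<And>z. z \<in> cball 0 R \<Longrightarrow> \<bar>F z\<bar> \<le> C"
    using compact_imp_bounded[of "F ` cball 0 R"] by (metis bounded_iff imageI real_norm_def)
  have "\<bar>F z\<bar> \<le> \<bar>C\<bar> + 1" for z
  proof (cases "norm z \<le> R")
    case True
    then show ?thesis using C[of z] by simp
  next
    case False
    then show ?thesis using R[of z] by simp
  qed
  then show ?thesis using that[of "\<bar>C\<bar> + 1"] by force
qed

lemma ccs_section:
  fixes F :: "real \<times> real \<Rightarrow> real"
  assumes "ccs F"
  shows "ccs (\<lambda>t. F (t, y))" "ccs (\<lambda>t. F (x, t))"
proof -
  obtain R where R: "\<And>z. norm z > R \<Longrightarrow> F z = 0" using assms unfolding ccs_def by blast
  have "continuous_on UNIV (\<lambda>t. F (t, y))" "continuous_on UNIV (\<lambda>t. F (x, t))"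
    by (intro continuous_on_compose2[OF ccs_continuous[OF assms]] continuous_intros; simp)+
  moreover have "norm (t, y) > R" if "norm t > R" for t
    using that norm_fst_le[of t y] by simp
  moreover have "norm (x, t) > R" if "norm t > R" for t
    using that norm_snd_le[of t x] by simp
  ultimately show "ccs (\<lambda>t. F (t, y))" "ccs (\<lambda>t. F (x, t))"
    using R by (auto intro!: ccsI[of _ R])
qed

lemma integral_halfline_deriv:
  fixes F F' :: "real \<Rightarrow> real"
  assumes d: "\<And>x. (F has_real_derivative F' x) (at x)" and F: "ccs F" and F': "ccs F'"
  shows "(\<integral>t. indicator {..x} t * F' t \<partial>lborel) = F x" "(\<integral>t. F' t \<partial>lborel) = 0"
proof -
  obtain R1 where R1: "\<And>z. norm z > R1 \<Longrightarrow> F z = 0" using F unfolding ccs_def by blast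
  obtain R2 where R2: "\<And>z. norm z > R2 \<Longrightarrow> F' z = 0" using F' unfolding ccs_def by blast
  \<comment> \<open>\<open>F\<close> and \<open>F'\<close> are known to vanish only strictly beyond
    \<open>R1\<close> and \<open>R2\<close>; the extra 1 makes the point \<open>R\<close> itself
    safe.\<close>
  define R where "R = \<bar>R1\<bar> + \<bar>R2\<bar> + 1"
  have FTC: "(\<integral>t. indicator {a..b} t * F' t \<partial>lborel) = F b - F a" if "a \<le> b" for a b
  proof -
    have "(\<integral>t. indicator {a..b} t *\<^sub>R F' t \<partial>lborel) = F b - F a"
    proof (rule integral_FTC_atLeastAtMost[OF that])
      fix t
      show "(F has_vector_derivative F' t) (at t within {a..b})"
        using has_field_derivative_at_within[OF d[of t]] by (simp add: has_real_derivative_iff_has_vector_derivative)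
      show "continuous_on {a..b} F'" using continuous_on_subset[OF ccs_continuous[OF F']] by blast
    qed
    then show ?thesis by simp
  qed
  have z: "F (- S) = 0" "F S = 0" "\<And>t. \<bar>t\<bar> > S \<Longrightarrow> F' t = 0" if "S \<ge> R" for S
    using that by (auto simp: R_def intro!: R1 R2)
  \<comment> \<open>A point to the left of \<open>x\<close> and of the support, so the half-line
    integral becomes one over \<open>{a..x}\<close> with \<open>F a = 0\<close>.\<close>
  define a where "a = - R - \<bar>x\<bar>"
  have "F' t = 0" if "t < a" for t using z(3)[of "R + \<bar>x\<bar>" t] that by (simp add: a_def R_def)
  then have "(\<lambda>t. indicator {..x} t * F' t) = (\<lambda>t. indicator {a..x} t * F' t)"
    by (auto simp: fun_eq_iff indicator_def not_le)
  moreover have "a \<le> x" "F a = 0" using z(1)[of "R + \<bar>x\<bar>"] by (auto simp: a_def R_def)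
  ultimately show "(\<integral>t. indicator {..x} t * F' t \<partial>lborel) = F x" using FTC[of a x] by simp
  have "F' t = 0" if "t \<notin> {-R..R}" for t using z(3)[of R t] that by force
  then have "F' = (\<lambda>t. indicator {-R..R} t * F' t)"
    by (auto simp: fun_eq_iff indicator_def simp del: atLeastAtMost_iff)
  then show "(\<integral>t. F' t \<partial>lborel) = 0" using FTC[of "-R" R] z(1,2)[of R] by (simp add: R_def)
qed

lemma integral_prod_lborel:
  fixes F :: "real \<times> real \<Rightarrow> real"
  assumes "integrable lborel F"
  shows "integral\<^sup>L lborel F = (\<integral>x. \<integral>y. F (x, y) \<partial>lborel \<partial>lborel)"
    "integral\<^sup>L lborel F = (\<integral>y. \<integral>x. F (x, y) \<partial>lborel \<partial>lborel)"
  using lborel_pair.integral_fst'[of F] lborel_pair.integral_snd[of "curry F"] assms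
  by (simp_all add: lborel_prod)

lemma integral_dx_zero:
  fixes F F' :: "real \<times> real \<Rightarrow> real"
  assumes d: "\<And>x y. ((\<lambda>t. F (t, y)) has_real_derivative F' (x, y)) (at x)" and F: "ccs F" and F': "ccs F'"
  shows "(\<integral>z. F' z \<partial>lborel) = 0"
  using integral_halfline_deriv(2)[OF d ccs_section(1)[OF F] ccs_section(1)[OF F']]
  by (simp add: integral_prod_lborel(2)[OF integrable_ccs[OF F']])

lemma integral_dy_zero:
  fixes F F' :: "real \<times> real \<Rightarrow> real"
  assumes d: "\<And>x y. ((\<lambda>t. F (x, t)) has_real_derivative F' (x, y)) (at y)" and F: "ccs F" and F': "ccs F'"
  shows "(\<integral>z. F' z \<partial>lborel) = 0"
  using integral_halfline_deriv(2)[OF d ccs_section(2)[OF F] ccs_section(2)[OF F']]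
  by (simp add: integral_prod_lborel(1)[OF integrable_ccs[OF F']])

section \<open>Quadrants: recovering a function from its mixed derivative, and a criterion for
  vanishing a.e\<close>

definition quadrant :: "pt \<Rightarrow> pt set" where "quadrant z = {..fst z} \<times> {..snd z}"

lemma quadrant_borel [measurable]: "quadrant z \<in> sets borel"
  unfolding quadrant_def by (intro borel_closed closed_Times) auto

lemma integrable_quadrant: "ccs F \<Longrightarrow> integrable lborel (\<lambda>w. indicator (quadrant z) w * F w)"
  using integrable_mult_indicator[OF _ integrable_ccs, of "quadrant z" F] by simp

text \<open>Fubini and the half-line formula in each variable. It is needed for both orders of
  differentiation, since comparing the two is what proves that they agree.\<close>

lemma integral_quadrant_dxdy:
  fixes F F1 F2 :: "real \<times> real \<Rightarrow> real"
  assumes "\<And>x y. ((\<lambda>t. F (t, y)) has_real_derivative F1 (x, y)) (at x)"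
    "\<And>x y. ((\<lambda>t. F1 (x, t)) has_real_derivative F2 (x, y)) (at y)"
    and F: "ccs F" "ccs F1" "ccs F2"
  shows "(\<integral>w. indicator (quadrant z) w * F2 w \<partial>lborel) = F z"
proof -
  have "(\<integral>w. indicator (quadrant z) w * F2 w \<partial>lborel)
      = (\<integral>x. \<integral>y. indicator {..fst z} x * (indicator {..snd z} y * F2 (x, y)) \<partial>lborel \<partial>lborel)"
    unfolding integral_prod_lborel(1)[OF integrable_quadrant[OF F(3)]]
    by (intro Bochner_Integration.integral_cong refl) (simp add: quadrant_def indicator_times)
  also have "\<dots> = (\<integral>x. indicator {..fst z} x * F1 (x, snd z) \<partial>lborel)"
    using integral_halfline_deriv(1)[OF assms(2) ccs_section(2)[OF F(2)] ccs_section(2)[OF F(3)]] by simp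
  also have "\<dots> = F z"
    using integral_halfline_deriv(1)[OF assms(1) ccs_section(1)[OF F(1)] ccs_section(1)[OF F(2)]] by simp
  finally show ?thesis .
qed

lemma integral_quadrant_dydx:
  fixes F F1 F2 :: "real \<times> real \<Rightarrow> real"
  assumes "\<And>x y. ((\<lambda>t. F (x, t)) has_real_derivative F1 (x, y)) (at y)"
    "\<And>x y. ((\<lambda>t. F1 (t, y)) has_real_derivative F2 (x, y)) (at x)"
    and F: "ccs F" "ccs F1" "ccs F2"
  shows "(\<integral>w. indicator (quadrant z) w * F2 w \<partial>lborel) = F z"
proof -
  have "(\<integral>w. indicator (quadrant z) w * F2 w \<partial>lborel)
      = (\<integral>y. \<integral>x. indicator {..snd z} y * (indicator {..fst z} x * F2 (x, y)) \<partial>lborel \<partial>lborel)"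
    unfolding integral_prod_lborel(2)[OF integrable_quadrant[OF F(3)]]
    by (intro Bochner_Integration.integral_cong refl) (simp add: quadrant_def indicator_times)
  also have "\<dots> = (\<integral>y. indicator {..snd z} y * F1 (fst z, y) \<partial>lborel)"
    using integral_halfline_deriv(1)[OF assms(2) ccs_section(1)[OF F(2)] ccs_section(1)[OF F(3)]] by simp
  also have "\<dots> = F z"
    using integral_halfline_deriv(1)[OF assms(1) ccs_section(2)[OF F(1)] ccs_section(2)[OF F(2)]] by simp
  finally show ?thesis .
qed

text \<open>Quadrants are stable under intersection and generate the Borel sets, so Dynkin's
  argument extends the vanishing integrals to all Borel sets; the signed density is then zero
  a.e.\<close>

lemma AE_zero_if_quadrant_integrals_zero:
  fixes g :: "real \<times> real \<Rightarrow> real"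
  assumes g: "integrable lborel g" and q: "\<And>z. (\<integral>w. indicator (quadrant z) w * g w \<partial>lborel) = 0"
  shows "AE w in lborel. g w = 0"
proof -
  have [measurable]: "g \<in> borel_measurable borel" using g by simp
  have int: "integrable lborel (\<lambda>w. indicator A w * g w)" if "A \<in> sets borel" for A
    using integrable_mult_indicator[OF _ g, of A] that by simp
  \<comment> \<open>The complement step of the induction needs the integral over the whole plane,
    which growing quadrants exhaust.\<close>
  have "(\<lambda>n. \<integral>w. indicator (quadrant (real n, real n)) w * g w \<partial>lborel) \<longlonglongrightarrow> integral\<^sup>L lborel g"
  proof (rule integral_dominated_convergence[where w = "\<lambda>w. \<bar>g w\<bar>"])
    show "AE w in lborel. (\<lambda>n. indicator (quadrant (real n, real n)) w * g w) \<longlonglongrightarrow> g w"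
    proof (intro AE_I2 tendsto_eventually)
      fix w :: "real \<times> real"
      obtain N where N: "max (fst w) (snd w) \<le> real N" using real_arch_simple by blast
      show "\<forall>\<^sub>F n in sequentially. indicator (quadrant (real n, real n)) w * g w = g w"
        using eventually_ge_at_top[of N]
      proof eventually_elim
        case (elim n)
        then have "w \<in> quadrant (real n, real n)" using N by (cases w) (auto simp: quadrant_def)
        then show ?case by simp
      qed
    qed
  qed (use g in \<open>auto simp: indicator_def\<close>)
  then have tot: "integral\<^sup>L lborel g = 0" using LIMSEQ_unique[OF _ tendsto_const[of 0]] by (simp add: q)
  \<comment> \<open>Quadrants are the sets \<open>{..a}\<close> of the componentwise order, a known
    generator of the Borel sets.\<close>
  have gen: "sets borel = sigma_sets UNIV (range quadrant)"
  proof -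
    have "(\<lambda>a::real \<times> real. {..a}) = quadrant"
      by (auto simp: quadrant_def fun_eq_iff less_eq_prod_def)
    then have "(borel :: (real \<times> real) measure) = sigma UNIV (range quadrant)"
      using borel_eq_atMost[where 'a = "real \<times> real"] by simp
    from arg_cong[OF this, of sets] show ?thesis by (simp add: sets_measure_of)
  qed
  have stable: "Int_stable (range quadrant)"
  proof (rule Int_stableI)
    fix a b assume "a \<in> range quadrant" "b \<in> range quadrant"
    then obtain u v where "a = quadrant u" "b = quadrant v" by auto
    then have "a \<inter> b = quadrant (min (fst u) (fst v), min (snd u) (snd v))"
      by (auto simp: quadrant_def)
    then show "a \<inter> b \<in> range quadrant" by blast
  qed
  have all: "(\<integral>w. indicator A w * g w \<partial>lborel) = 0" if "A \<in> sets borel" for A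
  proof -
    have sub: "range quadrant \<subseteq> Pow UNIV" by simp
    have "A \<in> sigma_sets UNIV (range quadrant)" using that gen by simp
    from stable sub this show ?thesis
    proof (induction rule: sigma_sets_induct_disjoint)
      case (compl A)
      then have A: "A \<in> sets borel" by (simp add: gen)
      have "(\<lambda>w. indicator (UNIV - A) w * g w) = (\<lambda>w. g w - indicator A w * g w)"
        by (auto simp: fun_eq_iff indicator_def)
      then show ?case using int[OF A] g compl tot by simp
    next
      case (union A)
      have A: "A i \<in> sets borel" for i using union(2) gen by auto
      have "(LINT w:(\<Union>i. A i)|lborel. g w) = (\<Sum>i. LINT w:A i|lborel. g w)"
      proof (rule lebesgue_integral_countable_add)
        show "\<And>i. A i \<in> sets lborel" using A by simp
        show "\<And>i j. i \<noteq> j \<Longrightarrow> A i \<inter> A j = {}" using union(1) by (auto simp: disjoint_family_on_def)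
        show "set_integrable lborel (\<Union>i. A i) g"
          using int[of "\<Union>i. A i"] A by (simp add: set_integrable_def sets.countable_UN)
      qed
      then show ?case using union(3) by (simp add: set_lebesgue_integral_def)
    qed (use q in auto)
  qed
  have "AE w in lborel. g w = (\<lambda>_. 0) w"
    by (rule density_unique_real) (use g all in \<open>auto simp: set_lebesgue_integral_def\<close>)
  then show ?thesis by simp
qed

lemma continuous_AE_zero:
  fixes F :: "'a::euclidean_space \<Rightarrow> real"
  assumes "continuous_on UNIV F" "AE w in lborel. F w = 0"
  shows "F z = 0"
proof (rule ccontr)
  assume nz: "F z \<noteq> 0"
  have op: "open {w. F w \<noteq> 0}" using assms(1) by (intro open_Collect_neq) auto
  then obtain e where e: "e > 0" "ball z e \<subseteq> {w. F w \<noteq> 0}" using nz openE by blast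
  have "emeasure lborel {w \<in> space lborel. F w \<noteq> 0} = 0"
    using assms(2) op by (subst AE_iff_measurable[symmetric, of _ lborel "\<lambda>w. F w = 0"]) auto
  then have "emeasure lborel (ball z e) = 0"
    using emeasure_mono[of "ball z e" "{w. F w \<noteq> 0}" lborel] e(2) op by simp
  then show False using emeasure_lborel_ball_finite[of z e] e(1)
    using content_ball_pos[of e z] by (simp add: measure_def)
qed

text \<open>Both mixed derivatives integrate to \<open>g z\<close> over every quadrant. Their
  difference is therefore zero a.e., and by continuity everywhere.\<close>

lemma pd_commute:
  assumes g: "test_fun \<Omega> g"
  shows "pdx (pdy g) = pdy (pdx g)"
proof -
  note s = test_fun_smooth[OF g] and c = ccs_test_fun[OF g]
  have 1: "(\<integral>w. indicator (quadrant z) w * pdy (pdx g) w \<partial>lborel) = g z" for z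
    using integral_quadrant_dxdy[OF smooth2_dx[OF s, of "[]"] smooth2_dy[OF s, of "[True]"] c[of "[]"] c[of "[True]"] c[of "[False, True]"]]
    by simp
  have 2: "(\<integral>w. indicator (quadrant z) w * pdx (pdy g) w \<partial>lborel) = g z" for z
    using integral_quadrant_dydx[OF smooth2_dy[OF s, of "[]"] smooth2_dx[OF s, of "[False]"] c[of "[]"] c[of "[False]"] c[of "[True, False]"]]
    by simp
  have c1: "ccs (pdx (pdy g))" and c2: "ccs (pdy (pdx g))" using c[of "[True, False]"] c[of "[False, True]"] by simp_all
  have "AE w in lborel. pdx (pdy g) w - pdy (pdx g) w = 0"
  proof (rule AE_zero_if_quadrant_integrals_zero)
    show "integrable lborel (\<lambda>w. pdx (pdy g) w - pdy (pdx g) w)"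
      using integrable_ccs[OF c1] integrable_ccs[OF c2] by simp
    show "(\<integral>w. indicator (quadrant z) w * (pdx (pdy g) w - pdy (pdx g) w) \<partial>lborel) = 0" for z
      using 1 2 integrable_quadrant[OF c1, of z] integrable_quadrant[OF c2, of z] by (simp add: right_diff_distrib)
  qed
  from continuous_AE_zero[OF ccs_continuous[OF ccs_diff[OF c1 c2]] this] show ?thesis
    by (auto simp: fun_eq_iff)
qed

section \<open>Integration by parts for test functions\<close>

lemma parts_dx:
  assumes "test_fun \<Omega> u" "test_fun \<Omega>' v"
  shows "(\<integral>z. u z * pdx v z \<partial>lborel) = - (\<integral>z. pdx u z * v z \<partial>lborel)"
proof -
  note c = ccs_test_fun[OF assms(1)] ccs_test_fun[OF assms(2)]
  have c': "ccs u" "ccs (pdx u)" "ccs v" "ccs (pdx v)"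
    using c(1)[of "[]"] c(1)[of "[True]"] c(2)[of "[]"] c(2)[of "[True]"] by simp_all
  have "((\<lambda>t. u (t, y) * v (t, y)) has_real_derivative (\<lambda>z. pdx u z * v z + u z * pdx v z) (x, y)) (at x)" for x y
    using DERIV_mult[OF smooth2_dx[OF test_fun_smooth[OF assms(1)], of "[]"] smooth2_dx[OF test_fun_smooth[OF assms(2)], of "[]"]]
    by (simp add: algebra_simps)
  from integral_dx_zero[OF this] have "(\<integral>z. pdx u z * v z + u z * pdx v z \<partial>lborel) = 0"
    using c' by (simp add: ccs_mult ccs_add)
  then show ?thesis using c' by (simp add: ccs_mult integrable_ccs)
qed

lemma parts_dy:
  assumes "test_fun \<Omega> u" "test_fun \<Omega>' v"
  shows "(\<integral>z. u z * pdy v z \<partial>lborel) = - (\<integral>z. pdy u z * v z \<partial>lborel)"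
proof -
  note c = ccs_test_fun[OF assms(1)] ccs_test_fun[OF assms(2)]
  have c': "ccs u" "ccs (pdy u)" "ccs v" "ccs (pdy v)"
    using c(1)[of "[]"] c(1)[of "[False]"] c(2)[of "[]"] c(2)[of "[False]"] by simp_all
  have "((\<lambda>t. u (x, t) * v (x, t)) has_real_derivative (\<lambda>z. pdy u z * v z + u z * pdy v z) (x, y)) (at y)" for x y
    using DERIV_mult[OF smooth2_dy[OF test_fun_smooth[OF assms(1)], of "[]"] smooth2_dy[OF test_fun_smooth[OF assms(2)], of "[]"]]
    by (simp add: algebra_simps)
  from integral_dy_zero[OF this] have "(\<integral>z. pdy u z * v z + u z * pdy v z \<partial>lborel) = 0"
    using c' by (simp add: ccs_mult ccs_add)
  then show ?thesis using c' by (simp add: ccs_mult integrable_ccs)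
qed

text \<open>Moving derivatives one by one across an integral reverses their order; this restores
  it.\<close>

lemma ipd_rev:
  assumes "test_fun \<Omega> g"
  shows "ipd (rev ds) g = ipd ds g"
proof -
  have swap: "ipd ds (ipd [d] g) = ipd [d] (ipd ds g)" for d ds
  proof (induction ds)
    case (Cons e ds)
    have "ipd [e] (ipd [d] (ipd ds g)) = ipd [d] (ipd [e] (ipd ds g))"
      using pd_commute[OF test_fun_ipd[OF assms, of ds]] by (cases d; cases e) auto
    moreover have "ipd (e # ds) (ipd [d] g) = ipd [e] (ipd ds (ipd [d] g))"
      and "ipd (e # ds) g = ipd [e] (ipd ds g)"
      using ipd_append[of "[e]" ds] by simp_all
    ultimately show ?case using Cons by simp
  qed simp
  show ?thesis
  proof (induction ds)
    case (Cons d ds)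
    then show ?case using swap[of "rev ds" d] ipd_append[of "[d]" ds g] by (simp add: ipd_append)
  qed simp
qed

lemma parts_ipd:
  assumes "test_fun \<Omega> u" "test_fun \<Omega>' v"
  shows "(\<integral>z. u z * ipd ds v z \<partial>lborel) = (-1) ^ length ds * (\<integral>z. ipd ds u z * v z \<partial>lborel)"
proof -
  have "(\<integral>z. u z * ipd ds v z \<partial>lborel) = (-1) ^ length ds * (\<integral>z. ipd (rev ds) u z * v z \<partial>lborel)"
    using assms(1)
  proof (induction ds arbitrary: u)
    case (Cons d ds)
    have "(\<integral>z. u z * ipd (d # ds) v z \<partial>lborel) = - (\<integral>z. ipd [d] u z * ipd ds v z \<partial>lborel)"
      using parts_dx[OF Cons.prems test_fun_ipd[OF assms(2)]] parts_dy[OF Cons.prems test_fun_ipd[OF assms(2)]]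
      by (cases d) auto
    also have "\<dots> = (-1) ^ length (d # ds) * (\<integral>z. ipd (rev (d # ds)) u z * v z \<partial>lborel)"
      using Cons.IH[OF test_fun_ipd[OF Cons.prems, of "[d]"]] by (simp add: ipd_append)
    finally show ?case .
  qed simp
  then show ?thesis by (simp add: ipd_rev[OF assms(1)])
qed

section \<open>Bump functions\<close>

text \<open>Smoothness of \<open>exp (-1/t)\<close> and of the bumps built from it: the class of functions
  \<open>p (1/t) exp (-1/t)\<close>, \<open>p\<close> a polynomial, is closed under differentiation.\<close>

definition flat :: "real poly \<Rightarrow> real \<Rightarrow> real" where
  "flat p t = (if t \<le> 0 then 0 else poly p (inverse t) * exp (- inverse t))"

lemma poly_exp_tendsto_0: "((\<lambda>y. poly q y * exp (- y)) \<longlongrightarrow> (0::real)) at_top"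
proof -
  have "((\<lambda>y. \<Sum>i\<le>degree q. coeff q i * (y ^ i / exp y)) \<longlongrightarrow> (\<Sum>i\<le>degree q. coeff q i * 0)) at_top"
    by (intro tendsto_sum tendsto_mult tendsto_const tendsto_power_div_exp_0)
  moreover have "(\<lambda>y. \<Sum>i\<le>degree q. coeff q i * (y ^ i / exp y)) = (\<lambda>y. poly q y * exp (- y))"
    by (simp add: fun_eq_iff poly_altdef sum_distrib_right exp_minus field_simps sum_divide_distrib)
  ultimately show ?thesis by simp
qed

text \<open>For \<open>t > 0\<close> the derivative of \<open>p(1/t) * exp (-1/t)\<close> is
  \<open>(1/t)\<^sup>2 * (p - p')(1/t) * exp (-1/t)\<close>; the list \<open>[:0, 0, 1:]\<close> is
  the square of the polynomial variable.\<close>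

lemma flat_deriv: "(flat p has_real_derivative flat ([:0, 0, 1:] * (p - pderiv p)) x) (at x)"
proof (cases "x = 0")
  case False
  show ?thesis
  proof (cases "x < 0")
    case True
    have "\<forall>\<^sub>F t in nhds x. flat p t = 0"
      using eventually_nhds_in_open[of "{..<0}" x] True by (auto elim!: eventually_mono simp: flat_def)
    then have "(flat p has_real_derivative 0) (at x)" using DERIV_cong_ev[OF refl _ refl] by fastforce
    moreover have "flat q x = 0" for q using True by (simp add: flat_def)
    ultimately show ?thesis by simp
  next
    case nn: False
    with False have pos: "x > 0" by simp
    have ev: "\<forall>\<^sub>F t in nhds x. flat p t = poly p (inverse t) * exp (- inverse t)"
      using eventually_nhds_in_open[of "{0<..}" x] pos by (auto elim!: eventually_mono simp: flat_def)
    have "((\<lambda>t. poly p (inverse t) * exp (- inverse t)) has_real_derivative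
        flat ([:0, 0, 1:] * (p - pderiv p)) x) (at x)"
      using pos
      by (auto intro!: derivative_eq_intros DERIV_chain2[OF poly_DERIV] simp: flat_def power2_eq_square algebra_simps)
    with DERIV_cong_ev[OF refl ev refl] show ?thesis by simp
  qed
next
  case True
  have l: "((\<lambda>t. (flat p t - flat p 0) / (t - 0)) \<longlongrightarrow> 0) (at_left 0)"
    by (rule tendsto_eventually) (auto simp: eventually_at_filter flat_def)
  \<comment> \<open>Dividing by \<open>t\<close> multiplies the polynomial in \<open>1/t\<close> by
    its variable, so the right difference quotient at 0 is again of the same form.\<close>
  have "((\<lambda>t. poly (pCons 0 p) (inverse t) * exp (- inverse t)) \<longlongrightarrow> 0) (at_right 0)"
    by (rule filterlim_compose[OF poly_exp_tendsto_0 filterlim_inverse_at_top_right])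
  moreover have "\<forall>\<^sub>F t in at_right 0. poly (pCons 0 p) (inverse t) * exp (- inverse t) = (flat p t - flat p 0) / (t - 0)"
    by (auto simp: eventually_at_filter flat_def field_simps)
  ultimately have "((\<lambda>t. (flat p t - flat p 0) / (t - 0)) \<longlongrightarrow> 0) (at_right 0)"
    by (rule Lim_transform_eventually)
  with l have "((\<lambda>t. (flat p t - flat p 0) / (t - 0)) \<longlongrightarrow> 0) (at 0)"
    by (rule filterlim_split_at)
  then show ?thesis using True by (simp add: has_field_derivative_iff flat_def)
qed

text \<open>For \<open>c > 0\<close> the first factor vanishes to the left of \<open>a\<close> and
  the second to the right of \<open>b\<close>. Linear combinations are included because the product
  rule yields a sum.\<close>

inductive_set flat_prods :: "(real \<Rightarrow> real) set" where
  base: "(\<lambda>x. flat p (c * (x - a)) * flat q (c * (b - x))) \<in> flat_prods"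
| lincomb: "h \<in> flat_prods \<Longrightarrow> k \<in> flat_prods \<Longrightarrow> (\<lambda>x. r * h x + s * k x) \<in> flat_prods"

lemma flat_prods_deriv:
  assumes "h \<in> flat_prods"
  shows "\<exists>h'\<in>flat_prods. \<forall>x. (h has_real_derivative h' x) (at x)"
  using assms
proof induction
  case (base p c a q b)
  define D where "D p = [:0, 0, 1:] * (p - pderiv p)" for p :: "real poly"
  have "((\<lambda>x. flat p (c * (x - a)) * flat q (c * (b - x))) has_real_derivative
      c * (flat (D p) (c * (x - a)) * flat q (c * (b - x)))
      + (- c) * (flat p (c * (x - a)) * flat (D q) (c * (b - x)))) (at x)" for x
    unfolding D_def
    by (auto intro!: derivative_eq_intros DERIV_chain2[OF flat_deriv] simp del: mult_pCons_left simp: algebra_simps)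
  then show ?case by (intro bexI[OF _ flat_prods.lincomb[OF flat_prods.base flat_prods.base]] allI)
next
  case (lincomb h k r s)
  then obtain h' k' where h: "h' \<in> flat_prods" "\<And>x. (h has_real_derivative h' x) (at x)"
    and k: "k' \<in> flat_prods" "\<And>x. (k has_real_derivative k' x) (at x)" by blast
  have "((\<lambda>x. r * h x + s * k x) has_real_derivative r * h' x + s * k' x) (at x)" for x
    by (intro DERIV_add DERIV_cmult h k)
  then show ?case by (intro bexI[OF _ flat_prods.lincomb[OF h(1) k(1)]] allI)
qed

lemma smooth2_tensor:
  assumes "h \<in> flat_prods" "k \<in> flat_prods"
  shows "smooth2 (\<lambda>z. h (fst z) * k (snd z))"
proof (rule smooth2_coinduct)
  let ?S = "{\<lambda>z::real \<times> real. h (fst z) * k (snd z) |h k. h \<in> flat_prods \<and> k \<in> flat_prods}"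
  show "(\<lambda>z. h (fst z) * k (snd z)) \<in> ?S" using assms by blast
  have cont: "continuous_on UNIV h" if "h \<in> flat_prods" for h
    using flat_prods_deriv[OF that] by (metis DERIV_continuous_on has_field_derivative_at_within)
  fix g assume "g \<in> ?S"
  then obtain h k where hk: "h \<in> flat_prods" "k \<in> flat_prods" and g: "g = (\<lambda>z. h (fst z) * k (snd z))" by blast
  show "continuous_on UNIV g"
    unfolding g by (intro continuous_intros continuous_on_compose2[OF cont[OF hk(1)]] continuous_on_compose2[OF cont[OF hk(2)]]) auto
  obtain h' where h': "h' \<in> flat_prods" "\<And>x. (h has_real_derivative h' x) (at x)"
    using flat_prods_deriv[OF hk(1)] by blast
  obtain k' where k': "k' \<in> flat_prods" "\<And>x. (k has_real_derivative k' x) (at x)"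
    using flat_prods_deriv[OF hk(2)] by blast
  have "((\<lambda>t. g (t, y)) has_real_derivative h' x * k y) (at x)" for x y
    using DERIV_cmult_right[OF h'(2), of "k y" x] by (simp add: g)
  then show "\<exists>f\<in>?S. \<forall>x y. ((\<lambda>t. g (t, y)) has_real_derivative f (x, y)) (at x)"
    using h'(1) hk(2) by (intro bexI[of _ "\<lambda>z. h' (fst z) * k (snd z)"]) auto
  have "((\<lambda>t. g (x, t)) has_real_derivative h x * k' y) (at y)" for x y
    using DERIV_cmult[OF k'(2), of "h x" y] by (simp add: g)
  then show "\<exists>f\<in>?S. \<forall>x y. ((\<lambda>t. g (x, t)) has_real_derivative f (x, y)) (at y)"
    using k'(1) hk(1) by (intro bexI[of _ "\<lambda>z. h (fst z) * k' (snd z)"]) auto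
qed

text \<open>\<open>c\<close> is a steepness: as it tends to infinity the bump tends pointwise to the
  indicator of the open interval, while staying between 0 and 1.\<close>

definition bump1 :: "real \<Rightarrow> real \<Rightarrow> real \<Rightarrow> real \<Rightarrow> real" where
  "bump1 c a b x = flat 1 (c * (x - a)) * flat 1 (c * (b - x))"

definition bump :: "real \<Rightarrow> pt \<Rightarrow> pt \<Rightarrow> pt \<Rightarrow> real" where
  "bump c a b z = bump1 c (fst a) (fst b) (fst z) * bump1 c (snd a) (snd b) (snd z)"

lemma flat_1_bounds: "0 \<le> flat 1 t" "flat 1 t \<le> 1" "flat 1 t > 0 \<longleftrightarrow> t > 0"
  by (auto simp: flat_def)

lemma bump1_bounds: "0 \<le> bump1 c a b x" "bump1 c a b x \<le> 1"
  using flat_1_bounds by (auto simp: bump1_def intro!: mult_le_one)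

lemma bump1_pos: "c > 0 \<Longrightarrow> bump1 c a b x > 0 \<longleftrightarrow> x \<in> {a<..<b}"
  using flat_1_bounds(1)[of "c * (x - a)"] flat_1_bounds(1)[of "c * (b - x)"]
  by (auto simp: bump1_def zero_less_mult_iff flat_1_bounds(3))

lemma bump_bounds: "0 \<le> bump c a b z" "bump c a b z \<le> 1"
  using bump1_bounds by (auto simp: bump_def intro!: mult_le_one)

lemma mem_box_pt: "(z::pt) \<in> box a b \<longleftrightarrow> fst z \<in> {fst a<..<fst b} \<and> snd z \<in> {snd a<..<snd b}"
  by (cases z; cases a; cases b) (auto simp: mem_box Basis_prod_def)

lemma mem_cbox_pt: "(z::pt) \<in> cbox a b \<longleftrightarrow> fst z \<in> {fst a..fst b} \<and> snd z \<in> {snd a..snd b}"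
  by (cases z; cases a; cases b) (auto simp: mem_box Basis_prod_def)

lemma bump_pos: "c > 0 \<Longrightarrow> bump c a b z > 0 \<longleftrightarrow> z \<in> box a b"
  by (auto simp: bump_def zero_less_mult_iff bump1_pos mem_box_pt bump1_bounds(1)[THEN leD])

lemma flat_1_tendsto: "t > 0 \<Longrightarrow> (\<lambda>n. flat 1 (real (Suc n) * t)) \<longlonglongrightarrow> 1"
proof -
  assume t: "t > 0"
  have "(\<lambda>n. exp (- (inverse (real (Suc n)) * inverse t))) \<longlonglongrightarrow> exp (- (0 * inverse t))"
    by (intro tendsto_intros LIMSEQ_inverse_real_of_nat)
  moreover have "flat 1 (real (Suc n) * t) = exp (- (inverse (real (Suc n)) * inverse t))" for n
  proof -
    have "0 < real (Suc n) * t" using t by simp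
    then show ?thesis unfolding flat_def by (simp del: of_nat_Suc add: inverse_mult_distrib)
  qed
  ultimately show ?thesis by simp
qed

lemma bump_tendsto: "(\<lambda>n. bump (real (Suc n)) a b z) \<longlonglongrightarrow> indicator (box a b) z"
proof (cases "z \<in> box a b")
  case True
  have "(\<lambda>n. bump (real (Suc n)) a b z) \<longlonglongrightarrow> 1 * 1 * (1 * 1)"
    unfolding bump_def bump1_def
    using True by (intro tendsto_mult flat_1_tendsto) (auto simp: mem_box_pt)
  then show ?thesis using True by simp
next
  case False
  then have "bump (real (Suc n)) a b z = 0" for n
    using bump_pos[of "real (Suc n)" a b z] bump_bounds(1)[of "real (Suc n)" a b z] by simp
  then show ?thesis using False by simp
qed

lemma test_fun_bump:
  assumes c: "c > 0" and sub: "cbox a b \<subseteq> \<Omega>"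
  shows "test_fun \<Omega> (bump c a b)"
proof -
  have "bump1 c a b \<in> flat_prods" for a b
    unfolding bump1_def by (rule flat_prods.base)
  from smooth2_tensor[OF this this] have s: "smooth2 (bump c a b)" unfolding bump_def .
  have "csupp (bump c a b) \<subseteq> cbox a b"
  proof (rule csupp_subset)
    fix z assume "z \<notin> cbox a b"
    then have "z \<notin> box a b" using box_subset_cbox by blast
    then show "bump c a b z = 0"
      using bump_pos[OF c, of a b z] bump_bounds(1)[of c a b z] by simp
  qed (rule closed_cbox)
  then show ?thesis
    using s sub compact_Int_closed[OF compact_cbox[of a b] csupp_closed[of "bump c a b"]]
    by (auto simp: test_fun_def Int_absorb1)
qed

section \<open>Square-integrable functions\<close>

lemma L2_mult_integrable:
  assumes "L2 \<Omega> g" "L2 \<Omega> h"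
  shows "integrable (lebesgue_on \<Omega>) (\<lambda>z. g z * h z)"
proof (rule Bochner_Integration.integrable_bound)
  show "integrable (lebesgue_on \<Omega>) (\<lambda>z. (g z)\<^sup>2 + (h z)\<^sup>2)" using assms by (simp add: L2_def)
  show "(\<lambda>z. g z * h z) \<in> borel_measurable (lebesgue_on \<Omega>)" using assms by (auto simp: L2_def)
  have "\<bar>x * y\<bar> \<le> x\<^sup>2 + y\<^sup>2" for x y :: real
  proof -
    have "2 * (\<bar>x\<bar> * \<bar>y\<bar>) \<le> x\<^sup>2 + y\<^sup>2" using sum_squares_bound[of "\<bar>x\<bar>" "\<bar>y\<bar>"] by (simp add: mult.assoc)
    moreover have "0 \<le> \<bar>x\<bar> * \<bar>y\<bar>" by simp
    ultimately show ?thesis unfolding abs_mult by linarith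
  qed
  then show "AE z in lebesgue_on \<Omega>. norm (g z * h z) \<le> norm ((g z)\<^sup>2 + (h z)\<^sup>2)"
    by simp
qed

lemma L2_lincomb:
  assumes "L2 \<Omega> g" "L2 \<Omega> h"
  shows "L2 \<Omega> (\<lambda>z. c * g z + d * h z)"
proof -
  have "(\<lambda>z. (c * g z + d * h z)\<^sup>2) = (\<lambda>z. c\<^sup>2 * (g z)\<^sup>2 + d\<^sup>2 * (h z)\<^sup>2 + 2 * c * d * (g z * h z))"
    by (simp add: fun_eq_iff power2_eq_square algebra_simps)
  then show ?thesis using assms L2_mult_integrable[OF assms] by (auto simp: L2_def)
qed

lemma L2_zero: "L2 \<Omega> (\<lambda>z. 0)" by (simp add: L2_def)

lemma L2_cong_AE:
  assumes "L2 \<Omega> g" "AE z in lebesgue_on \<Omega>. g z = h z" "h \<in> borel_measurable (lebesgue_on \<Omega>)"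
  shows "L2 \<Omega> h"
proof -
  have "integrable (lebesgue_on \<Omega>) (\<lambda>z. (g z)\<^sup>2) \<longleftrightarrow> integrable (lebesgue_on \<Omega>) (\<lambda>z. (h z)\<^sup>2)"
    using assms by (intro integrable_cong_AE) (auto simp: L2_def)
  then show ?thesis using assms by (simp add: L2_def)
qed

lemma L2inner_cong_AE:
  assumes "L2 \<Omega> g" "L2 \<Omega> h" "L2 \<Omega> g'" "L2 \<Omega> h'"
    and "AE z in lebesgue_on \<Omega>. g z = g' z" "AE z in lebesgue_on \<Omega>. h z = h' z"
  shows "L2inner \<Omega> g h = L2inner \<Omega> g' h'"
  unfolding L2inner_def
  using assms by (intro integral_cong_AE) (auto simp: L2_def)

interpretation L2: semi_inner "{g. L2 \<Omega> g}" "L2inner \<Omega>" for \<Omega>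
proof
  fix u v w :: "real \<times> real \<Rightarrow> real" and c d
  assume "u \<in> {g. L2 \<Omega> g}" "v \<in> {g. L2 \<Omega> g}" "w \<in> {g. L2 \<Omega> g}"
  then show "L2inner \<Omega> (\<lambda>z. c * u z + d * v z) w = c * L2inner \<Omega> u w + d * L2inner \<Omega> v w"
    by (simp add: L2inner_def distrib_right mult.assoc L2_mult_integrable)
qed (auto simp: L2_zero L2_lincomb L2inner_def mult.commute)

lemma L2inner_self_zero:
  assumes "L2 \<Omega> g" "L2inner \<Omega> g g = 0"
  shows "AE z in lebesgue_on \<Omega>. g z = 0"
  using assms integral_nonneg_eq_0_iff_AE[of "lebesgue_on \<Omega>" "\<lambda>z. g z * g z"] L2_mult_integrable[of \<Omega> g g]
  by (auto simp: L2inner_def)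

lemma L2_mult_bounded:
  assumes "L2 \<Omega> g" "h \<in> borel_measurable (lebesgue_on \<Omega>)" "AE z in lebesgue_on \<Omega>. \<bar>h z\<bar> \<le> C"
  shows "L2 \<Omega> (\<lambda>z. h z * g z)"
  unfolding L2_def
proof
  show "integrable (lebesgue_on \<Omega>) (\<lambda>z. (h z * g z)\<^sup>2)"
  proof (rule Bochner_Integration.integrable_bound)
    show "integrable (lebesgue_on \<Omega>) (\<lambda>z. C\<^sup>2 * (g z)\<^sup>2)" using assms by (simp add: L2_def)
    show "AE z in lebesgue_on \<Omega>. norm ((h z * g z)\<^sup>2) \<le> norm (C\<^sup>2 * (g z)\<^sup>2)"
      using assms(3)
    proof eventually_elim
      case (elim z)
      then have "(h z)\<^sup>2 \<le> C\<^sup>2" using power_mono[of "\<bar>h z\<bar>" C 2] by simp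
      then show ?case by (simp add: power_mult_distrib mult_right_mono)
    qed
  qed (use assms in \<open>auto simp: L2_def\<close>)
qed (use assms in \<open>auto simp: L2_def\<close>)

section \<open>Lebesgue measure on a bounded open domain\<close>

locale bounded_open =
  fixes \<Omega> :: "(real \<times> real) set"
  assumes open_dom: "open \<Omega>" and bounded_dom: "bounded \<Omega>"
begin

lemma dom_lmeasurable: "\<Omega> \<in> lmeasurable"
  using open_dom bounded_dom lmeasurable_open by blast

lemma dom_borel [measurable]: "\<Omega> \<in> sets borel" using open_dom by simp

sublocale finite_measure "lebesgue_on \<Omega>"
  using finite_measure_lebesgue_on dom_lmeasurable .

definition vol :: real where "vol = measure (lebesgue_on \<Omega>) \<Omega>"

lemma vol_nonneg: "0 \<le> vol" by (simp add: vol_def)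

lemma borel_imp_measurable: "F \<in> borel_measurable borel \<Longrightarrow> F \<in> borel_measurable (lebesgue_on \<Omega>)"
  by (intro measurable_restrict_space1 measurable_completion) simp

lemma AE_dom: "(AE z in lebesgue_on \<Omega>. P z) \<longleftrightarrow> (AE z in lborel. z \<in> \<Omega> \<longrightarrow> P z)"
  by (simp add: AE_restrict_space_iff AE_completion_iff)

lemma integral_dom_borel:
  fixes F :: "real \<times> real \<Rightarrow> real"
  assumes F: "F \<in> borel_measurable borel" and z: "\<And>z. z \<notin> \<Omega> \<Longrightarrow> F z = 0"
  shows "integral\<^sup>L (lebesgue_on \<Omega>) F = integral\<^sup>L lborel F"
    and "integrable (lebesgue_on \<Omega>) F \<longleftrightarrow> integrable lborel F"
proof -
  have "(\<lambda>z. indicator \<Omega> z *\<^sub>R F z) = F" using z by (auto simp: fun_eq_iff indicator_def)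
  then show "integral\<^sup>L (lebesgue_on \<Omega>) F = integral\<^sup>L lborel F"
    "integrable (lebesgue_on \<Omega>) F \<longleftrightarrow> integrable lborel F"
    using F by (simp_all add: integral_restrict_space integrable_restrict_space integral_completion integrable_completion)
qed

text \<open>Members of \<open>L2\<close> are measurable only for the completed measure on
  \<open>\<Omega>\<close>. A Borel version extended by zero brings the results over
  \<open>lborel\<close> into reach, at the price of a null set.\<close>

lemma borel_version:
  fixes g :: "pt \<Rightarrow> real"
  assumes "g \<in> borel_measurable (lebesgue_on \<Omega>)"
  obtains G where "G \<in> borel_measurable borel" "\<forall>z. z \<notin> \<Omega> \<longrightarrow> G z = 0" "AE z in lebesgue_on \<Omega>. g z = G z"
proof -
  have "(\<lambda>z. indicator \<Omega> z *\<^sub>R g z) \<in> borel_measurable lebesgue"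
    using assms by (simp add: borel_measurable_restrict_space_iff)
  then obtain G where G: "G \<in> borel_measurable lborel" "AE z in lborel. indicator \<Omega> z *\<^sub>R g z = G z"
    using completion_ex_borel_measurable_real by blast
  have "AE z in lebesgue_on \<Omega>. g z = indicator \<Omega> z * G z"
    unfolding AE_dom using G(2) by eventually_elim (auto simp: indicator_def)
  moreover have "(\<lambda>z. indicator \<Omega> z * G z) \<in> borel_measurable borel"
    using G(1) by measurable
  ultimately show ?thesis using that[of "\<lambda>z. indicator \<Omega> z * G z"] by simp
qed

lemma L2_bounded:
  assumes "h \<in> borel_measurable (lebesgue_on \<Omega>)" "AE z in lebesgue_on \<Omega>. \<bar>h z\<bar> \<le> C"
  shows "L2 \<Omega> h"
  using L2_mult_bounded[OF _ assms, of "\<lambda>_. 1"] by (simp add: L2_def)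

lemma L2_test: "test_fun \<Omega>' g \<Longrightarrow> L2 \<Omega> (ipd ds g)"
proof -
  assume g: "test_fun \<Omega>' g"
  from ccs_bounded[OF ccs_test_fun[OF g]] obtain C where "\<And>z. \<bar>ipd ds g z\<bar> \<le> C" by blast
  moreover have "ipd ds g \<in> borel_measurable borel"
    using test_fun_continuous[OF g] by (rule borel_measurable_continuous_onI)
  ultimately show ?thesis by (intro L2_bounded[of _ C] borel_imp_measurable) auto
qed

lemma L2_indicator: "A \<in> sets borel \<Longrightarrow> L2 \<Omega> (indicator A)"
  by (rule L2_bounded[of _ 1]) (auto intro!: borel_imp_measurable simp: indicator_def)

lemma test_outside: "test_fun \<Omega> g \<Longrightarrow> z \<notin> \<Omega> \<Longrightarrow> ipd ds g z = 0"
  using csupp_outside[of z "ipd ds g"] csupp_ipd[of ds g] by (auto simp: test_fun_def)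

lemma test_borel: "test_fun \<Omega>' g \<Longrightarrow> ipd ds g \<in> borel_measurable borel"
  using test_fun_continuous by (rule borel_measurable_continuous_onI)

lemma L2inner_test:
  assumes g: "test_fun \<Omega> g" and F: "F \<in> borel_measurable borel"
  shows "L2inner \<Omega> F (ipd ds g) = (\<integral>z. F z * ipd ds g z \<partial>lborel)"
  unfolding L2inner_def
  using test_borel[OF g] test_outside[OF g] F by (intro integral_dom_borel(1)) auto

lemma is_weak_deriv_test:
  assumes g: "test_fun \<Omega> g"
  shows "is_weak_deriv \<Omega> g ds (ipd ds g)"
  unfolding is_weak_deriv_def
proof (intro conjI allI impI)
  show "L2 \<Omega> (ipd ds g)" by (rule L2_test[OF g])
  fix \<psi> assume psi: "test_fun \<Omega> \<psi>"
  have "L2inner \<Omega> (ipd [] g) (ipd ds \<psi>) = (\<integral>z. ipd [] g z * ipd ds \<psi> z \<partial>lborel)"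
    by (intro L2inner_test psi test_borel[OF g])
  moreover have "L2inner \<Omega> (ipd ds g) (ipd [] \<psi>) = (\<integral>z. ipd ds g z * ipd [] \<psi> z \<partial>lborel)"
    by (intro L2inner_test psi test_borel[OF g])
  ultimately show "L2inner \<Omega> g (ipd ds \<psi>) = (-1) ^ length ds * L2inner \<Omega> (ipd ds g) \<psi>"
    using parts_ipd[OF g psi] by simp
qed

lemma AE_not_edge: "AE w::pt in lborel. fst w \<noteq> c" "AE w::pt in lborel. snd w \<noteq> c"
proof -
  have "(1, 0) \<in> (Basis :: (real \<times> real) set)" "(0, 1) \<in> (Basis :: (real \<times> real) set)"
    by (simp_all add: Basis_prod_def)
  then show "AE w::pt in lborel. fst w \<noteq> c" "AE w::pt in lborel. snd w \<noteq> c"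
    using AE_lborel_inner_neq[of "(1, 0)::real \<times> real" c] AE_lborel_inner_neq[of "(0, 1)::real \<times> real" c]
    by (simp_all add: inner_prod_def)
qed

text \<open>Bumps of growing steepness turn the orthogonality into vanishing integrals over open
  boxes inside \<open>\<Omega>\<close>. Restricted to a closed box, the function then has zero
  quadrant integrals, hence is zero a.e. there, and countably many closed boxes fill
  \<open>\<Omega>\<close>.\<close>

lemma fundamental_lemma:
  assumes g: "L2 \<Omega> g" and orth: "\<And>\<psi>. test_fun \<Omega> \<psi> \<Longrightarrow> L2inner \<Omega> g \<psi> = 0"
  shows "AE z in lebesgue_on \<Omega>. g z = 0"
proof -
  have gm: "g \<in> borel_measurable (lebesgue_on \<Omega>)" using g by (simp add: L2_def)
  obtain G where G: "G \<in> borel_measurable borel" "\<forall>z. z \<notin> \<Omega> \<longrightarrow> G z = 0" "AE z in lebesgue_on \<Omega>. g z = G z"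
    by (rule borel_version[OF gm])
  have L2G: "L2 \<Omega> G" by (rule L2_cong_AE[OF g G(3) borel_imp_measurable[OF G(1)]])
  \<comment> \<open>The factor \<open>indicator UNIV\<close> is the constant 1, which is
    square-integrable on a set of finite measure; so \<open>G\<close> itself is integrable.\<close>
  have "integrable (lebesgue_on \<Omega>) (\<lambda>z. G z * indicator UNIV z)"
    using L2_mult_integrable[OF L2G L2_indicator[of UNIV]] by simp
  then have Gint: "integrable lborel G"
    using integral_dom_borel(2)[OF G(1)] G(2) by simp
  have box0: "(\<integral>w. indicator (box a b) w * G w \<partial>lborel) = 0" if sub: "cbox a b \<subseteq> \<Omega>" for a b
  proof -
    have "(\<lambda>n. \<integral>w. bump (real (Suc n)) a b w * G w \<partial>lborel) \<longlonglongrightarrow> (\<integral>w. indicator (box a b) w * G w \<partial>lborel)"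
    proof (rule integral_dominated_convergence[where w = "\<lambda>w. \<bar>G w\<bar>"])
      show "(\<lambda>w. bump (real (Suc n)) a b w * G w) \<in> borel_measurable lborel" for n
        using test_borel[OF test_fun_bump[OF _ sub], of "real (Suc n)" "[]"] G(1) by simp
      show "AE w in lborel. (\<lambda>n. bump (real (Suc n)) a b w * G w) \<longlonglongrightarrow> indicator (box a b) w * G w"
        by (intro AE_I2 tendsto_mult bump_tendsto tendsto_const)
      show "AE w in lborel. norm (bump (real (Suc n)) a b w * G w) \<le> \<bar>G w\<bar>" for n
        using bump_bounds[of "real (Suc n)" a b] by (auto simp: abs_mult intro!: mult_left_le_one_le)
    qed (use G(1) Gint in auto)
    moreover have "(\<integral>w. bump (real (Suc n)) a b w * G w \<partial>lborel) = 0" for n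
    proof -
      have t: "test_fun \<Omega> (bump (real (Suc n)) a b)" using test_fun_bump[OF _ sub] by simp
      have "L2inner \<Omega> g (ipd [] (bump (real (Suc n)) a b)) = L2inner \<Omega> G (ipd [] (bump (real (Suc n)) a b))"
        by (intro L2inner_cong_AE g L2G L2_test[OF t] G(3)) auto
      also have "\<dots> = (\<integral>w. G w * ipd [] (bump (real (Suc n)) a b) w \<partial>lborel)"
        by (rule L2inner_test[OF t G(1)])
      finally show ?thesis using orth[OF t] by (simp add: mult.commute)
    qed
    ultimately show ?thesis using LIMSEQ_unique[OF _ tendsto_const[of 0]] by simp
  qed
  have cbox0: "AE w in lborel. w \<in> cbox a b \<longrightarrow> G w = 0" if sub: "cbox a b \<subseteq> \<Omega>" for a b
  proof -
    have "AE w in lborel. indicator (cbox a b) w * G w = 0"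
    proof (rule AE_zero_if_quadrant_integrals_zero)
      show "integrable lborel (\<lambda>w. indicator (cbox a b) w * G w)"
        using integrable_mult_indicator[OF _ Gint, of "cbox a b"] by simp
      fix z
      \<comment> \<open>A quadrant meets \<open>cbox a b\<close> in the open box with upper corner
        \<open>b'\<close> (possibly empty), up to coordinate lines, which are null sets.\<close>
      define b' where "b' = (min (fst b) (fst z), min (snd b) (snd z))"
      have "(\<integral>w. indicator (quadrant z) w * (indicator (cbox a b) w * G w) \<partial>lborel)
          = (\<integral>w. indicator (box a b') w * G w \<partial>lborel)"
      proof (rule integral_cong_AE)
        show "AE w in lborel. indicator (quadrant z) w * (indicator (cbox a b) w * G w) = indicator (box a b') w * G w"
          using AE_not_edge(1)[of "fst z"] AE_not_edge(2)[of "snd z"] AE_not_edge(1)[of "fst a"]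
            AE_not_edge(2)[of "snd a"] AE_not_edge(1)[of "fst b"] AE_not_edge(2)[of "snd b"]
        proof eventually_elim
          case (elim w)
          then have "w \<in> quadrant z \<and> w \<in> cbox a b \<longleftrightarrow> w \<in> box a b'"
            by (cases w) (auto simp: quadrant_def mem_box_pt mem_cbox_pt b'_def)
          then show ?case by (auto simp: indicator_def)
        qed
      qed (use G(1) in measurable)
      also have "\<dots> = 0"
        using sub by (intro box0) (auto simp: mem_cbox_pt b'_def subset_iff)
      finally show "(\<integral>w. indicator (quadrant z) w * (indicator (cbox a b) w * G w) \<partial>lborel) = 0" .
    qed
    then show ?thesis by eventually_elim (auto simp: indicator_def)
  qed
  obtain D where D: "countable D" "D \<subseteq> Pow \<Omega>" "\<And>X. X \<in> D \<Longrightarrow> \<exists>a b. X = cbox a b" "\<Union>D = \<Omega>"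
    using open_countable_Union_open_cbox[OF open_dom] by metis
  have "AE w in lborel. \<forall>X\<in>D. w \<in> X \<longrightarrow> G w = 0"
  proof (rule AE_ball_countable'[OF _ D(1)])
    fix X assume "X \<in> D"
    then obtain a b where "X = cbox a b" "cbox a b \<subseteq> \<Omega>" using D(2,3) by blast
    then show "AE w in lborel. w \<in> X \<longrightarrow> G w = 0" using cbox0 by simp
  qed
  then have "AE w in lebesgue_on \<Omega>. G w = 0"
    unfolding AE_dom using D(4) by (auto elim!: eventually_mono)
  with G(3) show ?thesis by eventually_elim simp
qed

text \<open>Riesz-Fischer: a subsequence with summable steps converges a.e., and Fatou's lemma
  transfers the Cauchy estimate to the limit function, for the full sequence.\<close>

lemma L2_complete:
  assumes s: "\<And>n. L2 \<Omega> (s n)"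
    and cau: "\<forall>e>0. \<exists>N. \<forall>m\<ge>N. \<forall>n\<ge>N. L2.nrm \<Omega> (\<lambda>z. s m z - s n z) < e"
  shows "\<exists>g. L2 \<Omega> g \<and> (\<lambda>n. L2.nrm \<Omega> (\<lambda>z. s n z - g z)) \<longlonglongrightarrow> 0"
proof -
  have [measurable]: "s n \<in> borel_measurable (lebesgue_on \<Omega>)" for n using s by (simp add: L2_def)
  have diff: "L2 \<Omega> (\<lambda>z. s m z - s n z)" for m n using L2.diff_mem s by simp
  have "\<exists>N. \<forall>m\<ge>N. \<forall>n\<ge>N. L2.nrm \<Omega> (\<lambda>z. s m z - s n z) < (1/2) ^ k" for k
    using cau by simp
  then obtain N where N: "\<And>k m n. m \<ge> N k \<Longrightarrow> n \<ge> N k \<Longrightarrow> L2.nrm \<Omega> (\<lambda>z. s m z - s n z) < (1/2) ^ k"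
    by metis
  \<comment> \<open>The sum puts \<open>r k\<close> and \<open>r (Suc k)\<close> above
    \<open>N k\<close>, so step \<open>k\<close> is below \<open>(1/2) ^ k\<close>; the summand
    \<open>k\<close> makes \<open>r\<close> unbounded.\<close>
  define r where "r k = k + (\<Sum>i\<le>k. N i)" for k
  have rN: "r k \<ge> N k" "r (Suc k) \<ge> N k" "r k \<ge> k" for k
    using member_le_sum[of k "{..k}" N] member_le_sum[of k "{..Suc k}" N] by (auto simp: r_def)
  define d where "d k z = \<bar>s (r (Suc k)) z - s (r k) z\<bar>" for k z
  have [measurable]: "d k \<in> borel_measurable (lebesgue_on \<Omega>)" for k unfolding d_def by measurable
  have L2d: "L2 \<Omega> (d k)" for k
    using diff[of "r (Suc k)" "r k"] by (simp add: L2_def d_def)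
  have L21: "L2 \<Omega> (\<lambda>_. 1)" by (simp add: L2_def)
  have dint: "integrable (lebesgue_on \<Omega>) (d k)" for k
    using L2_mult_integrable[OF L2d L21] by simp
  have dle: "(\<integral>z. d k z \<partial>lebesgue_on \<Omega>) \<le> (1/2) ^ k * L2.nrm \<Omega> (\<lambda>_. 1)" for k
  proof -
    \<comment> \<open>Pairing with the constant 1 turns smallness in L2 into smallness of the
      integral, so the sum of all steps is finite a.e.\<close>
    have "(\<integral>z. d k z \<partial>lebesgue_on \<Omega>) = L2inner \<Omega> (d k) (\<lambda>_. 1)" by (simp add: L2inner_def)
    also have "\<dots> \<le> L2.nrm \<Omega> (d k) * L2.nrm \<Omega> (\<lambda>_. 1)"
      using L2.Cauchy_Schwarz[of "d k" \<Omega> "\<lambda>_. 1"] L2d L21 by simp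
    also have "L2.nrm \<Omega> (d k) = L2.nrm \<Omega> (\<lambda>z. s (r (Suc k)) z - s (r k) z)"
      by (simp add: L2.nrm_def L2inner_def d_def)
    also have "\<dots> * L2.nrm \<Omega> (\<lambda>_. 1) \<le> (1/2) ^ k * L2.nrm \<Omega> (\<lambda>_. 1)"
      using N[OF rN(2,1), of k] L21 by (intro mult_right_mono) auto
    finally show ?thesis .
  qed
  have "(\<integral>\<^sup>+z. (\<Sum>k. ennreal (d k z)) \<partial>lebesgue_on \<Omega>) = (\<Sum>k. \<integral>\<^sup>+z. ennreal (d k z) \<partial>lebesgue_on \<Omega>)"
    by (rule nn_integral_suminf) simp
  also have "\<dots> = (\<Sum>k. ennreal (\<integral>z. d k z \<partial>lebesgue_on \<Omega>))"
    by (intro suminf_cong nn_integral_eq_integral dint) (simp add: d_def)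
  also have "\<dots> \<le> (\<Sum>k. ennreal ((1/2) ^ k * L2.nrm \<Omega> (\<lambda>_. 1)))"
    using dle by (intro suminf_le ennreal_leI summableI) auto
  also have "\<dots> = ennreal (\<Sum>k. (1/2) ^ k * L2.nrm \<Omega> (\<lambda>_. 1))"
    using L21 by (intro suminf_ennreal2 summable_mult2 summable_geometric) auto
  finally have "(\<integral>\<^sup>+z. (\<Sum>k. ennreal (d k z)) \<partial>lebesgue_on \<Omega>) \<noteq> \<infinity>"
    using ennreal_less_top le_less_trans by (metis infinity_ennreal_def less_irrefl)
  then have "AE z in lebesgue_on \<Omega>. (\<Sum>k. ennreal (d k z)) \<noteq> \<infinity>"
    by (intro nn_integral_PInf_AE) measurable
  then have conv: "AE z in lebesgue_on \<Omega>. convergent (\<lambda>k. s (r k) z)"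
  proof eventually_elim
    case (elim z)
    then have "summable (\<lambda>k. d k z)" by (intro summable_suminf_not_top) (auto simp: d_def)
    then have "summable (\<lambda>k. s (r (Suc k)) z - s (r k) z)"
      unfolding d_def by (rule summable_rabs_cancel)
    then have "convergent (\<lambda>n. \<Sum>k<n. s (r (Suc k)) z - s (r k) z)" by (simp add: summable_iff_convergent)
    then have "convergent (\<lambda>n. s (r n) z - s (r 0) z)"
      by (simp add: sum_lessThan_telescope[of "\<lambda>k. s (r k) z"])
    then have "convergent (\<lambda>n. (s (r n) z - s (r 0) z) + s (r 0) z)"
      by (intro convergent_add convergent_const)
    then show ?case by simp
  qed
  \<comment> \<open>Where the subsequence diverges, on a null set, \<open>lim\<close> is
    unspecified; it is measurable all the same.\<close>
  define g where "g z = lim (\<lambda>k. s (r k) z)" for z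
  have [measurable]: "g \<in> borel_measurable (lebesgue_on \<Omega>)" unfolding g_def by measurable
  have fat: "(\<integral>\<^sup>+z. ennreal ((s n z - g z)\<^sup>2) \<partial>lebesgue_on \<Omega>) \<le> ennreal (e\<^sup>2)"
    if e: "e > 0" and n: "n \<ge> M" and M: "\<And>m n. m \<ge> M \<Longrightarrow> n \<ge> M \<Longrightarrow> L2.nrm \<Omega> (\<lambda>z. s m z - s n z) < e" for e n M
  proof -
    have "(\<integral>\<^sup>+z. ennreal ((s n z - g z)\<^sup>2) \<partial>lebesgue_on \<Omega>)
        = (\<integral>\<^sup>+z. liminf (\<lambda>k. ennreal ((s n z - s (r k) z)\<^sup>2)) \<partial>lebesgue_on \<Omega>)"
    proof (rule nn_integral_cong_AE)
      show "AE z in lebesgue_on \<Omega>. ennreal ((s n z - g z)\<^sup>2) = liminf (\<lambda>k. ennreal ((s n z - s (r k) z)\<^sup>2))"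
        using conv
      proof eventually_elim
        case (elim z)
        then have "(\<lambda>k. s (r k) z) \<longlonglongrightarrow> g z" by (simp add: g_def convergent_LIMSEQ_iff)
        then have "(\<lambda>k. ennreal ((s n z - s (r k) z)\<^sup>2)) \<longlonglongrightarrow> ennreal ((s n z - g z)\<^sup>2)"
          by (intro tendsto_ennrealI tendsto_intros)
        from lim_imp_Liminf[OF trivial_limit_sequentially this] show ?case by simp
      qed
    qed
    also have "\<dots> \<le> liminf (\<lambda>k. \<integral>\<^sup>+z. ennreal ((s n z - s (r k) z)\<^sup>2) \<partial>lebesgue_on \<Omega>)"
      by (rule nn_integral_liminf) measurable
    also have "\<dots> \<le> liminf (\<lambda>k. ennreal (e\<^sup>2))"
    proof (rule Liminf_mono)
      show "\<forall>\<^sub>F k in sequentially. (\<integral>\<^sup>+z. ennreal ((s n z - s (r k) z)\<^sup>2) \<partial>lebesgue_on \<Omega>) \<le> ennreal (e\<^sup>2)"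
        using eventually_ge_at_top[of M]
      proof eventually_elim
        case (elim k)
        have "(\<integral>\<^sup>+z. ennreal ((s n z - s (r k) z)\<^sup>2) \<partial>lebesgue_on \<Omega>)
            = ennreal (\<integral>z. (s n z - s (r k) z)\<^sup>2 \<partial>lebesgue_on \<Omega>)"
          using diff by (intro nn_integral_eq_integral) (auto simp: L2_def)
        also have "\<dots> = ennreal ((L2.nrm \<Omega> (\<lambda>z. s n z - s (r k) z))\<^sup>2)"
          using L2.nrm_sq[of "\<lambda>z. s n z - s (r k) z" \<Omega>] diff by (simp add: L2inner_def power2_eq_square)
        also have "\<dots> \<le> ennreal (e\<^sup>2)"
          using M[OF n, of "r k"] rN(3)[of k] elim diff[of n "r k"]
          by (intro ennreal_leI power_mono) (auto simp: less_imp_le)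
        finally show ?case .
      qed
    qed
    also have "\<dots> = ennreal (e\<^sup>2)" by (simp add: Liminf_const)
    finally show ?thesis .
  qed
  have L2diff: "L2 \<Omega> (\<lambda>z. s n z - g z) \<and> L2.nrm \<Omega> (\<lambda>z. s n z - g z) \<le> e"
    if e: "e > 0" and n: "n \<ge> M" and M: "\<And>m n. m \<ge> M \<Longrightarrow> n \<ge> M \<Longrightarrow> L2.nrm \<Omega> (\<lambda>z. s m z - s n z) < e" for e n M
  proof -
    note f = fat[OF that]
    have int: "integrable (lebesgue_on \<Omega>) (\<lambda>z. (s n z - g z)\<^sup>2)"
      using f by (intro integrableI_nonneg) (auto intro: le_less_trans)
    then have L: "L2 \<Omega> (\<lambda>z. s n z - g z)" by (simp add: L2_def)
    have "ennreal (\<integral>z. (s n z - g z)\<^sup>2 \<partial>lebesgue_on \<Omega>) \<le> ennreal (e\<^sup>2)"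
      using f int by (simp add: nn_integral_eq_integral)
    then have "(L2.nrm \<Omega> (\<lambda>z. s n z - g z))\<^sup>2 \<le> e\<^sup>2"
      using L2.nrm_sq[of "\<lambda>z. s n z - g z" \<Omega>] L by (simp add: L2inner_def power2_eq_square)
    then show ?thesis using L e by (auto intro: power2_le_imp_le)
  qed
  obtain M1 where M1: "\<And>m n. m \<ge> M1 \<Longrightarrow> n \<ge> M1 \<Longrightarrow> L2.nrm \<Omega> (\<lambda>z. s m z - s n z) < 1"
    using cau zero_less_one by blast
  have "L2 \<Omega> (\<lambda>z. s M1 z - g z)" using L2diff[of 1 M1 M1] M1 by simp
  \<comment> \<open>\<open>g\<close> is \<open>s M1\<close> minus the difference
    \<open>s M1 - g\<close>, and both are square-integrable.\<close>
  then have Lg: "L2 \<Omega> g" using L2.diff_mem[of "s M1" \<Omega> "\<lambda>z. s M1 z - g z"] s by simp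
  have "(\<lambda>n. L2.nrm \<Omega> (\<lambda>z. s n z - g z)) \<longlonglongrightarrow> 0"
  proof (rule LIMSEQ_I)
    fix e :: real assume e: "e > 0"
    obtain M where M: "\<And>m n. m \<ge> M \<Longrightarrow> n \<ge> M \<Longrightarrow> L2.nrm \<Omega> (\<lambda>z. s m z - s n z) < e/2"
      using cau e by (meson half_gt_zero)
    have "norm (L2.nrm \<Omega> (\<lambda>z. s n z - g z) - 0) < e" if "n \<ge> M" for n
      using L2diff[of "e/2" M n, OF _ that M] e L2.nrm_nonneg[of "\<lambda>z. s n z - g z" \<Omega>] by auto
    then show "\<exists>N. \<forall>n\<ge>N. norm (L2.nrm \<Omega> (\<lambda>z. s n z - g z) - 0) < e" by blast
  qed
  with Lg show ?thesis by blast
qed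

end

section \<open>The spaces H2 and H20\<close>

lemma short_lists: "{ds :: bool list. length ds \<le> 2} =
    {[], [True], [False], [True, True], [True, False], [False, True], [False, False]}"
proof -
  have "ds \<in> {[], [True], [False], [True, True], [True, False], [False, True], [False, False]}"
    if "length ds \<le> 2" for ds :: "bool list"
  proof (cases ds)
    case (Cons a as)
    then show ?thesis using that by (cases as; cases a; cases "hd as") auto
  qed simp
  then show ?thesis by auto
qed

context bounded_open
begin

lemma weak_deriv_unique:
  assumes g: "is_weak_deriv \<Omega> \<phi> ds g" and h: "is_weak_deriv \<Omega> \<phi> ds h"
  shows "AE z in lebesgue_on \<Omega>. g z = h z"
proof -
  have L: "L2 \<Omega> g" "L2 \<Omega> h" using g h by (auto simp: is_weak_deriv_def)
  have "AE z in lebesgue_on \<Omega>. g z - h z = 0"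
  proof (rule fundamental_lemma)
    show "L2 \<Omega> (\<lambda>z. g z - h z)" using L2.diff_mem[of g \<Omega> h] L by simp
    fix \<psi> assume psi: "test_fun \<Omega> \<psi>"
    have "(-1) ^ length ds * L2inner \<Omega> g \<psi> = (-1) ^ length ds * L2inner \<Omega> h \<psi>"
      using g h psi by (metis is_weak_deriv_def)
    then have "L2inner \<Omega> g \<psi> = L2inner \<Omega> h \<psi>" by simp
    then show "L2inner \<Omega> (\<lambda>z. g z - h z) \<psi> = 0"
      using L2.form_diff_left[of g \<Omega> h \<psi>] L L2_test[OF psi, of "[]"] by simp
  qed
  then show ?thesis by simp
qed

lemma is_weak_deriv_wd: "\<phi> \<in> H2 \<Omega> \<Longrightarrow> length ds \<le> 2 \<Longrightarrow> is_weak_deriv \<Omega> \<phi> ds (wd \<Omega> \<phi> ds)"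
  unfolding wd_def by (rule someI_ex[of "is_weak_deriv \<Omega> \<phi> ds"]) (simp add: H2_def)

text \<open>Uniqueness makes the choice inside \<open>wd\<close> harmless: a weak derivative
  obtained by any other means may replace it under an integral.\<close>

lemma wd_AE: "is_weak_deriv \<Omega> \<phi> ds g \<Longrightarrow> AE z in lebesgue_on \<Omega>. wd \<Omega> \<phi> ds z = g z"
  unfolding wd_def using weak_deriv_unique someI[of "is_weak_deriv \<Omega> \<phi> ds" g] by blast

lemma L2_wd: "\<phi> \<in> H2 \<Omega> \<Longrightarrow> length ds \<le> 2 \<Longrightarrow> L2 \<Omega> (wd \<Omega> \<phi> ds)"
  using is_weak_deriv_wd by (simp add: is_weak_deriv_def)

lemma H2_L2: "\<phi> \<in> H2 \<Omega> \<Longrightarrow> L2 \<Omega> \<phi>" by (simp add: H2_def)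

lemma is_weak_deriv_Nil: "L2 \<Omega> \<phi> \<Longrightarrow> is_weak_deriv \<Omega> \<phi> [] \<phi>"
  by (simp add: is_weak_deriv_def)

lemma wd_Nil: "\<phi> \<in> H2 \<Omega> \<Longrightarrow> AE z in lebesgue_on \<Omega>. wd \<Omega> \<phi> [] z = \<phi> z"
  by (intro wd_AE is_weak_deriv_Nil H2_L2)

lemma is_weak_deriv_lincomb:
  assumes "L2 \<Omega> u" "L2 \<Omega> v" "is_weak_deriv \<Omega> u ds g" "is_weak_deriv \<Omega> v ds h"
  shows "is_weak_deriv \<Omega> (\<lambda>z. c * u z + d * v z) ds (\<lambda>z. c * g z + d * h z)"
  unfolding is_weak_deriv_def
proof (intro conjI allI impI)
  have L: "L2 \<Omega> g" "L2 \<Omega> h" using assms by (auto simp: is_weak_deriv_def)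
  then show "L2 \<Omega> (\<lambda>z. c * g z + d * h z)" by (rule L2_lincomb)
  fix \<psi> assume psi: "test_fun \<Omega> \<psi>"
  have "L2inner \<Omega> u (ipd ds \<psi>) = (-1) ^ length ds * L2inner \<Omega> g \<psi>"
    "L2inner \<Omega> v (ipd ds \<psi>) = (-1) ^ length ds * L2inner \<Omega> h \<psi>"
    using assms psi by (auto simp: is_weak_deriv_def)
  then show "L2inner \<Omega> (\<lambda>z. c * u z + d * v z) (ipd ds \<psi>)
      = (-1) ^ length ds * L2inner \<Omega> (\<lambda>z. c * g z + d * h z) \<psi>"
    using L2.form_lin[of u \<Omega> v "ipd ds \<psi>"] L2.form_lin[of g \<Omega> h \<psi>] assms(1,2) L
      L2_test[OF psi, of ds] L2_test[OF psi, of "[]"]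
    by (simp add: algebra_simps)
qed

lemma H2_lincomb:
  assumes "u \<in> H2 \<Omega>" "v \<in> H2 \<Omega>"
  shows "(\<lambda>z. c * u z + d * v z) \<in> H2 \<Omega>"
  using is_weak_deriv_lincomb[OF H2_L2[OF assms(1)] H2_L2[OF assms(2)]
      is_weak_deriv_wd[OF assms(1)] is_weak_deriv_wd[OF assms(2)], of _ c d]
    L2_lincomb[OF H2_L2[OF assms(1)] H2_L2[OF assms(2)], of c d]
  unfolding H2_def by blast

lemma wd_lincomb:
  assumes "u \<in> H2 \<Omega>" "v \<in> H2 \<Omega>" "length ds \<le> 2"
  shows "AE z in lebesgue_on \<Omega>. wd \<Omega> (\<lambda>z. c * u z + d * v z) ds z = c * wd \<Omega> u ds z + d * wd \<Omega> v ds z"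
  using assms by (intro wd_AE is_weak_deriv_lincomb H2_L2 is_weak_deriv_wd)

lemma test_H2: "test_fun \<Omega> g \<Longrightarrow> g \<in> H2 \<Omega>"
  unfolding H2_def using is_weak_deriv_test L2_test[of \<Omega> g "[]"] by auto

lemma wd_test: "test_fun \<Omega> g \<Longrightarrow> AE z in lebesgue_on \<Omega>. wd \<Omega> g ds z = ipd ds g z"
  by (intro wd_AE is_weak_deriv_test)

lemma L2inner_wd_lincomb:
  assumes "u \<in> H2 \<Omega>" "v \<in> H2 \<Omega>" "L2 \<Omega> w" "length ds \<le> 2"
  shows "L2inner \<Omega> (wd \<Omega> (\<lambda>z. c * u z + d * v z) ds) w
    = c * L2inner \<Omega> (wd \<Omega> u ds) w + d * L2inner \<Omega> (wd \<Omega> v ds) w"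
proof -
  note L = L2_wd[OF assms(1,4)] L2_wd[OF assms(2,4)]
  have "L2inner \<Omega> (wd \<Omega> (\<lambda>z. c * u z + d * v z) ds) w = L2inner \<Omega> (\<lambda>z. c * wd \<Omega> u ds z + d * wd \<Omega> v ds z) w"
    using assms L by (intro L2inner_cong_AE wd_lincomb L2_wd H2_lincomb L2_lincomb) auto
  then show ?thesis using L2.form_lin[of "wd \<Omega> u ds" \<Omega> "wd \<Omega> v ds" w c d] L assms by simp
qed

lemma L2inner_wd_test:
  assumes "test_fun \<Omega> g" "test_fun \<Omega> h" "length ds \<le> 2" "length es \<le> 2"
  shows "L2inner \<Omega> (wd \<Omega> g ds) (wd \<Omega> h es) = L2inner \<Omega> (ipd ds g) (ipd es h)"
  using assms by (intro L2inner_cong_AE L2_wd test_H2 L2_test wd_test)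

section \<open>The Sobolev inner product and the closure of the test functions\<close>

definition H2inner :: "(pt \<Rightarrow> real) \<Rightarrow> (pt \<Rightarrow> real) \<Rightarrow> real" where
  "H2inner u v = (\<Sum>ds\<in>{ds. length ds \<le> 2}. L2inner \<Omega> (wd \<Omega> u ds) (wd \<Omega> v ds))"

sublocale H2: semi_inner "H2 \<Omega>" H2inner
proof
  show "(\<lambda>z. 0) \<in> H2 \<Omega>" by (rule test_H2[OF test_fun_zero])
  fix u v w :: "pt \<Rightarrow> real" and c d
  show "H2inner u v = H2inner v u" unfolding H2inner_def using L2.form_sym by (intro sum.cong) auto
  assume u: "u \<in> H2 \<Omega>"
  show "0 \<le> H2inner u u"
    unfolding H2inner_def using L2.form_nonneg[of _ \<Omega>] L2_wd[OF u] by (intro sum_nonneg) auto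
  assume v: "v \<in> H2 \<Omega>"
  show "(\<lambda>z. c * u z + d * v z) \<in> H2 \<Omega>" by (rule H2_lincomb[OF u v])
  assume w: "w \<in> H2 \<Omega>"
  show "H2inner (\<lambda>z. c * u z + d * v z) w = c * H2inner u w + d * H2inner v w"
    unfolding H2inner_def sum_distrib_left sum.distrib[symmetric]
    by (intro sum.cong refl L2inner_wd_lincomb u v L2_wd w) auto
qed

lemma H2_normsq_eq: "H2_normsq \<Omega> u = H2inner u u"
  by (simp add: H2_normsq_def H2inner_def)

lemma L2_nrm_wd_le:
  assumes "u \<in> H2 \<Omega>" "length ds \<le> 2"
  shows "L2.nrm \<Omega> (wd \<Omega> u ds) \<le> H2.nrm u"
proof -
  have "L2inner \<Omega> (wd \<Omega> u ds) (wd \<Omega> u ds) \<le> H2inner u u"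
    unfolding H2inner_def using assms L2.form_nonneg[of _ \<Omega>] L2_wd[OF assms(1)]
    by (intro member_le_sum[of ds _ "\<lambda>ds. L2inner \<Omega> (wd \<Omega> u ds) (wd \<Omega> u ds)"])
      (auto simp: short_lists[symmetric] finite_lists_length_le[of UNIV, simplified])
  then show ?thesis by (simp add: L2.nrm_def H2.nrm_def)
qed

lemma L2_nrm_wd_diff:
  assumes "u \<in> H2 \<Omega>" "v \<in> H2 \<Omega>" "length ds \<le> 2"
  shows "L2.nrm \<Omega> (\<lambda>z. wd \<Omega> u ds z - wd \<Omega> v ds z) = L2.nrm \<Omega> (wd \<Omega> (\<lambda>z. u z - v z) ds)"
proof -
  have L: "L2 \<Omega> (wd \<Omega> u ds)" "L2 \<Omega> (wd \<Omega> v ds)" "L2 \<Omega> (wd \<Omega> (\<lambda>z. u z - v z) ds)"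
    using assms H2.diff_mem L2_wd by auto
  have ae: "AE z in lebesgue_on \<Omega>. wd \<Omega> u ds z - wd \<Omega> v ds z = wd \<Omega> (\<lambda>z. u z - v z) ds z"
    using wd_lincomb[OF assms, of 1 "-1"] by auto
  have "L2inner \<Omega> (\<lambda>z. wd \<Omega> u ds z - wd \<Omega> v ds z) (\<lambda>z. wd \<Omega> u ds z - wd \<Omega> v ds z)
      = L2inner \<Omega> (wd \<Omega> (\<lambda>z. u z - v z) ds) (wd \<Omega> (\<lambda>z. u z - v z) ds)"
    using L L2.diff_mem[of "wd \<Omega> u ds" \<Omega> "wd \<Omega> v ds"] by (intro L2inner_cong_AE ae) auto
  then show ?thesis by (simp add: L2.nrm_def)
qed

lemma H20_iff: "\<phi> \<in> H20 \<Omega> \<longleftrightarrow> \<phi> \<in> H2 \<Omega> \<and>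
    (\<exists>s. (\<forall>n. test_fun \<Omega> (s n)) \<and> (\<lambda>n. H2.nrm (\<lambda>z. s n z - \<phi> z)) \<longlonglongrightarrow> 0)"
proof -
  have "(\<lambda>n. H2_normsq \<Omega> (\<lambda>z. s n z - \<phi> z)) \<longlonglongrightarrow> 0 \<longleftrightarrow> (\<lambda>n. H2.nrm (\<lambda>z. s n z - \<phi> z)) \<longlonglongrightarrow> 0"
    if phi: "\<phi> \<in> H2 \<Omega>" and s: "\<forall>n. test_fun \<Omega> (s n)" for s
  proof
    have mem: "(\<lambda>z. s n z - \<phi> z) \<in> H2 \<Omega>" for n using H2.diff_mem phi s test_H2 by blast
    show "(\<lambda>n. H2.nrm (\<lambda>z. s n z - \<phi> z)) \<longlonglongrightarrow> 0" if "(\<lambda>n. H2_normsq \<Omega> (\<lambda>z. s n z - \<phi> z)) \<longlonglongrightarrow> 0"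
      using tendsto_real_sqrt[OF that] by (simp add: H2.nrm_def H2_normsq_eq)
    show "(\<lambda>n. H2_normsq \<Omega> (\<lambda>z. s n z - \<phi> z)) \<longlonglongrightarrow> 0" if "(\<lambda>n. H2.nrm (\<lambda>z. s n z - \<phi> z)) \<longlonglongrightarrow> 0"
      using tendsto_power[OF that, of 2] by (simp add: H2.nrm_sq[OF mem] H2_normsq_eq)
  qed
  then show ?thesis unfolding H20_def by blast
qed

lemma H20_H2: "\<phi> \<in> H20 \<Omega> \<Longrightarrow> \<phi> \<in> H2 \<Omega>" by (simp add: H20_def)

lemma H20_ex:
  assumes "\<phi> \<in> H20 \<Omega>"
  shows "\<exists>s. (\<forall>n. test_fun \<Omega> (s n)) \<and> (\<lambda>n. H2.nrm (\<lambda>z. s n z - \<phi> z)) \<longlonglongrightarrow> 0"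
  using assms H20_iff by blast

lemma test_H20:
  assumes "test_fun \<Omega> g"
  shows "g \<in> H20 \<Omega>"
proof -
  have "H2.nrm (\<lambda>z. g z - g z) = 0" using H2.nrm_scale[OF test_H2[OF assms], of 0] by simp
  then show ?thesis using assms test_H2 by (auto simp: H20_iff intro!: exI[of _ "\<lambda>_. g"])
qed

text \<open>A diagonal choice: each \<open>s n\<close> is replaced by a test function at distance
  below \<open>1 / Suc n\<close>, which does not change the limit.\<close>

lemma H20_closed:
  assumes s: "\<And>n. s n \<in> H20 \<Omega>" and u: "u \<in> H2 \<Omega>" and lim: "(\<lambda>n. H2.nrm (\<lambda>z. s n z - u z)) \<longlonglongrightarrow> 0"
  shows "u \<in> H20 \<Omega>"
proof -
  have "\<exists>t. test_fun \<Omega> t \<and> H2.nrm (\<lambda>z. t z - s n z) < inverse (real (Suc n))" for n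
  proof -
    obtain t where t_test: "\<forall>k. test_fun \<Omega> (t k)" and t_lim: "(\<lambda>k. H2.nrm (\<lambda>z. t k z - s n z)) \<longlonglongrightarrow> 0"
      using H20_ex[OF s[of n]] by blast
    note t = t_test[rule_format] t_lim
    have "inverse (real (Suc n)) > 0" by simp
    from order_tendstoD(2)[OF t(2) this] have "\<exists>k. H2.nrm (\<lambda>z. t k z - s n z) < inverse (real (Suc n))"
      by (rule eventually_happens'[OF sequentially_bot])
    then show ?thesis using t(1) by blast
  qed
  then obtain t where t: "\<And>n. test_fun \<Omega> (t n)" "\<And>n. H2.nrm (\<lambda>z. t n z - s n z) < inverse (real (Suc n))"
    by metis
  have m: "t n \<in> H2 \<Omega>" "s n \<in> H2 \<Omega>" for n using t(1) s test_H2 H20_H2 by auto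
  have "(\<lambda>n. H2.nrm (\<lambda>z. t n z - u z)) \<longlonglongrightarrow> 0"
  proof (rule Lim_null_comparison)
    show "\<forall>\<^sub>F n in sequentially. norm (H2.nrm (\<lambda>z. t n z - u z)) \<le> inverse (real (Suc n)) + H2.nrm (\<lambda>z. s n z - u z)"
    proof (intro always_eventually allI)
      fix n
      have "0 \<le> H2.nrm (\<lambda>z. t n z - u z)" using H2.diff_mem m u by simp
      then show "norm (H2.nrm (\<lambda>z. t n z - u z)) \<le> inverse (real (Suc n)) + H2.nrm (\<lambda>z. s n z - u z)"
        using H2.nrm_diff_triangle[OF m(1) m(2) u, of n n] t(2)[of n] by simp
    qed
    show "(\<lambda>n. inverse (real (Suc n)) + H2.nrm (\<lambda>z. s n z - u z)) \<longlonglongrightarrow> 0"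
      using tendsto_add[OF LIMSEQ_inverse_real_of_nat lim] by simp
  qed
  then show ?thesis using H20_iff u t(1) by blast
qed

lemma H20_lincomb:
  assumes u: "u \<in> H20 \<Omega>" and v: "v \<in> H20 \<Omega>"
  shows "(\<lambda>z. c * u z + d * v z) \<in> H20 \<Omega>"
proof -
  obtain s where s_test: "\<forall>n. test_fun \<Omega> (s n)" and s_lim: "(\<lambda>n. H2.nrm (\<lambda>z. s n z - u z)) \<longlonglongrightarrow> 0"
    using H20_ex[OF u] by blast
  note s = s_test[rule_format] s_lim
  obtain t where t_test: "\<forall>n. test_fun \<Omega> (t n)" and t_lim: "(\<lambda>n. H2.nrm (\<lambda>z. t n z - v z)) \<longlonglongrightarrow> 0"
    using H20_ex[OF v] by blast
  note t = t_test[rule_format] t_lim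
  have m: "(\<lambda>z. s n z - u z) \<in> H2 \<Omega>" "(\<lambda>z. t n z - v z) \<in> H2 \<Omega>" for n
    using H2.diff_mem s t u v test_H2 H20_H2 by auto
  have eq: "(\<lambda>z. (c * s n z + d * t n z) - (c * u z + d * v z)) = (\<lambda>z. c * (s n z - u z) + d * (t n z - v z))" for n
    by (auto simp: algebra_simps)
  have "(\<lambda>n. H2.nrm (\<lambda>z. (c * s n z + d * t n z) - (c * u z + d * v z))) \<longlonglongrightarrow> 0"
  proof (rule Lim_null_comparison)
    show "\<forall>\<^sub>F n in sequentially. norm (H2.nrm (\<lambda>z. (c * s n z + d * t n z) - (c * u z + d * v z)))
        \<le> \<bar>c\<bar> * H2.nrm (\<lambda>z. s n z - u z) + \<bar>d\<bar> * H2.nrm (\<lambda>z. t n z - v z)"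
      unfolding eq
      using H2.nrm_add[OF H2.scale_mem[OF m(1), of c] H2.scale_mem[OF m(2), of d]]
      by (intro always_eventually allI) (simp add: H2.nrm_scale[OF m(1)] H2.nrm_scale[OF m(2)] H2.lin_mem[OF m])
    show "(\<lambda>n. \<bar>c\<bar> * H2.nrm (\<lambda>z. s n z - u z) + \<bar>d\<bar> * H2.nrm (\<lambda>z. t n z - v z)) \<longlonglongrightarrow> 0"
      using tendsto_add[OF tendsto_mult_right_zero[OF s(2), of "\<bar>c\<bar>"] tendsto_mult_right_zero[OF t(2), of "\<bar>d\<bar>"]] by simp
  qed
  moreover have "\<forall>n. test_fun \<Omega> (\<lambda>z. c * s n z + d * t n z)" using test_fun_lincomb s(1) t(1) by simp
  ultimately show ?thesis
    unfolding H20_iff using H2_lincomb[OF H20_H2[OF u] H20_H2[OF v], of c d]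
    by (intro conjI exI[of _ "\<lambda>n z. c * s n z + d * t n z"])
qed

section \<open>The energy form\<close>

lemma a_form_eq:
  assumes "u \<in> H2 \<Omega>" "v \<in> H2 \<Omega>"
  shows "a_form \<Omega> u v = (\<Sum>ds\<in>{[True, True], [True, False], [False, True], [False, False]}.
      L2inner \<Omega> (wd \<Omega> u ds) (wd \<Omega> v ds))"
proof -
  have "integrable (lebesgue_on \<Omega>) (\<lambda>z. wd \<Omega> u ds z * wd \<Omega> v ds z)" if "length ds \<le> 2" for ds
    using that assms by (intro L2_mult_integrable L2_wd)
  then show ?thesis by (simp add: a_form_def L2inner_def)
qed

lemma semi_inner_a_form: "semi_inner (H2 \<Omega>) (a_form \<Omega>)"
proof
  show "(\<lambda>z. 0) \<in> H2 \<Omega>" by (rule H2.zero_mem)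
  fix u v w :: "pt \<Rightarrow> real" and c d
  show "a_form \<Omega> u v = a_form \<Omega> v u" by (simp add: a_form_def mult.commute)
  assume u: "u \<in> H2 \<Omega>"
  show "0 \<le> a_form \<Omega> u u"
    unfolding a_form_eq[OF u u] using L2.form_nonneg[of _ \<Omega>] L2_wd[OF u] by (intro sum_nonneg) auto
  assume v: "v \<in> H2 \<Omega>"
  show "(\<lambda>z. c * u z + d * v z) \<in> H2 \<Omega>" by (rule H2_lincomb[OF u v])
  assume w: "w \<in> H2 \<Omega>"
  show "a_form \<Omega> (\<lambda>z. c * u z + d * v z) w = c * a_form \<Omega> u w + d * a_form \<Omega> v w"
    unfolding a_form_eq[OF u w] a_form_eq[OF v w] a_form_eq[OF H2_lincomb[OF u v] w]
      sum_distrib_left sum.distrib[symmetric]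
    by (intro sum.cong refl L2inner_wd_lincomb u v L2_wd w) auto
qed

sublocale E: semi_inner "H20 \<Omega>" "a_form \<Omega>"
proof -
  interpret A: semi_inner "H2 \<Omega>" "a_form \<Omega>" by (rule semi_inner_a_form)
  show "semi_inner (H20 \<Omega>) (a_form \<Omega>)"
    by unfold_locales (auto intro: H20_lincomb test_H20[OF test_fun_zero] A.form_lin A.form_sym A.form_nonneg H20_H2)
qed

lemma nrm_wd_le_E:
  assumes u: "u \<in> H20 \<Omega>" and ds: "length ds = 2"
  shows "L2.nrm \<Omega> (wd \<Omega> u ds) \<le> E.nrm u"
proof -
  have mem: "ds \<in> {[True, True], [True, False], [False, True], [False, False]}"
    using ds short_lists by (auto simp: length_Suc_conv numeral_2_eq_2)
  have "L2inner \<Omega> (wd \<Omega> u ds) (wd \<Omega> u ds) \<le> a_form \<Omega> u u"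
    unfolding a_form_eq[OF H20_H2[OF u] H20_H2[OF u]]
    using mem L2.form_nonneg[of _ \<Omega>] L2_wd[OF H20_H2[OF u]]
    by (intro member_le_sum[of ds _ "\<lambda>ds. L2inner \<Omega> (wd \<Omega> u ds) (wd \<Omega> u ds)"]) auto
  then show ?thesis by (simp add: L2.nrm_def E.nrm_def)
qed

lemma E_le_H2:
  assumes u: "u \<in> H20 \<Omega>"
  shows "E.nrm u \<le> H2.nrm u"
proof -
  have "a_form \<Omega> u u \<le> H2inner u u"
    unfolding a_form_eq[OF H20_H2[OF u] H20_H2[OF u]] H2inner_def
    using L2.form_nonneg[of _ \<Omega>] L2_wd[OF H20_H2[OF u]] by (intro sum_mono2) (auto simp: short_lists)
  then show ?thesis by (simp add: E.nrm_def H2.nrm_def)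
qed

lemma E_tendsto_of_H2:
  assumes "\<And>n. s n \<in> H20 \<Omega>" "u \<in> H20 \<Omega>" "(\<lambda>n. H2.nrm (\<lambda>z. s n z - u z)) \<longlonglongrightarrow> 0"
  shows "(\<lambda>n. E.nrm (\<lambda>z. s n z - u z)) \<longlonglongrightarrow> 0"
proof (rule Lim_null_comparison[OF always_eventually assms(3)], rule allI)
  fix n
  have "(\<lambda>z. s n z - u z) \<in> H20 \<Omega>" using E.diff_mem assms by blast
  then show "norm (E.nrm (\<lambda>z. s n z - u z)) \<le> H2.nrm (\<lambda>z. s n z - u z)" using E_le_H2 by simp
qed

section \<open>Pointwise values, the sup bound and the Poincare inequality\<close>

lemma nrm_indicator_le: "A \<in> sets borel \<Longrightarrow> L2.nrm \<Omega> (indicator A) \<le> sqrt vol"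
proof -
  assume A: "A \<in> sets borel"
  have "L2inner \<Omega> (indicator A) (indicator A) \<le> (\<integral>z. 1 \<partial>lebesgue_on \<Omega>)"
    unfolding L2inner_def using L2_mult_integrable[OF L2_indicator[OF A] L2_indicator[OF A]]
    by (intro integral_mono) (auto simp: indicator_def)
  then show ?thesis by (simp add: L2.nrm_def vol_def)
qed

lemma nrm_bounded_le:
  assumes "L2 \<Omega> g" "AE z in lebesgue_on \<Omega>. \<bar>g z\<bar> \<le> C" "C \<ge> 0"
  shows "L2.nrm \<Omega> g \<le> C * sqrt vol"
proof -
  have "L2inner \<Omega> g g \<le> (\<integral>z. C\<^sup>2 \<partial>lebesgue_on \<Omega>)"
    unfolding L2inner_def
  proof (rule integral_mono_AE)
    show "AE z in lebesgue_on \<Omega>. g z * g z \<le> C\<^sup>2"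
      using assms(2)
    proof eventually_elim
      case (elim z)
      then show ?case using power_mono[of "\<bar>g z\<bar>" C 2] by (simp add: power2_eq_square)
    qed
  qed (use L2_mult_integrable[OF assms(1) assms(1)] in auto)
  then have "L2inner \<Omega> g g \<le> C\<^sup>2 * vol" by (simp add: vol_def mult.commute)
  from real_sqrt_le_mono[OF this] show ?thesis using assms(3) by (simp add: L2.nrm_def real_sqrt_mult)
qed

text \<open>A representative of \<open>u\<close> whose value at each point is a bounded functional of \<open>u\<close>.\<close>

definition pval :: "(pt \<Rightarrow> real) \<Rightarrow> pt \<Rightarrow> real" where
  "pval u z = L2inner \<Omega> (indicator (quadrant z)) (wd \<Omega> u [True, False])"

lemma pval_test:
  assumes g: "test_fun \<Omega> g"
  shows "pval g z = g z"
proof -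
  note s = test_fun_smooth[OF g] and c = ccs_test_fun[OF g]
  have "pval g z = L2inner \<Omega> (indicator (quadrant z)) (ipd [True, False] g)"
    unfolding pval_def
    by (intro L2inner_cong_AE L2_indicator quadrant_borel L2_wd test_H2 g L2_test[OF g] wd_test) auto
  also have "\<dots> = (\<integral>w. indicator (quadrant z) w * ipd [True, False] g w \<partial>lborel)"
    by (intro L2inner_test g) simp
  also have "\<dots> = g z"
    using integral_quadrant_dydx[OF smooth2_dy[OF s, of "[]"] smooth2_dx[OF s, of "[False]"]
        c[of "[]"] c[of "[False]"] c[of "[True, False]"]] by simp
  finally show ?thesis .
qed

text \<open>Cauchy-Schwarz; \<open>sqrt vol\<close> bounds the L2 norm over \<open>\<Omega>\<close>
  of any quadrant indicator, uniformly in \<open>z\<close>.\<close>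

lemma pval_bound:
  assumes u: "u \<in> H20 \<Omega>"
  shows "\<bar>pval u z\<bar> \<le> sqrt vol * E.nrm u"
proof -
  have L: "L2 \<Omega> (wd \<Omega> u [True, False])" by (rule L2_wd[OF H20_H2[OF u]]) simp
  have "\<bar>pval u z\<bar> \<le> L2.nrm \<Omega> (indicator (quadrant z)) * L2.nrm \<Omega> (wd \<Omega> u [True, False])"
    unfolding pval_def using L L2_indicator[OF quadrant_borel] by (intro L2.Cauchy_Schwarz) auto
  also have "\<dots> \<le> sqrt vol * E.nrm u"
    using nrm_indicator_le[OF quadrant_borel] nrm_wd_le_E[OF u, of "[True, False]"] L vol_nonneg
    by (intro mult_mono) auto
  finally show ?thesis .
qed

lemma pval_lincomb:
  assumes "u \<in> H20 \<Omega>" "v \<in> H20 \<Omega>"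
  shows "pval (\<lambda>w. c * u w + d * v w) z = c * pval u z + d * pval v z"
  using L2inner_wd_lincomb[OF H20_H2[OF assms(1)] H20_H2[OF assms(2)] L2_indicator[OF quadrant_borel[of z]], of "[True, False]" c d]
  unfolding pval_def L2.form_sym[of _ "indicator (quadrant z)"] by simp

lemma bdd_lin_pval: "E.bdd_lin (\<lambda>u. pval u z) (H20 \<Omega>)"
  unfolding E.bdd_lin_def using pval_lincomb pval_bound by blast

text \<open>Approximating test functions coincide with their own \<open>pval\<close>. By
  \<open>pval_bound\<close> they converge to \<open>pval u\<close> uniformly, and by construction
  they converge to \<open>u\<close> in L2, so the two limits agree a.e.\<close>

lemma pval_AE:
  assumes u: "u \<in> H20 \<Omega>"
  shows "AE z in lebesgue_on \<Omega>. u z = pval u z"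
proof -
  obtain s where s_test: "\<forall>n. test_fun \<Omega> (s n)" and s_lim: "(\<lambda>n. H2.nrm (\<lambda>z. s n z - u z)) \<longlonglongrightarrow> 0"
    using H20_ex[OF u] by blast
  note s = s_test[rule_format] s_lim
  have sH: "s n \<in> H20 \<Omega>" for n using s(1) test_H20 by blast
  have dH: "(\<lambda>z. s n z - u z) \<in> H20 \<Omega>" for n using E.diff_mem[OF sH u] .
  note Elim = E_tendsto_of_H2[OF sH u s(2)]
  have close: "\<bar>s n z - pval u z\<bar> \<le> sqrt vol * E.nrm (\<lambda>z. s n z - u z)" for n z
    using pval_bound[OF dH, of n z] pval_lincomb[OF sH u, of 1 n "-1" z] by (simp add: pval_test[OF s(1)])
  have meas: "pval u \<in> borel_measurable (lebesgue_on \<Omega>)"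
  proof (rule borel_measurable_LIMSEQ_metric)
    show "s n \<in> borel_measurable (lebesgue_on \<Omega>)" for n
      using L2_test[OF s(1), of "[]" n] by (simp add: L2_def)
    show "(\<lambda>n. s n z) \<longlonglongrightarrow> pval u z" for z
    proof -
      have "(\<lambda>n. s n z - pval u z) \<longlonglongrightarrow> 0"
        by (rule Lim_null_comparison[OF _ tendsto_mult_right_zero[OF Elim, of "sqrt vol"]]) (simp add: close)
      then show ?thesis by (simp add: LIM_zero_iff)
    qed
  qed
  have Lp: "L2 \<Omega> (pval u)"
    using L2_bounded[OF meas, of "sqrt vol * E.nrm u"] pval_bound[OF u] by simp
  have Lu: "L2 \<Omega> u" "\<And>n. L2 \<Omega> (s n)" using H2_L2 H20_H2 u sH by auto
  have "L2.nrm \<Omega> (\<lambda>z. u z - pval u z) \<le> 0"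
  proof (rule LIMSEQ_le_const)
    show "(\<lambda>n. H2.nrm (\<lambda>z. s n z - u z) + sqrt vol * E.nrm (\<lambda>z. s n z - u z) * sqrt vol) \<longlonglongrightarrow> 0"
      using tendsto_add[OF s(2) tendsto_mult_left_zero[OF tendsto_mult_right_zero[OF Elim, of "sqrt vol"], of "sqrt vol"]]
      by simp
    have "L2.nrm \<Omega> (\<lambda>z. u z - pval u z) \<le> H2.nrm (\<lambda>z. s n z - u z) + sqrt vol * E.nrm (\<lambda>z. s n z - u z) * sqrt vol" for n
    proof -
      have "L2.nrm \<Omega> (\<lambda>z. u z - s n z) = L2.nrm \<Omega> (\<lambda>z. s n z - u z)"
        using L2.nrm_minus_commute[of u \<Omega> "s n"] Lu by simp
      also have "\<dots> = L2.nrm \<Omega> (wd \<Omega> (\<lambda>z. s n z - u z) [])"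
      proof -
        have "L2inner \<Omega> (\<lambda>z. s n z - u z) (\<lambda>z. s n z - u z)
            = L2inner \<Omega> (wd \<Omega> (\<lambda>z. s n z - u z) []) (wd \<Omega> (\<lambda>z. s n z - u z) [])"
          using wd_Nil[OF H20_H2[OF dH], of n] H2_L2[OF H20_H2[OF dH], of n] L2_wd[OF H20_H2[OF dH], of "[]" n]
          by (intro L2inner_cong_AE) auto
        then show ?thesis by (simp add: L2.nrm_def)
      qed
      also have "\<dots> \<le> H2.nrm (\<lambda>z. s n z - u z)" by (intro L2_nrm_wd_le H20_H2 dH) simp
      finally have 1: "L2.nrm \<Omega> (\<lambda>z. u z - s n z) \<le> H2.nrm (\<lambda>z. s n z - u z)" .
      have 2: "L2.nrm \<Omega> (\<lambda>z. s n z - pval u z) \<le> sqrt vol * E.nrm (\<lambda>z. s n z - u z) * sqrt vol"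
        using close[of n] L2.diff_mem[of "s n" \<Omega> "pval u"] Lu Lp vol_nonneg E.nrm_nonneg[OF dH]
        by (intro nrm_bounded_le) auto
      show ?thesis
        using L2.nrm_diff_triangle[of u \<Omega> "s n" "pval u"] Lu Lp 1 2 by simp
    qed
    then show "\<exists>N. \<forall>n\<ge>N. L2.nrm \<Omega> (\<lambda>z. u z - pval u z)
        \<le> H2.nrm (\<lambda>z. s n z - u z) + sqrt vol * E.nrm (\<lambda>z. s n z - u z) * sqrt vol" by blast
  qed
  moreover have L: "L2 \<Omega> (\<lambda>z. u z - pval u z)" using L2.diff_mem[of u \<Omega> "pval u"] Lu Lp by simp
  ultimately have "L2.nrm \<Omega> (\<lambda>z. u z - pval u z) = 0" by (intro antisym) simp_all
  then have "L2inner \<Omega> (\<lambda>z. u z - pval u z) (\<lambda>z. u z - pval u z) = 0"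
    using L2.nrm_sq[of "\<lambda>z. u z - pval u z" \<Omega>] L by simp
  from L2inner_self_zero[OF L this] show ?thesis by eventually_elim simp
qed

lemma sup_bound:
  assumes "u \<in> H20 \<Omega>"
  shows "AE z in lebesgue_on \<Omega>. \<bar>u z\<bar> \<le> sqrt vol * E.nrm u"
  using pval_AE[OF assms] by eventually_elim (use pval_bound[OF assms] in auto)

lemma L2_nrm_le_E:
  assumes u: "u \<in> H20 \<Omega>"
  shows "L2.nrm \<Omega> u \<le> vol * E.nrm u"
proof -
  have "L2.nrm \<Omega> u \<le> sqrt vol * E.nrm u * sqrt vol"
    using vol_nonneg u by (intro nrm_bounded_le H2_L2 H20_H2 sup_bound) auto
  also have "\<dots> = (sqrt vol * sqrt vol) * E.nrm u" by (simp only: ac_simps)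
  also have "\<dots> = vol * E.nrm u" using vol_nonneg by simp
  finally show ?thesis .
qed

text \<open>Order zero comes from the sup bound, with factor \<open>vol\<^sup>2\<close>. Each first
  derivative contributes \<open>vol\<close>, since the square of its norm is minus the inner product
  of \<open>g\<close> with the pure second derivative. Adding the energy itself gives
  \<open>vol\<^sup>2 + 2 * vol + 1\<close>, a square.\<close>

lemma Poincare_test:
  assumes g: "test_fun \<Omega> g"
  shows "H2.nrm g \<le> (vol + 1) * E.nrm g"
proof -
  have gH: "g \<in> H20 \<Omega>" by (rule test_H20[OF g])
  have L: "L2 \<Omega> (ipd ds g)" for ds by (rule L2_test[OF g])
  define D where "D = a_form \<Omega> g g"
  have D0: "0 \<le> D" unfolding D_def by (rule E.form_nonneg[OF gH])
  have nE: "E.nrm g = sqrt D" by (simp add: E.nrm_def D_def)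
  have t: "L2inner \<Omega> (wd \<Omega> g ds) (wd \<Omega> g ds) = L2inner \<Omega> (ipd ds g) (ipd ds g)" if "length ds \<le> 2" for ds
    by (rule L2inner_wd_test[OF g g that that])
  have n0: "L2.nrm \<Omega> g \<le> vol * sqrt D" using L2_nrm_le_E[OF gH] nE by simp
  have n0': "L2inner \<Omega> (ipd [] g) (ipd [] g) \<le> vol\<^sup>2 * D"
    using power_mono[OF n0, of 2] L2.nrm_sq[of g \<Omega>] L2.nrm_nonneg[of g \<Omega>] L[of "[]"] D0
    by (simp add: power_mult_distrib)
  have n1: "L2inner \<Omega> (ipd [d] g) (ipd [d] g) \<le> vol * D" for d
  proof -
    have "L2inner \<Omega> g (ipd [d] (ipd [d] g)) = - L2inner \<Omega> (ipd [d] g) (ipd [d] g)"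
      using is_weak_deriv_test[OF g, of "[d]"] test_fun_ipd[OF g, of "[d]"] unfolding is_weak_deriv_def by auto
    then have "L2inner \<Omega> (ipd [d] g) (ipd [d] g) \<le> \<bar>L2inner \<Omega> g (ipd [d, d] g)\<bar>"
      using ipd_append[of "[d]" "[d]" g] by simp
    also have "\<dots> \<le> L2.nrm \<Omega> g * L2.nrm \<Omega> (ipd [d, d] g)"
      using L[of "[]"] L[of "[d, d]"] by (intro L2.Cauchy_Schwarz) auto
    also have "\<dots> \<le> (vol * sqrt D) * sqrt D"
    proof (rule mult_mono[OF n0])
      show "L2.nrm \<Omega> (ipd [d, d] g) \<le> sqrt D"
        using nrm_wd_le_E[OF gH, of "[d, d]"] t[of "[d, d]"] nE by (simp add: L2.nrm_def)
    qed (use L[of "[d, d]"] vol_nonneg D0 in auto)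
    also have "\<dots> = vol * D" using D0 by simp
    finally show ?thesis .
  qed
  have "H2inner g g = L2inner \<Omega> (ipd [] g) (ipd [] g) + L2inner \<Omega> (ipd [True] g) (ipd [True] g)
      + L2inner \<Omega> (ipd [False] g) (ipd [False] g) + D"
    unfolding D_def a_form_eq[OF test_H2[OF g] test_H2[OF g]] H2inner_def short_lists
    using t by simp
  also have "\<dots> \<le> vol\<^sup>2 * D + vol * D + vol * D + D" using n0' n1[of True] n1[of False] by linarith
  also have "\<dots> = (vol + 1)\<^sup>2 * D" by (simp add: power2_eq_square algebra_simps)
  finally have "H2inner g g \<le> (vol + 1)\<^sup>2 * D" .
  from real_sqrt_le_mono[OF this] show ?thesis
    using vol_nonneg by (simp add: H2.nrm_def nE real_sqrt_mult)
qed

lemma Poincare: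
  assumes u: "u \<in> H20 \<Omega>"
  shows "H2.nrm u \<le> (vol + 1) * E.nrm u"
proof -
  obtain s where s_test: "\<forall>n. test_fun \<Omega> (s n)" and s_lim: "(\<lambda>n. H2.nrm (\<lambda>z. s n z - u z)) \<longlonglongrightarrow> 0"
    using H20_ex[OF u] by blast
  note s = s_test[rule_format] s_lim
  have sH: "s n \<in> H20 \<Omega>" for n using s(1) test_H20 by blast
  have 1: "(\<lambda>n. H2.nrm (s n)) \<longlonglongrightarrow> H2.nrm u"
    by (rule H2.nrm_tendsto[OF H20_H2[OF sH] H20_H2[OF u] s(2)])
  have 2: "(\<lambda>n. (vol + 1) * E.nrm (s n)) \<longlonglongrightarrow> (vol + 1) * E.nrm u"
    by (intro tendsto_mult tendsto_const E.nrm_tendsto sH u E_tendsto_of_H2 s(2))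
  show ?thesis by (rule LIMSEQ_le[OF 1 2]) (use Poincare_test[OF s(1)] in auto)
qed

text \<open>Poincare upgrades an energy-Cauchy sequence to one that is Cauchy in every derivative up
  to order two. The L2 limits of these derivatives are the weak derivatives of the limit of order
  zero, because the defining identity passes to the limit against each fixed test function.\<close>

lemma H20_complete:
  assumes s: "\<And>n. s n \<in> H20 \<Omega>"
    and cau: "\<forall>e>0. \<exists>N. \<forall>m\<ge>N. \<forall>n\<ge>N. E.nrm (\<lambda>z. s m z - s n z) < e"
  shows "\<exists>u\<in>H20 \<Omega>. (\<lambda>n. E.nrm (\<lambda>z. s n z - u z)) \<longlonglongrightarrow> 0"
proof -
  have sH: "s n \<in> H2 \<Omega>" for n using s H20_H2 by blast
  have vp: "vol + 1 > 0" using vol_nonneg by simp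
  have cauds: "\<forall>e>0. \<exists>N. \<forall>m\<ge>N. \<forall>n\<ge>N. L2.nrm \<Omega> (\<lambda>z. wd \<Omega> (s m) ds z - wd \<Omega> (s n) ds z) < e"
    if ds: "length ds \<le> 2" for ds
  proof (intro allI impI)
    fix e :: real assume "e > 0"
    then obtain N where N: "\<And>m n. m \<ge> N \<Longrightarrow> n \<ge> N \<Longrightarrow> E.nrm (\<lambda>z. s m z - s n z) < e / (vol + 1)"
      using cau vp by (meson divide_pos_pos)
    have "L2.nrm \<Omega> (\<lambda>z. wd \<Omega> (s m) ds z - wd \<Omega> (s n) ds z) < e" if "m \<ge> N" "n \<ge> N" for m n
    proof -
      have "L2.nrm \<Omega> (\<lambda>z. wd \<Omega> (s m) ds z - wd \<Omega> (s n) ds z) \<le> H2.nrm (\<lambda>z. s m z - s n z)"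
        using L2_nrm_wd_le[OF H2.diff_mem[OF sH sH] ds, of m n] L2_nrm_wd_diff[OF sH sH ds, of m n] by simp
      also have "\<dots> \<le> (vol + 1) * E.nrm (\<lambda>z. s m z - s n z)" by (rule Poincare[OF E.diff_mem[OF s s]])
      also have "\<dots> < e" using N[OF that] vp by (simp add: pos_less_divide_eq mult.commute)
      finally show ?thesis .
    qed
    then show "\<exists>N. \<forall>m\<ge>N. \<forall>n\<ge>N. L2.nrm \<Omega> (\<lambda>z. wd \<Omega> (s m) ds z - wd \<Omega> (s n) ds z) < e" by blast
  qed
  \<comment> \<open>The guard on the length makes the claim vacuous for longer lists, so one choice
    function covers all lists.\<close>
  have "\<forall>ds. \<exists>g. length ds \<le> 2 \<longrightarrow> L2 \<Omega> g \<and> (\<lambda>n. L2.nrm \<Omega> (\<lambda>z. wd \<Omega> (s n) ds z - g z)) \<longlonglongrightarrow> 0"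
    using L2_complete[OF L2_wd[OF sH] cauds] by blast
  from choice[OF this] obtain g where gg: "\<forall>ds. length ds \<le> 2 \<longrightarrow>
      L2 \<Omega> (g ds) \<and> (\<lambda>n. L2.nrm \<Omega> (\<lambda>z. wd \<Omega> (s n) ds z - g ds z)) \<longlonglongrightarrow> 0" ..
  have g: "L2 \<Omega> (g ds)" "(\<lambda>n. L2.nrm \<Omega> (\<lambda>z. wd \<Omega> (s n) ds z - g ds z)) \<longlonglongrightarrow> 0"
    if "length ds \<le> 2" for ds
    using gg that by blast+
  define u where "u = g []"
  have Lu: "L2 \<Omega> u" using g(1) by (simp add: u_def)
  have lim: "(\<lambda>n. L2inner \<Omega> (wd \<Omega> (s n) ds) \<psi>) \<longlonglongrightarrow> L2inner \<Omega> (g ds) \<psi>"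
    if "length ds \<le> 2" "L2 \<Omega> \<psi>" for ds \<psi>
    using L2.bdd_lin_tendsto[OF L2.bdd_lin_form[of \<psi> \<Omega>], of "\<lambda>n. wd \<Omega> (s n) ds" "g ds"] g[OF that(1)] that
      L2_wd[OF sH that(1)] by (simp add: L2.form_sym[of \<Omega> \<psi>])
  have wk: "is_weak_deriv \<Omega> u ds (g ds)" if ds: "length ds \<le> 2" for ds
    unfolding is_weak_deriv_def
  proof (intro conjI allI impI)
    show "L2 \<Omega> (g ds)" by (rule g(1)[OF ds])
    fix \<psi> assume psi: "test_fun \<Omega> \<psi>"
    have eq: "L2inner \<Omega> (wd \<Omega> (s n) []) (ipd ds \<psi>) = (-1) ^ length ds * L2inner \<Omega> (wd \<Omega> (s n) ds) \<psi>" for n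
    proof -
      have "L2inner \<Omega> (wd \<Omega> (s n) []) (ipd ds \<psi>) = L2inner \<Omega> (s n) (ipd ds \<psi>)"
        by (intro L2inner_cong_AE L2_wd sH L2_test[OF psi] wd_Nil H2_L2) auto
      also have "\<dots> = (-1) ^ length ds * L2inner \<Omega> (wd \<Omega> (s n) ds) \<psi>"
        using is_weak_deriv_wd[OF sH ds, of n] psi unfolding is_weak_deriv_def by blast
      finally show ?thesis .
    qed
    have "(\<lambda>n. L2inner \<Omega> (wd \<Omega> (s n) []) (ipd ds \<psi>)) \<longlonglongrightarrow> L2inner \<Omega> u (ipd ds \<psi>)"
      unfolding u_def by (intro lim L2_test[OF psi]) simp
    moreover have "(\<lambda>n. (-1) ^ length ds * L2inner \<Omega> (wd \<Omega> (s n) ds) \<psi>) \<longlonglongrightarrow> (-1) ^ length ds * L2inner \<Omega> (g ds) \<psi>"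
      using L2_test[OF psi, of "[]"] by (intro tendsto_mult tendsto_const lim ds) simp
    ultimately show "L2inner \<Omega> u (ipd ds \<psi>) = (-1) ^ length ds * L2inner \<Omega> (g ds) \<psi>"
      unfolding eq by (rule LIMSEQ_unique)
  qed
  have uH: "u \<in> H2 \<Omega>" unfolding H2_def using Lu wk by blast
  have nrm_eq: "L2.nrm \<Omega> (wd \<Omega> (\<lambda>z. s n z - u z) ds) = L2.nrm \<Omega> (\<lambda>z. wd \<Omega> (s n) ds z - g ds z)"
    if ds: "length ds \<le> 2" for n ds
  proof -
    have ae: "AE z in lebesgue_on \<Omega>. wd \<Omega> (s n) ds z - wd \<Omega> u ds z = wd \<Omega> (s n) ds z - g ds z"
      using wd_AE[OF wk[OF ds]] by eventually_elim simp
    have "L2 \<Omega> (\<lambda>z. wd \<Omega> (s n) ds z - wd \<Omega> u ds z)" "L2 \<Omega> (\<lambda>z. wd \<Omega> (s n) ds z - g ds z)"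
      using L2.diff_mem[of "wd \<Omega> (s n) ds" \<Omega>] L2_wd[OF sH ds, of n] L2_wd[OF uH ds] g(1)[OF ds] by auto
    then have "L2inner \<Omega> (\<lambda>z. wd \<Omega> (s n) ds z - wd \<Omega> u ds z) (\<lambda>z. wd \<Omega> (s n) ds z - wd \<Omega> u ds z)
        = L2inner \<Omega> (\<lambda>z. wd \<Omega> (s n) ds z - g ds z) (\<lambda>z. wd \<Omega> (s n) ds z - g ds z)"
      by (intro L2inner_cong_AE ae)
    then show ?thesis using L2_nrm_wd_diff[OF sH uH ds, of n] by (simp add: L2.nrm_def)
  qed
  have "(\<lambda>n. \<Sum>ds\<in>{ds. length ds \<le> 2}. (L2.nrm \<Omega> (wd \<Omega> (\<lambda>z. s n z - u z) ds))\<^sup>2) \<longlonglongrightarrow> (\<Sum>ds\<in>{ds :: bool list. length ds \<le> 2}. 0\<^sup>2)"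
    by (intro tendsto_sum tendsto_power) (use g(2) nrm_eq in auto)
  moreover have "(\<Sum>ds\<in>{ds. length ds \<le> 2}. (L2.nrm \<Omega> (wd \<Omega> (\<lambda>z. s n z - u z) ds))\<^sup>2) = H2inner (\<lambda>z. s n z - u z) (\<lambda>z. s n z - u z)" for n
    unfolding H2inner_def using L2_wd[OF H2.diff_mem[OF sH uH]] by (intro sum.cong L2.nrm_sq) auto
  ultimately have "(\<lambda>n. H2inner (\<lambda>z. s n z - u z) (\<lambda>z. s n z - u z)) \<longlonglongrightarrow> 0" by simp
  from tendsto_real_sqrt[OF this] have H2lim: "(\<lambda>n. H2.nrm (\<lambda>z. s n z - u z)) \<longlonglongrightarrow> 0"
    by (simp add: H2.nrm_def)
  have uH20: "u \<in> H20 \<Omega>" by (rule H20_closed[OF s uH H2lim])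
  from E_tendsto_of_H2[OF s this H2lim] uH20 show ?thesis by blast
qed

sublocale E: complete_semi_inner "H20 \<Omega>" "a_form \<Omega>"
  by unfold_locales (rule H20_complete)

lemma E_dense:
  assumes u: "u \<in> H20 \<Omega>"
  shows "\<exists>s. (\<forall>n. test_fun \<Omega> (s n)) \<and> (\<lambda>n. E.nrm (\<lambda>z. s n z - u z)) \<longlonglongrightarrow> 0"
proof -
  obtain s where s: "\<forall>n. test_fun \<Omega> (s n)" "(\<lambda>n. H2.nrm (\<lambda>z. s n z - u z)) \<longlonglongrightarrow> 0"
    using H20_ex[OF u] by blast
  have "(\<lambda>n. E.nrm (\<lambda>z. s n z - u z)) \<longlonglongrightarrow> 0"
    by (rule E_tendsto_of_H2[OF test_H20 u s(2)]) (simp add: s(1))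
  with s(1) show ?thesis by blast
qed

text \<open>Density of the test functions in the energy norm; it extends identities of
  \<open>b_form\<close> one argument at a time.\<close>

lemma bdd_lin_zero_on_test:
  assumes L: "E.bdd_lin L (H20 \<Omega>)" and z: "\<And>g. test_fun \<Omega> g \<Longrightarrow> L g = 0" and u: "u \<in> H20 \<Omega>"
  shows "L u = 0"
proof -
  obtain s where s_test: "\<forall>n. test_fun \<Omega> (s n)" and s_lim: "(\<lambda>n. E.nrm (\<lambda>z. s n z - u z)) \<longlonglongrightarrow> 0"
    using E_dense[OF u] by blast
  note s = s_test[rule_format] s_lim
  have "(\<lambda>n. L (s n)) \<longlonglongrightarrow> L u" by (rule E.bdd_lin_tendsto[OF L test_H20[OF s(1)] u s(2)])
  then show ?thesis using z[OF s(1)] LIMSEQ_unique[OF _ tendsto_const[of 0]] by simp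
qed

end

section \<open>The von Karman trilinear form\<close>

text \<open>\<open>[u, v]\<close> is the divergence of \<open>(u_yy v_x - u_xy v_y, u_xx v_y - u_xy v_x)\<close>; integrating it by parts
  against \<open>w\<close> gives an expression symmetric in \<open>v\<close> and \<open>w\<close>.\<close>

lemma null_lagrangian_identity:
  assumes u: "test_fun \<Omega> u" and v: "test_fun \<Omega> v" and w: "test_fun \<Omega> w"
  shows "(\<integral>z. (ipd [True, True] u z * ipd [False, False] v z + ipd [False, False] u z * ipd [True, True] v z
        - 2 * ipd [True, False] u z * ipd [True, False] v z) * w z \<partial>lborel)
    = - (\<integral>z. ipd [True, True] u z * (ipd [False] v z * ipd [False] w z)
        + ipd [False, False] u z * (ipd [True] v z * ipd [True] w z)
        - ipd [True, False] u z * (ipd [True] v z * ipd [False] w z + ipd [False] v z * ipd [True] w z) \<partial>lborel)"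
    (is "(\<integral>z. ?L z \<partial>lborel) = - (\<integral>z. ?R z \<partial>lborel)")
proof -
  note su = test_fun_smooth[OF u] and sv = test_fun_smooth[OF v] and sw = test_fun_smooth[OF w]
  note cu = ccs_test_fun[OF u] and cv = ccs_test_fun[OF v] and cw = ccs_test_fun[OF w]
  \<comment> \<open>Divergence produces derivatives in several orders. They are normalised so that
    the third derivatives of \<open>u\<close> in \<open>X'\<close> and \<open>Y'\<close>
    cancel.\<close>
  have mixed: "ipd [False, True] v = ipd [True, False] v" using ipd_rev[OF v, of "[True, False]"] by simp
  have third1: "ipd [False, True, True] u = ipd [True, True, False] u" using ipd_rev[OF u, of "[True, True, False]"] by simp
  have third2: "ipd [False, True, False] u = ipd [True, False, False] u"
    using pd_commute[OF test_fun_ipd[OF u, of "[False]"]] by simp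
  \<comment> \<open>\<open>(X, Y)\<close> is the vector field of the divergence formula multiplied
    by \<open>w\<close>; \<open>X'\<close> and \<open>Y'\<close> are its x- and y-derivative by the
    product rule, so their sum integrates to zero.\<close>
  define X where "X z = (ipd [False, False] u z * ipd [True] v z - ipd [True, False] u z * ipd [False] v z) * ipd [] w z" for z
  define X' where "X' z = (ipd [True, False, False] u z * ipd [True] v z + ipd [False, False] u z * ipd [True, True] v z
      - (ipd [True, True, False] u z * ipd [False] v z + ipd [True, False] u z * ipd [True, False] v z)) * ipd [] w z
      + (ipd [False, False] u z * ipd [True] v z - ipd [True, False] u z * ipd [False] v z) * ipd [True] w z" for z
  define Y where "Y z = (ipd [True, True] u z * ipd [False] v z - ipd [True, False] u z * ipd [True] v z) * ipd [] w z" for z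
  define Y' where "Y' z = (ipd [False, True, True] u z * ipd [False] v z + ipd [True, True] u z * ipd [False, False] v z
      - (ipd [False, True, False] u z * ipd [True] v z + ipd [True, False] u z * ipd [False, True] v z)) * ipd [] w z
      + (ipd [True, True] u z * ipd [False] v z - ipd [True, False] u z * ipd [True] v z) * ipd [False] w z" for z
  have cX: "ccs X" "ccs X'" "ccs Y" "ccs Y'"
    unfolding X_def X'_def Y_def Y'_def by (intro ccs_mult ccs_add ccs_diff cu cv cw)+
  have dX: "((\<lambda>t. X (t, y)) has_real_derivative X' (x, y)) (at x)" for x y
    unfolding X_def X'_def
    by (rule DERIV_cong[OF DERIV_mult[OF DERIV_diff[OF DERIV_mult[OF smooth2_dx[OF su] smooth2_dx[OF sv]]
          DERIV_mult[OF smooth2_dx[OF su] smooth2_dx[OF sv]]] smooth2_dx[OF sw]]]) (simp only: algebra_simps)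
  have dY: "((\<lambda>t. Y (x, t)) has_real_derivative Y' (x, y)) (at y)" for x y
    unfolding Y_def Y'_def
    by (rule DERIV_cong[OF DERIV_mult[OF DERIV_diff[OF DERIV_mult[OF smooth2_dy[OF su] smooth2_dy[OF sv]]
          DERIV_mult[OF smooth2_dy[OF su] smooth2_dy[OF sv]]] smooth2_dy[OF sw]]]) (simp only: algebra_simps)
  have "(\<integral>z. X' z + Y' z \<partial>lborel) = 0"
    using integral_dx_zero[OF dX cX(1,2)] integral_dy_zero[OF dY cX(3,4)] integrable_ccs[OF cX(2)] integrable_ccs[OF cX(4)]
    by simp
  moreover have "(\<lambda>z. X' z + Y' z) = (\<lambda>z. ?L z + ?R z)"
    unfolding X'_def Y'_def mixed third1 third2 by (simp add: fun_eq_iff algebra_simps)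
  moreover have "ccs ?L"
    using ccs_mult[OF ccs_diff[OF ccs_add[OF ccs_mult[OF cu[of "[True, True]"] cv[of "[False, False]"]]
          ccs_mult[OF cu[of "[False, False]"] cv[of "[True, True]"]]]
        ccs_lincomb[OF ccs_mult[OF cu[of "[True, False]"] cv[of "[True, False]"]]
          ccs_mult[OF cu[of "[True, False]"] cv[of "[True, False]"]], of 1 1]] cw[of "[]"]]
    by (simp add: mult.assoc)
  moreover have "ccs ?R" by (intro ccs_mult ccs_add ccs_diff cu cv cw)
  ultimately show ?thesis by (simp add: integrable_ccs)
qed

context bounded_open
begin

section \<open>Multilinearity, bounds and symmetry of the trilinear form\<close>

lemma nrm_mult_bounded:
  assumes g: "L2 \<Omega> g" and h: "h \<in> borel_measurable (lebesgue_on \<Omega>)" "AE z in lebesgue_on \<Omega>. \<bar>h z\<bar> \<le> C" and C: "0 \<le> C"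
  shows "L2.nrm \<Omega> (\<lambda>z. h z * g z) \<le> C * L2.nrm \<Omega> g"
proof -
  note hg = L2_mult_bounded[OF g h]
  have "L2inner \<Omega> (\<lambda>z. h z * g z) (\<lambda>z. h z * g z) \<le> (\<integral>z. C\<^sup>2 * (g z * g z) \<partial>lebesgue_on \<Omega>)"
    unfolding L2inner_def
  proof (rule integral_mono_AE)
    show "AE z in lebesgue_on \<Omega>. h z * g z * (h z * g z) \<le> C\<^sup>2 * (g z * g z)"
      using h(2)
    proof eventually_elim
      case (elim z)
      then have "(h z)\<^sup>2 \<le> C\<^sup>2" using power_mono[of "\<bar>h z\<bar>" C 2] by simp
      then have "(h z)\<^sup>2 * (g z)\<^sup>2 \<le> C\<^sup>2 * (g z)\<^sup>2" by (intro mult_right_mono) auto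
      then show ?case by (simp add: power2_eq_square ac_simps)
    qed
  qed (use L2_mult_integrable[OF hg hg] L2_mult_integrable[OF g g] in auto)
  also have "\<dots> = C\<^sup>2 * L2inner \<Omega> g g" by (simp add: L2inner_def)
  finally show ?thesis using real_sqrt_le_mono C by (fastforce simp: L2.nrm_def real_sqrt_mult)
qed

lemma H20_measurable: "u \<in> H20 \<Omega> \<Longrightarrow> u \<in> borel_measurable (lebesgue_on \<Omega>)"
  using H2_L2 H20_H2 by (auto simp: L2_def)

text \<open>A product of three L2 functions need not be integrable. Grouping the bounded factor
  \<open>w\<close> with one second derivative keeps that product in L2 and makes the integral an
  inner product.\<close>

definition tri :: "bool list \<Rightarrow> bool list \<Rightarrow> (pt \<Rightarrow> real) \<Rightarrow> (pt \<Rightarrow> real) \<Rightarrow> (pt \<Rightarrow> real) \<Rightarrow> real" where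
  "tri ds es w u v = L2inner \<Omega> (\<lambda>z. w z * wd \<Omega> u ds z) (wd \<Omega> v es)"

lemma L2_tri:
  assumes "w \<in> H20 \<Omega>" "u \<in> H20 \<Omega>" "length ds = 2"
  shows "L2 \<Omega> (\<lambda>z. w z * wd \<Omega> u ds z)"
  by (rule L2_mult_bounded[OF L2_wd[OF H20_H2] H20_measurable sup_bound]) (use assms in auto)

lemma tri_lin_v:
  assumes "w \<in> H20 \<Omega>" "u \<in> H20 \<Omega>" "v \<in> H20 \<Omega>" "v' \<in> H20 \<Omega>" "length ds = 2" "length es = 2"
  shows "tri ds es w u (\<lambda>z. c * v z + d * v' z) = c * tri ds es w u v + d * tri ds es w u v'"
  using L2inner_wd_lincomb[OF H20_H2[OF assms(3)] H20_H2[OF assms(4)] L2_tri[OF assms(1,2,5)], of es] assms(6)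
  unfolding tri_def L2.form_sym[of _ "\<lambda>z. w z * wd \<Omega> u ds z"] by simp

lemma tri_lin_w:
  assumes "w \<in> H20 \<Omega>" "w' \<in> H20 \<Omega>" "u \<in> H20 \<Omega>" "v \<in> H20 \<Omega>" "length ds = 2" "length es = 2"
  shows "tri ds es (\<lambda>z. c * w z + d * w' z) u v = c * tri ds es w u v + d * tri ds es w' u v"
  using L2.form_lin[of "\<lambda>z. w z * wd \<Omega> u ds z" \<Omega> "\<lambda>z. w' z * wd \<Omega> u ds z" "wd \<Omega> v es" c d]
    L2_tri[OF assms(1,3,5)] L2_tri[OF assms(2,3,5)] L2_wd[OF H20_H2[OF assms(4)], of es] assms(6)
  by (simp add: tri_def algebra_simps)

lemma tri_bound:
  assumes "w \<in> H20 \<Omega>" "u \<in> H20 \<Omega>" "v \<in> H20 \<Omega>" and ds: "length ds = 2" "length es = 2"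
  shows "\<bar>tri ds es w u v\<bar> \<le> sqrt vol * E.nrm w * E.nrm u * E.nrm v"
proof -
  have L: "L2 \<Omega> (wd \<Omega> u ds)" "L2 \<Omega> (wd \<Omega> v es)" using L2_wd H20_H2 assms by auto
  have c: "0 \<le> sqrt vol * E.nrm w" using vol_nonneg assms by simp
  have "\<bar>tri ds es w u v\<bar> \<le> L2.nrm \<Omega> (\<lambda>z. w z * wd \<Omega> u ds z) * L2.nrm \<Omega> (wd \<Omega> v es)"
    unfolding tri_def using L L2_tri[OF assms(1,2) ds(1)] by (intro L2.Cauchy_Schwarz) auto
  also have "\<dots> \<le> (sqrt vol * E.nrm w * L2.nrm \<Omega> (wd \<Omega> u ds)) * L2.nrm \<Omega> (wd \<Omega> v es)"
    using L nrm_mult_bounded[OF L(1) H20_measurable sup_bound c] assms by (intro mult_right_mono) auto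
  also have "\<dots> \<le> (sqrt vol * E.nrm w * E.nrm u) * E.nrm v"
    using L nrm_wd_le_E assms c by (intro mult_mono mult_left_mono) auto
  finally show ?thesis .
qed

lemma b_form_tri:
  assumes "u \<in> H20 \<Omega>" "v \<in> H20 \<Omega>" "w \<in> H20 \<Omega>"
  shows "b_form \<Omega> u v w = - (1/2) * (tri [True, True] [False, False] w u v + tri [False, False] [True, True] w u v
      - 2 * tri [True, False] [True, False] w u v)"
proof -
  have int: "integrable (lebesgue_on \<Omega>) (\<lambda>z. w z * wd \<Omega> u ds z * wd \<Omega> v es z)" if "length ds = 2" "length es = 2" for ds es
    using that assms by (intro L2_mult_integrable L2_tri L2_wd H20_H2) auto
  have "L2inner \<Omega> (vkb \<Omega> u v) w = (\<integral>z. w z * wd \<Omega> u [True, True] z * wd \<Omega> v [False, False] z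
      + w z * wd \<Omega> u [False, False] z * wd \<Omega> v [True, True] z
      - 2 * (w z * wd \<Omega> u [True, False] z * wd \<Omega> v [True, False] z) \<partial>lebesgue_on \<Omega>)"
    unfolding L2inner_def vkb_def by (intro Bochner_Integration.integral_cong refl) (simp add: algebra_simps)
  also have "\<dots> = tri [True, True] [False, False] w u v + tri [False, False] [True, True] w u v
      - 2 * tri [True, False] [True, False] w u v"
    using int by (simp add: tri_def L2inner_def)
  finally show ?thesis by (simp add: b_form_def)
qed

text \<open>The constant 2 is one half of \<open>1 + 1 + 2\<close>, the coefficients of the three
  terms of the bracket.\<close>

lemma b_form_bound:
  assumes "u \<in> H20 \<Omega>" "v \<in> H20 \<Omega>" "w \<in> H20 \<Omega>"
  shows "\<bar>b_form \<Omega> u v w\<bar> \<le> 2 * sqrt vol * E.nrm u * E.nrm v * E.nrm w"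
proof -
  have "\<bar>tri ds es w u v\<bar> \<le> sqrt vol * E.nrm u * E.nrm v * E.nrm w" if "length ds = 2" "length es = 2" for ds es
    using tri_bound[OF assms(3,1,2) that] by (simp add: ac_simps)
  from this[of "[True, True]" "[False, False]"] this[of "[False, False]" "[True, True]"] this[of "[True, False]" "[True, False]"]
  show ?thesis unfolding b_form_tri[OF assms] by simp
qed

lemma b_form_commute: "b_form \<Omega> u v w = b_form \<Omega> v u w"
  by (simp add: b_form_def L2inner_def vkb_def algebra_simps)

lemma b_form_lin2:
  assumes "u \<in> H20 \<Omega>" "v \<in> H20 \<Omega>" "v' \<in> H20 \<Omega>" "w \<in> H20 \<Omega>"
  shows "b_form \<Omega> u (\<lambda>z. c * v z + d * v' z) w = c * b_form \<Omega> u v w + d * b_form \<Omega> u v' w"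
  using assms by (simp add: b_form_tri H20_lincomb tri_lin_v algebra_simps)

lemma b_form_lin1:
  assumes "u \<in> H20 \<Omega>" "u' \<in> H20 \<Omega>" "v \<in> H20 \<Omega>" "w \<in> H20 \<Omega>"
  shows "b_form \<Omega> (\<lambda>z. c * u z + d * u' z) v w = c * b_form \<Omega> u v w + d * b_form \<Omega> u' v w"
  using b_form_lin2[OF assms(3,1,2,4)] by (simp add: b_form_commute[of _ v])

lemma b_form_lin3:
  assumes "u \<in> H20 \<Omega>" "v \<in> H20 \<Omega>" "w \<in> H20 \<Omega>" "w' \<in> H20 \<Omega>"
  shows "b_form \<Omega> u v (\<lambda>z. c * w z + d * w' z) = c * b_form \<Omega> u v w + d * b_form \<Omega> u v w'"
  using assms by (simp add: b_form_tri H20_lincomb tri_lin_w algebra_simps)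

lemma bdd_lin_b1: "v \<in> H20 \<Omega> \<Longrightarrow> w \<in> H20 \<Omega> \<Longrightarrow> E.bdd_lin (\<lambda>u. b_form \<Omega> u v w) (H20 \<Omega>)"
  unfolding E.bdd_lin_def using b_form_lin1 b_form_bound
  by (auto intro!: exI[of _ "2 * sqrt vol * E.nrm v * E.nrm w"] simp: ac_simps)

lemma bdd_lin_b2: "u \<in> H20 \<Omega> \<Longrightarrow> w \<in> H20 \<Omega> \<Longrightarrow> E.bdd_lin (\<lambda>v. b_form \<Omega> u v w) (H20 \<Omega>)"
  using bdd_lin_b1[of u w] by (simp add: b_form_commute[of u])

lemma bdd_lin_b3: "u \<in> H20 \<Omega> \<Longrightarrow> v \<in> H20 \<Omega> \<Longrightarrow> E.bdd_lin (\<lambda>w. b_form \<Omega> u v w) (H20 \<Omega>)"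
  unfolding E.bdd_lin_def using b_form_lin3 b_form_bound by blast

lemma bdd_lin_minus:
  assumes "E.bdd_lin L (H20 \<Omega>)" "E.bdd_lin M (H20 \<Omega>)"
  shows "E.bdd_lin (\<lambda>u. L u - M u) (H20 \<Omega>)"
proof -
  obtain C D where "\<And>u. u \<in> H20 \<Omega> \<Longrightarrow> \<bar>L u\<bar> \<le> C * E.nrm u" "\<And>u. u \<in> H20 \<Omega> \<Longrightarrow> \<bar>M u\<bar> \<le> D * E.nrm u"
    using assms unfolding E.bdd_lin_def by blast
  then have "\<bar>L u - M u\<bar> \<le> (C + D) * E.nrm u" if "u \<in> H20 \<Omega>" for u
    using that abs_triangle_ineq4[of "L u" "M u"] by (simp add: distrib_right) (smt (verit))
  then show ?thesis
    unfolding E.bdd_lin_def using E.bdd_linD[OF assms(1)] E.bdd_linD[OF assms(2)]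
    by (auto simp: algebra_simps intro!: exI[of _ "C + D"])
qed

text \<open>The integrand on the right is symmetric in \<open>v\<close> and \<open>w\<close> and
  contains only first derivatives of them: the former gives the symmetry of the form, the latter its
  weak continuity.\<close>

lemma b_form_test:
  assumes u: "test_fun \<Omega> u" and v: "test_fun \<Omega> v" and w: "test_fun \<Omega> w"
  shows "b_form \<Omega> u v w = (1/2) * (\<integral>z. ipd [True, True] u z * (ipd [False] v z * ipd [False] w z)
        + ipd [False, False] u z * (ipd [True] v z * ipd [True] w z)
        - ipd [True, False] u z * (ipd [True] v z * ipd [False] w z + ipd [False] v z * ipd [True] w z) \<partial>lborel)"
proof -
  let ?F = "\<lambda>z. (ipd [True, True] u z * ipd [False, False] v z + ipd [False, False] u z * ipd [True, True] v z
        - 2 * ipd [True, False] u z * ipd [True, False] v z)"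
  have [measurable]: "ipd ds u \<in> borel_measurable borel" "ipd ds v \<in> borel_measurable borel" for ds
    using test_borel u v by blast+
  have [measurable]: "wd \<Omega> u ds \<in> borel_measurable (lebesgue_on \<Omega>)" "wd \<Omega> v ds \<in> borel_measurable (lebesgue_on \<Omega>)"
    if "length ds \<le> 2" for ds
    using L2_wd[OF test_H2[OF u] that] L2_wd[OF test_H2[OF v] that] by (auto simp: L2_def)
  have [measurable]: "w \<in> borel_measurable (lebesgue_on \<Omega>)" by (rule H20_measurable[OF test_H20[OF w]])
  have "L2inner \<Omega> (vkb \<Omega> u v) w = L2inner \<Omega> ?F w"
    unfolding L2inner_def
  proof (rule integral_cong_AE)
    show "AE z in lebesgue_on \<Omega>. vkb \<Omega> u v z * w z = ?F z * w z"
      using wd_test[OF u, of "[True, True]"] wd_test[OF u, of "[True, False]"] wd_test[OF u, of "[False, False]"]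
        wd_test[OF v, of "[True, True]"] wd_test[OF v, of "[True, False]"] wd_test[OF v, of "[False, False]"]
      by eventually_elim (simp only: vkb_def)
    show "(\<lambda>z. vkb \<Omega> u v z * w z) \<in> borel_measurable (lebesgue_on \<Omega>)" unfolding vkb_def by measurable
    have "?F \<in> borel_measurable (lebesgue_on \<Omega>)" by (intro borel_imp_measurable) measurable
    then show "(\<lambda>z. ?F z * w z) \<in> borel_measurable (lebesgue_on \<Omega>)" by measurable
  qed
  also have "\<dots> = L2inner \<Omega> ?F (ipd [] w)" by simp
  also have "\<dots> = (\<integral>z. ?F z * ipd [] w z \<partial>lborel)" by (rule L2inner_test[OF w]) measurable
  finally show ?thesis using null_lagrangian_identity[OF u v w] by (simp add: b_form_def)
qed

text \<open>With two arguments fixed, the difference of both sides is a bounded linear functional of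
  the third. Starting from test functions, density therefore frees \<open>w\<close>, then
  \<open>v\<close>, then \<open>u\<close>.\<close>

lemma b_form_commute23:
  assumes u: "u \<in> H20 \<Omega>" and v: "v \<in> H20 \<Omega>" and w: "w \<in> H20 \<Omega>"
  shows "b_form \<Omega> u v w = b_form \<Omega> u w v"
proof -
  have 0: "b_form \<Omega> u v w - b_form \<Omega> u w v = 0" if "test_fun \<Omega> u" "test_fun \<Omega> v" "test_fun \<Omega> w" for u v w
    using b_form_test[OF that] b_form_test[OF that(1,3,2)] by (simp add: ac_simps)
  have 1: "b_form \<Omega> u v w - b_form \<Omega> u w v = 0" if "test_fun \<Omega> u" "test_fun \<Omega> v" "w \<in> H20 \<Omega>" for u v w
    by (rule bdd_lin_zero_on_test[OF bdd_lin_minus[OF bdd_lin_b3 bdd_lin_b2] 0]) (use that test_H20 in auto)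
  have 2: "b_form \<Omega> u v w - b_form \<Omega> u w v = 0" if "test_fun \<Omega> u" "v \<in> H20 \<Omega>" "w \<in> H20 \<Omega>" for u v w
    by (rule bdd_lin_zero_on_test[OF bdd_lin_minus[OF bdd_lin_b2 bdd_lin_b3] 1]) (use that test_H20 in auto)
  have "b_form \<Omega> u v w - b_form \<Omega> u w v = 0"
    by (rule bdd_lin_zero_on_test[OF bdd_lin_minus[OF bdd_lin_b1 bdd_lin_b1] 2]) (use u v w in auto)
  then show ?thesis by simp
qed

text \<open>Interpolation by one integration by parts. The L2 norm is kept as a factor instead of
  being absorbed into the energy, because it is the factor that tends to zero along the differences
  from a weak limit.\<close>

lemma gradient_bound:
  assumes g: "test_fun \<Omega> g"
  shows "(\<integral>z. (ipd [d] g z)\<^sup>2 \<partial>lborel) \<le> L2.nrm \<Omega> g * E.nrm g"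
proof -
  have L: "L2 \<Omega> (ipd ds g)" for ds by (rule L2_test[OF g])
  have "(\<integral>z. (ipd [d] g z)\<^sup>2 \<partial>lborel) = L2inner \<Omega> (ipd [d] g) (ipd [d] g)"
    using L2inner_test[OF g test_borel[OF g, of "[d]"], of "[d]"] by (simp add: power2_eq_square)
  also have "\<dots> = - L2inner \<Omega> g (ipd [d] (ipd [d] g))"
    using is_weak_deriv_test[OF g, of "[d]"] test_fun_ipd[OF g, of "[d]"] unfolding is_weak_deriv_def by auto
  also have "\<dots> \<le> \<bar>L2inner \<Omega> g (ipd [d, d] g)\<bar>" using ipd_append[of "[d]" "[d]" g] by simp
  also have "\<dots> \<le> L2.nrm \<Omega> g * L2.nrm \<Omega> (ipd [d, d] g)"
    using L[of "[]"] L[of "[d, d]"] by (intro L2.Cauchy_Schwarz) auto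
  also have "\<dots> \<le> L2.nrm \<Omega> g * E.nrm g"
  proof (rule mult_left_mono)
    show "L2.nrm \<Omega> (ipd [d, d] g) \<le> E.nrm g"
      using nrm_wd_le_E[OF test_H20[OF g], of "[d, d]"] L2inner_wd_test[OF g g, of "[d, d]" "[d, d]"]
      by (simp add: L2.nrm_def)
  qed (use L[of "[]"] in simp)
  finally show ?thesis .
qed

lemma L2_nrm_tendsto_of_E:
  assumes "\<And>n. s n \<in> H20 \<Omega>" "u \<in> H20 \<Omega>" "(\<lambda>n. E.nrm (\<lambda>z. s n z - u z)) \<longlonglongrightarrow> 0"
  shows "(\<lambda>n. L2.nrm \<Omega> (s n)) \<longlonglongrightarrow> L2.nrm \<Omega> u"
proof (rule L2.nrm_tendsto)
  have d: "(\<lambda>z. s n z - u z) \<in> H20 \<Omega>" for n using E.diff_mem assms by blast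
  show "(\<lambda>n. L2.nrm \<Omega> (\<lambda>z. s n z - u z)) \<longlonglongrightarrow> 0"
    by (rule Lim_null_comparison[OF _ tendsto_mult_right_zero[OF assms(3), of vol]])
      (use L2_nrm_le_E[OF d] H2_L2[OF H20_H2[OF d]] in auto)
qed (use assms H2_L2 H20_H2 in auto)

text \<open>Strong continuity, which carries a bound from test functions over to
  \<open>H20 \<Omega>\<close>; the change of the value splits into one increment per
  argument.\<close>

lemma b_form_tendsto12:
  assumes s: "\<And>n. s n \<in> H20 \<Omega>" and u: "u \<in> H20 \<Omega>" and w: "w \<in> H20 \<Omega>"
    and lim: "(\<lambda>n. E.nrm (\<lambda>z. s n z - u z)) \<longlonglongrightarrow> 0"
  shows "(\<lambda>n. b_form \<Omega> (s n) (s n) w) \<longlonglongrightarrow> b_form \<Omega> u u w"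
proof -
  have d: "(\<lambda>z. s n z - u z) \<in> H20 \<Omega>" for n using E.diff_mem s u by blast
  have eq: "b_form \<Omega> (s n) (s n) w - b_form \<Omega> u u w = b_form \<Omega> (\<lambda>z. s n z - u z) (s n) w + b_form \<Omega> u (\<lambda>z. s n z - u z) w" for n
    using b_form_lin1[OF s u s w, of 1 n "-1" n] b_form_lin2[OF u s u w, of 1 n "-1"] by simp
  have "(\<lambda>n. 2 * sqrt vol * E.nrm (\<lambda>z. s n z - u z) * (E.nrm (s n) + E.nrm u) * E.nrm w)
      \<longlonglongrightarrow> 2 * sqrt vol * 0 * (E.nrm u + E.nrm u) * E.nrm w"
    by (intro tendsto_intros lim E.nrm_tendsto s u)
  then have z: "(\<lambda>n. 2 * sqrt vol * E.nrm (\<lambda>z. s n z - u z) * (E.nrm (s n) + E.nrm u) * E.nrm w) \<longlonglongrightarrow> 0"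
    by simp
  have "(\<lambda>n. b_form \<Omega> (s n) (s n) w - b_form \<Omega> u u w) \<longlonglongrightarrow> 0"
  proof (rule Lim_null_comparison[OF always_eventually z], rule allI)
    fix n
    show "norm (b_form \<Omega> (s n) (s n) w - b_form \<Omega> u u w)
        \<le> 2 * sqrt vol * E.nrm (\<lambda>z. s n z - u z) * (E.nrm (s n) + E.nrm u) * E.nrm w"
      using b_form_bound[OF d s w, of n n] b_form_bound[OF u d w, of n]
      unfolding eq real_norm_def by (simp add: algebra_simps)
  qed
  then show ?thesis by (simp add: LIM_zero_iff)
qed

text \<open>\<open>C\<close> depends on sup bounds for the second derivatives of
  \<open>\<psi>\<close>, so this estimate is tied to a smooth third argument. It is shown for test
  functions \<open>w\<close>, where \<open>b_form_test\<close> applies, and both sides are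
  continuous in the energy norm.\<close>

lemma b_form_weak_bound:
  assumes p: "test_fun \<Omega> \<psi>"
  shows "\<exists>C. \<forall>w\<in>H20 \<Omega>. \<bar>b_form \<Omega> w w \<psi>\<bar> \<le> C * (L2.nrm \<Omega> w * E.nrm w)"
proof -
  have "\<exists>C>0. \<forall>z. \<bar>ipd ds \<psi> z\<bar> \<le> C" for ds
    using ccs_bounded[OF ccs_test_fun[OF p, of ds]] by metis
  then obtain Cf where Cf: "\<And>ds. Cf ds > 0" "\<And>ds z. \<bar>ipd ds \<psi> z\<bar> \<le> Cf ds" by metis
  define C where "C = Cf [True, True] + Cf [False, False] + Cf [True, False]"
  have C: "\<bar>ipd [True, True] \<psi> z\<bar> \<le> C" "\<bar>ipd [False, False] \<psi> z\<bar> \<le> C" "\<bar>ipd [True, False] \<psi> z\<bar> \<le> C" "C \<ge> 0" for z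
    using Cf(1)[of "[True, True]"] Cf(1)[of "[False, False]"] Cf(1)[of "[True, False]"]
      Cf(2)[of "[True, True]" z] Cf(2)[of "[False, False]" z] Cf(2)[of "[True, False]" z]
    by (auto simp: C_def)
  have test: "\<bar>b_form \<Omega> w w \<psi>\<bar> \<le> 2 * C * (L2.nrm \<Omega> w * E.nrm w)" if w: "test_fun \<Omega> w" for w
  proof -
    note cw = ccs_test_fun[OF w] and cp = ccs_test_fun[OF p]
    let ?F = "\<lambda>z. ipd [True, True] \<psi> z * (ipd [False] w z * ipd [False] w z)
        + ipd [False, False] \<psi> z * (ipd [True] w z * ipd [True] w z)
        - ipd [True, False] \<psi> z * (ipd [True] w z * ipd [False] w z + ipd [False] w z * ipd [True] w z)"
    have cF: "ccs ?F" by (intro ccs_mult ccs_add ccs_diff cw cp)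
    have ci: "integrable lborel (\<lambda>z. (ipd [d] w z)\<^sup>2)" for d
      using integrable_ccs[OF ccs_mult[OF cw[of "[d]"] cw[of "[d]"]]] by (simp add: power2_eq_square)
    \<comment> \<open>The two pure terms give \<open>C * (a\<^sup>2 + b\<^sup>2)\<close> together,
      and the mixed term gives as much again by
      \<open>2 * \<bar>a * b\<bar> \<le> a\<^sup>2 + b\<^sup>2\<close>.\<close>
    have pw: "\<bar>?F z\<bar> \<le> 2 * C * ((ipd [True] w z)\<^sup>2 + (ipd [False] w z)\<^sup>2)" for z
    proof -
      define a b where "a = ipd [True] w z" and "b = ipd [False] w z"
      have ab: "2 * \<bar>a * b\<bar> \<le> a\<^sup>2 + b\<^sup>2"
        using sum_squares_bound[of "\<bar>a\<bar>" "\<bar>b\<bar>"] by (simp add: abs_mult)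
      have "\<bar>ipd [True, True] \<psi> z * (b * b)\<bar> \<le> C * b\<^sup>2"
        using C(1)[of z] by (simp add: abs_mult power2_eq_square mult_right_mono)
      moreover have "\<bar>ipd [False, False] \<psi> z * (a * a)\<bar> \<le> C * a\<^sup>2"
        using C(2)[of z] by (simp add: abs_mult power2_eq_square mult_right_mono)
      moreover have "\<bar>ipd [True, False] \<psi> z * (a * b + b * a)\<bar> \<le> C * (a\<^sup>2 + b\<^sup>2)"
      proof -
        have "\<bar>ipd [True, False] \<psi> z * (a * b + b * a)\<bar> = \<bar>ipd [True, False] \<psi> z\<bar> * (2 * \<bar>a * b\<bar>)"
          by (simp add: abs_mult)
        also have "\<dots> \<le> C * (a\<^sup>2 + b\<^sup>2)" using C(3)[of z] C(4) ab by (intro mult_mono) auto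
        finally show ?thesis .
      qed
      ultimately show ?thesis unfolding a_def[symmetric] b_def[symmetric] by (simp add: algebra_simps abs_if split: if_splits)
    qed
    have "b_form \<Omega> w w \<psi> = b_form \<Omega> \<psi> w w"
      using b_form_commute[of w \<psi> w] b_form_commute23[OF test_H20[OF w] test_H20[OF w] test_H20[OF p]] by simp
    then have half: "\<bar>b_form \<Omega> w w \<psi>\<bar> = (1/2) * \<bar>\<integral>z. ?F z \<partial>lborel\<bar>"
      using b_form_test[OF p w w] by (simp add: abs_mult)
    have "\<bar>\<integral>z. ?F z \<partial>lborel\<bar> \<le> (\<integral>z. \<bar>?F z\<bar> \<partial>lborel)" by (rule integral_abs_bound)
    also have "\<dots> \<le> (\<integral>z. 2 * C * ((ipd [True] w z)\<^sup>2 + (ipd [False] w z)\<^sup>2) \<partial>lborel)"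
      using ci[of True] ci[of False] integrable_ccs[OF cF] pw by (intro integral_mono) auto
    also have "\<dots> = 2 * C * ((\<integral>z. (ipd [True] w z)\<^sup>2 \<partial>lborel) + (\<integral>z. (ipd [False] w z)\<^sup>2 \<partial>lborel))"
      using ci[of True] ci[of False] by simp
    also have "\<dots> \<le> 2 * C * (L2.nrm \<Omega> w * E.nrm w + L2.nrm \<Omega> w * E.nrm w)"
      by (intro mult_left_mono add_mono gradient_bound w) (use C(4) in auto)
    finally show ?thesis unfolding half by simp
  qed
  have "\<bar>b_form \<Omega> w w \<psi>\<bar> \<le> 2 * C * (L2.nrm \<Omega> w * E.nrm w)" if w: "w \<in> H20 \<Omega>" for w
  proof -
    obtain s where s_test: "\<forall>n. test_fun \<Omega> (s n)" and s_lim: "(\<lambda>n. E.nrm (\<lambda>z. s n z - w z)) \<longlonglongrightarrow> 0"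
      using E_dense[OF w] by blast
    have sH: "s n \<in> H20 \<Omega>" for n using s_test test_H20 by blast
    have 1: "(\<lambda>n. \<bar>b_form \<Omega> (s n) (s n) \<psi>\<bar>) \<longlonglongrightarrow> \<bar>b_form \<Omega> w w \<psi>\<bar>"
      by (intro tendsto_rabs b_form_tendsto12 sH w s_lim test_H20 p)
    have 2: "(\<lambda>n. 2 * C * (L2.nrm \<Omega> (s n) * E.nrm (s n))) \<longlonglongrightarrow> 2 * C * (L2.nrm \<Omega> w * E.nrm w)"
      by (intro tendsto_mult tendsto_const L2_nrm_tendsto_of_E E.nrm_tendsto sH w s_lim)
    show ?thesis by (rule LIMSEQ_le[OF 1 2]) (use test s_test in blast)
  qed
  then show ?thesis by blast
qed

section \<open>The operator G and weak convergence\<close>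

lemma b_representation:
  assumes "u \<in> H20 \<Omega>" "v \<in> H20 \<Omega>"
  shows "\<exists>g\<in>H20 \<Omega>. \<forall>\<psi>\<in>H20 \<Omega>. a_form \<Omega> g \<psi> = b_form \<Omega> u v \<psi>"
  by (rule E.Riesz[OF E.csub_whole bdd_lin_b3[OF assms]])

text \<open>The choice in \<open>G_op\<close> is pinned down only through the form; these two
  properties are the interface to it from here on.\<close>

lemma G_op_props:
  assumes "u \<in> H20 \<Omega>"
  shows "G_op \<Omega> u \<in> H20 \<Omega>" "\<psi> \<in> H20 \<Omega> \<Longrightarrow> a_form \<Omega> (G_op \<Omega> u) \<psi> = b_form \<Omega> u u \<psi>"
proof -
  have "\<exists>g. g \<in> H20 \<Omega> \<and> (\<forall>\<psi>\<in>H20 \<Omega>. a_form \<Omega> g \<psi> = b_form \<Omega> u u \<psi>)"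
    using b_representation[OF assms assms] by blast
  from someI_ex[OF this] show "G_op \<Omega> u \<in> H20 \<Omega>" "\<psi> \<in> H20 \<Omega> \<Longrightarrow> a_form \<Omega> (G_op \<Omega> u) \<psi> = b_form \<Omega> u u \<psi>"
    unfolding G_op_def by blast+
qed

lemma weak_imp_L2_tendsto:
  assumes s: "\<And>n. s n \<in> H20 \<Omega>" and u: "u \<in> H20 \<Omega>" and bnd: "\<And>n. E.nrm (s n) \<le> R"
    and weak: "\<And>\<psi>. \<psi> \<in> H20 \<Omega> \<Longrightarrow> (\<lambda>n. a_form \<Omega> (s n) \<psi>) \<longlonglongrightarrow> a_form \<Omega> u \<psi>"
  shows "(\<lambda>n. L2.nrm \<Omega> (\<lambda>z. s n z - u z)) \<longlonglongrightarrow> 0"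
proof -
  have pv: "(\<lambda>n. pval (s n) z) \<longlonglongrightarrow> pval u z" for z
    by (rule E.bdd_lin_weak_tendsto[OF bdd_lin_pval weak s u])
  have ae: "AE z in lebesgue_on \<Omega>. \<forall>n\<in>UNIV. s n z = pval (s n) z"
    by (rule AE_ball_countable'[OF pval_AE[OF s]]) auto
  \<comment> \<open>The sup bound dominates all squared differences by one constant, which is
    integrable as \<open>\<Omega>\<close> has finite measure.\<close>
  define W where "W = (sqrt vol * R + sqrt vol * E.nrm u)\<^sup>2"
  have d: "L2 \<Omega> (\<lambda>z. s n z - u z)" for n using H2_L2[OF H20_H2[OF E.diff_mem[OF s u]]] .
  have "(\<lambda>n. \<integral>z. (s n z - u z) * (s n z - u z) \<partial>lebesgue_on \<Omega>) \<longlonglongrightarrow> (\<integral>z. 0 \<partial>lebesgue_on \<Omega>)"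
  proof (rule integral_dominated_convergence[where w = "\<lambda>_. W"])
    show "AE z in lebesgue_on \<Omega>. (\<lambda>n. (s n z - u z) * (s n z - u z)) \<longlonglongrightarrow> 0"
      using ae pval_AE[OF u]
    proof eventually_elim
      case (elim z)
      have "(\<lambda>n. (pval (s n) z - pval u z) * (pval (s n) z - pval u z)) \<longlonglongrightarrow> (pval u z - pval u z) * (pval u z - pval u z)"
        by (intro tendsto_intros pv)
      then show ?case using elim by simp
    qed
    show "AE z in lebesgue_on \<Omega>. norm ((s n z - u z) * (s n z - u z)) \<le> W" for n
      using sup_bound[OF s[of n]] sup_bound[OF u]
    proof eventually_elim
      case (elim z)
      have "sqrt vol * E.nrm (s n) \<le> sqrt vol * R" using bnd[of n] vol_nonneg by (simp add: mult_left_mono)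
      then have "\<bar>s n z - u z\<bar> \<le> sqrt vol * R + sqrt vol * E.nrm u" using elim by linarith
      then show ?case using power_mono[of "\<bar>s n z - u z\<bar>" _ 2] by (simp add: W_def power2_eq_square abs_mult)
    qed
    show "(\<lambda>z. (s n z - u z) * (s n z - u z)) \<in> borel_measurable (lebesgue_on \<Omega>)" for n
      using L2_mult_integrable[OF d d] by (rule borel_measurable_integrable)
  qed auto
  then have "(\<lambda>n. L2inner \<Omega> (\<lambda>z. s n z - u z) (\<lambda>z. s n z - u z)) \<longlonglongrightarrow> 0" by (simp add: L2inner_def)
  from tendsto_real_sqrt[OF this] show ?thesis by (simp add: L2.nrm_def)
qed

text \<open>Completing the square around \<open>u\<close>: the value is
  \<open>b(s - u, s - u) + 2 b(u, s) - b(u, u)\<close> against \<open>\<psi>\<close>. The first term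
  tends to zero with the L2 norm of \<open>s - u\<close>, and the second is a bounded functional of
  \<open>s\<close>.\<close>

lemma b_form_weak_tendsto:
  assumes s: "\<And>n. s n \<in> H20 \<Omega>" and u: "u \<in> H20 \<Omega>" and bnd: "\<And>n. E.nrm (s n) \<le> R"
    and weak: "\<And>\<psi>. \<psi> \<in> H20 \<Omega> \<Longrightarrow> (\<lambda>n. a_form \<Omega> (s n) \<psi>) \<longlonglongrightarrow> a_form \<Omega> u \<psi>"
    and p: "test_fun \<Omega> \<psi>"
  shows "(\<lambda>n. b_form \<Omega> (s n) (s n) \<psi>) \<longlonglongrightarrow> b_form \<Omega> u u \<psi>"
proof -
  note pH = test_H20[OF p]
  have d: "(\<lambda>z. s n z - u z) \<in> H20 \<Omega>" for n using E.diff_mem s u by blast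
  obtain C where C: "\<And>w. w \<in> H20 \<Omega> \<Longrightarrow> \<bar>b_form \<Omega> w w \<psi>\<bar> \<le> C * (L2.nrm \<Omega> w * E.nrm w)"
    using b_form_weak_bound[OF p] by blast
  have "(\<lambda>n. b_form \<Omega> (\<lambda>z. s n z - u z) (\<lambda>z. s n z - u z) \<psi>) \<longlonglongrightarrow> 0"
  proof (rule Lim_null_comparison)
    show "(\<lambda>n. \<bar>C\<bar> * (R + E.nrm u) * L2.nrm \<Omega> (\<lambda>z. s n z - u z)) \<longlonglongrightarrow> 0"
      by (rule tendsto_mult_right_zero[OF weak_imp_L2_tendsto[OF s u bnd weak]])
    show "\<forall>\<^sub>F n in sequentially. norm (b_form \<Omega> (\<lambda>z. s n z - u z) (\<lambda>z. s n z - u z) \<psi>)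
        \<le> \<bar>C\<bar> * (R + E.nrm u) * L2.nrm \<Omega> (\<lambda>z. s n z - u z)"
    proof (intro always_eventually allI)
      fix n
      have L: "0 \<le> L2.nrm \<Omega> (\<lambda>z. s n z - u z)" using H2_L2[OF H20_H2[OF d]] by simp
      have "nd \<le> R + E.nrm u" if "nd = E.nrm (\<lambda>z. s n z - u z)" for nd
        using E.nrm_add[OF s E.scale_mem[OF u, of "-1"], of n] E.nrm_scale[OF u, of "-1"] bnd[of n] that by simp
      then have nd: "E.nrm (\<lambda>z. s n z - u z) \<le> R + E.nrm u" by simp
      have "\<bar>b_form \<Omega> (\<lambda>z. s n z - u z) (\<lambda>z. s n z - u z) \<psi>\<bar>
          \<le> C * (L2.nrm \<Omega> (\<lambda>z. s n z - u z) * E.nrm (\<lambda>z. s n z - u z))" by (rule C[OF d])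
      also have "\<dots> \<le> \<bar>C\<bar> * (L2.nrm \<Omega> (\<lambda>z. s n z - u z) * (R + E.nrm u))"
        using L nd d by (intro mult_mono mult_left_mono) auto
      finally show "norm (b_form \<Omega> (\<lambda>z. s n z - u z) (\<lambda>z. s n z - u z) \<psi>)
          \<le> \<bar>C\<bar> * (R + E.nrm u) * L2.nrm \<Omega> (\<lambda>z. s n z - u z)" by (simp add: ac_simps)
    qed
  qed
  moreover have "(\<lambda>n. b_form \<Omega> u (s n) \<psi>) \<longlonglongrightarrow> b_form \<Omega> u u \<psi>"
    by (rule E.bdd_lin_weak_tendsto[OF bdd_lin_b2[OF u pH] weak s u])
  ultimately have "(\<lambda>n. b_form \<Omega> (\<lambda>z. s n z - u z) (\<lambda>z. s n z - u z) \<psi> + 2 * b_form \<Omega> u (s n) \<psi> - b_form \<Omega> u u \<psi>)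
      \<longlonglongrightarrow> 0 + 2 * b_form \<Omega> u u \<psi> - b_form \<Omega> u u \<psi>"
    by (intro tendsto_intros)
  moreover have "b_form \<Omega> (\<lambda>z. s n z - u z) (\<lambda>z. s n z - u z) \<psi> + 2 * b_form \<Omega> u (s n) \<psi> - b_form \<Omega> u u \<psi>
      = b_form \<Omega> (s n) (s n) \<psi>" for n
    using b_form_lin1[OF s u d pH, of 1 n "-1" n] b_form_lin2[OF s s u pH, of n 1 n "-1"] b_form_lin2[OF u s u pH, of 1 n "-1"]
      b_form_commute[of "s n" u \<psi>] by simp
  ultimately show ?thesis by simp
qed

end

section \<open>Minimisers\<close>

context bounded_open
begin

section \<open>The energy functional and the admissible set\<close>

lemma enorm_sq: "u \<in> H20 \<Omega> \<Longrightarrow> (enorm \<Omega> u)\<^sup>2 = a_form \<Omega> u u"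
  by (simp add: enorm_def E.form_nonneg)

lemma j_fun_eq:
  "\<xi> \<in> H20 \<Omega> \<Longrightarrow> j_fun \<Omega> f \<xi> = 1/2 * a_form \<Omega> \<xi> \<xi> + 1/2 * a_form \<Omega> (G_op \<Omega> \<xi>) (G_op \<Omega> \<xi>) - L2inner \<Omega> f \<xi>"
  by (simp add: j_fun_def enorm_sq G_op_props)

lemma bdd_lin_load:
  assumes f: "L2 \<Omega> f"
  shows "E.bdd_lin (L2inner \<Omega> f) (H20 \<Omega>)"
  unfolding E.bdd_lin_def
proof (intro conjI ballI allI exI)
  fix u v c d assume "u \<in> H20 \<Omega>" "v \<in> H20 \<Omega>"
  then show "L2inner \<Omega> f (\<lambda>z. c * u z + d * v z) = c * L2inner \<Omega> f u + d * L2inner \<Omega> f v"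
    using L2.form_lin_right[of u \<Omega> v f c d] f H2_L2 H20_H2 by simp
next
  fix u assume u: "u \<in> H20 \<Omega>"
  have "\<bar>L2inner \<Omega> f u\<bar> \<le> L2.nrm \<Omega> f * L2.nrm \<Omega> u"
    using f H2_L2[OF H20_H2[OF u]] by (intro L2.Cauchy_Schwarz) auto
  also have "\<dots> \<le> L2.nrm \<Omega> f * (vol * E.nrm u)"
    using f by (intro mult_left_mono L2_nrm_le_E u) auto
  finally show "\<bar>L2inner \<Omega> f u\<bar> \<le> L2.nrm \<Omega> f * vol * E.nrm u" by simp
qed

text \<open>The obstacle is nonnegative only on a compact subset of \<open>\<Omega>\<close>. A test
  function that is nonnegative everywhere and positive on that subset dominates the obstacle after
  scaling.\<close>

lemma obstacle_set_nonempty: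
  assumes cont: "continuous_on (closure \<Omega>) obs" and neg: "\<forall>x\<in>frontier \<Omega>. obs x < 0"
  shows "obstacle_set \<Omega> obs \<noteq> {}"
proof -
  have cc: "compact (closure \<Omega>)" using bounded_dom by (simp add: compact_closure)
  define Kc where "Kc = {z \<in> closure \<Omega>. 0 \<le> obs z}"
  have "closed Kc" unfolding Kc_def
    using continuous_on_closed_Collect_le[OF continuous_on_const cont] by simp
  moreover have "closure \<Omega> \<inter> Kc = Kc" by (auto simp: Kc_def)
  ultimately have K: "compact Kc" using compact_Int_closed[OF cc, of Kc] by simp
  \<comment> \<open>A point of the closure where the obstacle is nonnegative cannot lie on the
    frontier, so it lies in the interior.\<close>
  have Ksub: "Kc \<subseteq> \<Omega>"
    using neg open_dom unfolding Kc_def frontier_def by (force simp: interior_open not_le[symmetric])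
  have "\<exists>g. test_fun \<Omega> g \<and> (\<forall>x. 0 \<le> g x) \<and> 0 < g z" if "z \<in> Kc" for z
  proof -
    have "z \<in> \<Omega>" using that Ksub by blast
    then obtain a b where ab: "cbox a b \<subseteq> \<Omega>" "z \<in> box a b" and "\<forall>i\<in>Basis. a \<bullet> i < b \<bullet> i"
      by (rule open_contains_cbox[OF open_dom])
    show ?thesis
      using test_fun_bump[OF zero_less_one ab(1)] bump_bounds(1)[of 1 a b] bump_pos[of 1 a b z] ab(2)
      by (intro exI[of _ "bump 1 a b"]) auto
  qed
  then obtain g where g: "\<And>z. z \<in> Kc \<Longrightarrow> test_fun \<Omega> (g z)" "\<And>z x. z \<in> Kc \<Longrightarrow> 0 \<le> g z x" "\<And>z. z \<in> Kc \<Longrightarrow> 0 < g z z"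
    by metis
  have op: "open {x. 0 < g z x}" if "z \<in> Kc" for z
    using test_fun_continuous[OF g(1)[OF that], of "[]"] by (intro open_Collect_less continuous_on_const) simp
  obtain F where F: "F \<subseteq> Kc" "finite F" "Kc \<subseteq> (\<Union>z\<in>F. {x. 0 < g z x})"
    by (rule compactE_image[OF K, of Kc "\<lambda>z. {x. 0 < g z x}"]) (use op g(3) in auto)
  define \<sigma> where "\<sigma> x = (\<Sum>z\<in>F. g z x)" for x
  have "test_fun \<Omega> (\<lambda>x. \<Sum>z\<in>F'. g z x)" if "finite F'" "F' \<subseteq> Kc" for F'
    using that
  proof (induction F')
    case empty
    then show ?case using test_fun_zero by simp
  next
    case (insert z F')
    then show ?case using test_fun_lincomb[OF g(1)[of z], of "\<lambda>x. \<Sum>z\<in>F'. g z x" 1 1] by simp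
  qed
  then have ts: "test_fun \<Omega> \<sigma>" unfolding \<sigma>_def using F by blast
  have s0: "0 \<le> \<sigma> x" for x unfolding \<sigma>_def using F(1) g(2) by (intro sum_nonneg) blast
  have spos: "0 < \<sigma> x" if "x \<in> Kc" for x
  proof -
    obtain z where "z \<in> F" "0 < g z x" using F(3) \<open>x \<in> Kc\<close> by blast
    moreover have "0 \<le> g i x" if "i \<in> F" for i using that F(1) g(2) by blast
    ultimately show ?thesis unfolding \<sigma>_def using F(2) by (intro sum_pos2[of F z])
  qed
  \<comment> \<open>The bound of this quotient on the compact set is the scaling factor. Its
    absolute value is taken so that the multiple of \<open>\<sigma>\<close> stays nonnegative where
    the obstacle is negative.\<close>
  have "continuous_on Kc (\<lambda>x. obs x / \<sigma> x)"
  proof (rule continuous_on_divide)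
    show "continuous_on Kc obs" by (rule continuous_on_subset[OF cont]) (auto simp: Kc_def)
    show "continuous_on Kc \<sigma>" by (rule continuous_on_subset[OF test_fun_continuous[OF ts, of "[]", simplified]]) simp
    show "\<forall>x\<in>Kc. \<sigma> x \<noteq> 0" using spos by (metis less_irrefl)
  qed
  then have "compact ((\<lambda>x. obs x / \<sigma> x) ` Kc)" using K by (rule compact_continuous_image)
  from compact_imp_bounded[OF this] obtain C where "\<forall>y\<in>(\<lambda>x. obs x / \<sigma> x) ` Kc. norm y \<le> C"
    unfolding bounded_iff by blast
  then have C: "\<bar>obs x / \<sigma> x\<bar> \<le> C" if "x \<in> Kc" for x using that by simp
  have le: "obs x \<le> \<bar>C\<bar> * \<sigma> x" if "x \<in> \<Omega>" for x
  proof (cases "x \<in> Kc")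
    case True
    then have "obs x / \<sigma> x \<le> \<bar>C\<bar>" using C[OF True] by linarith
    then show ?thesis using spos[OF True] by (simp add: pos_divide_le_eq)
  next
    case False
    then have "obs x < 0" using that closure_subset[of \<Omega>] by (auto simp: Kc_def)
    then show ?thesis using s0[of x] by (meson abs_ge_zero less_imp_le mult_nonneg_nonneg order_trans)
  qed
  have "test_fun \<Omega> (\<lambda>x. \<bar>C\<bar> * \<sigma> x)" using test_fun_lincomb[OF ts ts, of "\<bar>C\<bar>" 0] by simp
  then have "(\<lambda>x. \<bar>C\<bar> * \<sigma> x) \<in> obstacle_set \<Omega> obs"
    using le by (auto simp: obstacle_set_def test_H20 intro!: AE_I2)
  then show ?thesis by blast
qed

lemma obstacle_set_convex:
  assumes "u \<in> obstacle_set \<Omega> obs" "v \<in> obstacle_set \<Omega> obs" "0 \<le> t" "t \<le> 1"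
  shows "(\<lambda>z. u z + t * (v z - u z)) \<in> obstacle_set \<Omega> obs"
proof -
  have H: "u \<in> H20 \<Omega>" "v \<in> H20 \<Omega>" and ae: "AE z in lebesgue_on \<Omega>. obs z \<le> u z" "AE z in lebesgue_on \<Omega>. obs z \<le> v z"
    using assms by (auto simp: obstacle_set_def)
  have eq: "(\<lambda>z. u z + t * (v z - u z)) = (\<lambda>z. (1 - t) * u z + t * v z)" by (simp add: fun_eq_iff algebra_simps)
  have "AE z in lebesgue_on \<Omega>. obs z \<le> (1 - t) * u z + t * v z"
    using ae
  proof eventually_elim
    case (elim z)
    have "(1 - t) * obs z + t * obs z \<le> (1 - t) * u z + t * v z"
      using assms(3,4) elim by (intro add_mono mult_left_mono) auto
    then show ?case by (simp add: algebra_simps)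
  qed
  then show ?thesis unfolding eq using H20_lincomb[OF H] by (simp add: obstacle_set_def)
qed

text \<open>Dropping the \<open>G_op\<close> term leaves a quadratic lower bound in the energy norm,
  so the infimum is finite and minimising sequences are bounded; a weak limit point is then shown to
  be admissible and optimal.\<close>

lemma exists_minimizer:
  assumes f: "L2 \<Omega> f" and ne: "obstacle_set \<Omega> obs \<noteq> {}"
  shows "\<exists>u\<in>obstacle_set \<Omega> obs. \<forall>\<xi>\<in>obstacle_set \<Omega> obs. j_fun \<Omega> f u \<le> j_fun \<Omega> f \<xi>"
proof -
  define J where "J = j_fun \<Omega> f"
  define K where "K = obstacle_set \<Omega> obs"
  have KH: "\<xi> \<in> H20 \<Omega>" if "\<xi> \<in> K" for \<xi> using that by (simp add: K_def obstacle_set_def)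
  note load = bdd_lin_load[OF f]
  obtain C where C: "C > 0" "\<And>u. u \<in> H20 \<Omega> \<Longrightarrow> \<bar>L2inner \<Omega> f u\<bar> \<le> C * E.nrm u"
    using E.bdd_linE[OF load] by blast
  have low: "(1/2) * (E.nrm \<xi>)\<^sup>2 - C * E.nrm \<xi> \<le> J \<xi>" if "\<xi> \<in> K" for \<xi>
    using C(2)[OF KH[OF that]] E.form_nonneg[OF G_op_props(1)[OF KH[OF that]]] E.nrm_sq[OF KH[OF that]]
    unfolding J_def j_fun_eq[OF KH[OF that]] by linarith
  have low': "- C\<^sup>2 / 2 \<le> J \<xi>" if "\<xi> \<in> K" for \<xi>
  proof -
    have "0 \<le> (E.nrm \<xi> - C)\<^sup>2" by simp
    then have "- C\<^sup>2 / 2 \<le> (1/2) * (E.nrm \<xi>)\<^sup>2 - C * E.nrm \<xi>" by (simp add: power2_diff mult.commute)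
    with low[OF that] show ?thesis by linarith
  qed
  define m where "m = Inf (J ` K)"
  have bdd: "bdd_below (J ` K)" using low' by (intro bdd_belowI[of _ "- C\<^sup>2 / 2"]) auto
  have mle: "m \<le> J \<xi>" if "\<xi> \<in> K" for \<xi> unfolding m_def using that bdd by (intro cInf_lower) auto
  have "\<exists>\<xi>\<in>K. J \<xi> < m + inverse (real (Suc n))" for n
  proof -
    have "Inf (J ` K) < m + inverse (real (Suc n))" by (simp add: m_def)
    then show ?thesis using cInf_lessD[of "J ` K"] ne unfolding K_def by blast
  qed
  then obtain s where s: "\<And>n. s n \<in> K" "\<And>n. J (s n) < m + inverse (real (Suc n))" by metis
  have sH: "s n \<in> H20 \<Omega>" for n by (rule KH[OF s(1)])
  \<comment> \<open>Beyond \<open>R\<close> the factor \<open>(1/2) * E.nrm (s n) - C\<close>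
    exceeds \<open>\<bar>m\<bar> + 2\<close> and the norm exceeds 1, which would push
    \<open>J (s n)\<close> above \<open>m + 1\<close>.\<close>
  define R where "R = 2 * C + 2 * \<bar>m\<bar> + 4"
  have bnd: "E.nrm (s n) \<le> R" for n
  proof (rule ccontr)
    assume "\<not> E.nrm (s n) \<le> R"
    then have big: "E.nrm (s n) > R" by simp
    have "inverse (real (Suc n)) \<le> 1" by (simp add: inverse_le_1_iff)
    then have up: "(1/2) * (E.nrm (s n))\<^sup>2 - C * E.nrm (s n) < m + 1"
      using low[OF s(1)[of n]] s(2)[of n] by linarith
    have "(\<bar>m\<bar> + 2) * 1 \<le> ((1/2) * E.nrm (s n) - C) * E.nrm (s n)"
      using big C(1) unfolding R_def by (intro mult_mono) auto
    also have "\<dots> = (1/2) * (E.nrm (s n))\<^sup>2 - C * E.nrm (s n)" by (simp add: power2_eq_square algebra_simps)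
    finally have "(\<bar>m\<bar> + 2) * 1 < m + 1" using up by (rule le_less_trans)
    then show False by simp
  qed
  obtain u r where u: "u \<in> H20 \<Omega>" and r: "strict_mono (r :: nat \<Rightarrow> nat)"
    and weak: "\<And>\<psi>. \<psi> \<in> H20 \<Omega> \<Longrightarrow> (\<lambda>n. a_form \<Omega> (s (r n)) \<psi>) \<longlonglongrightarrow> a_form \<Omega> u \<psi>"
    using E.weakly_convergent_subsequence[of s R, OF sH bnd] by blast
  have ae1: "AE z in lebesgue_on \<Omega>. \<forall>n\<in>UNIV. obs z \<le> s (r n) z"
    by (rule AE_ball_countable') (use s(1) in \<open>auto simp: K_def obstacle_set_def\<close>)
  have ae2: "AE z in lebesgue_on \<Omega>. \<forall>n\<in>UNIV. s (r n) z = pval (s (r n)) z"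
    by (rule AE_ball_countable'[OF pval_AE[OF sH]]) auto
  \<comment> \<open>Weak convergence gives convergence of \<open>pval\<close> at every point, so off
    one null set the obstacle condition passes to the limit pointwise.\<close>
  have "AE z in lebesgue_on \<Omega>. obs z \<le> u z"
    using ae1 ae2 pval_AE[OF u]
  proof eventually_elim
    case (elim z)
    have "(\<lambda>n. pval (s (r n)) z) \<longlonglongrightarrow> pval u z"
      by (rule E.bdd_lin_weak_tendsto[OF bdd_lin_pval weak sH u])
    then have "obs z \<le> pval u z"
      by (rule LIMSEQ_le_const) (use elim in \<open>auto intro!: exI[of _ 0]\<close>)
    then show ?case using elim by simp
  qed
  then have uK: "u \<in> K" using u by (simp add: K_def obstacle_set_def)
  define v where "v = G_op \<Omega> u"
  have v: "v \<in> H20 \<Omega>" and vb: "\<And>\<psi>. \<psi> \<in> H20 \<Omega> \<Longrightarrow> a_form \<Omega> v \<psi> = b_form \<Omega> u u \<psi>"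
    using G_op_props[OF u] by (auto simp: v_def)
  \<comment> \<open>Both squares in \<open>J\<close> are replaced by tangents, at \<open>u\<close>
    and at \<open>\<psi>\<close>. The tangents lie below the squares and, unlike them, pass to the
    weak limit.\<close>
  have test: "(1/2) * a_form \<Omega> u u + a_form \<Omega> v \<psi> - (1/2) * a_form \<Omega> \<psi> \<psi> - L2inner \<Omega> f u \<le> m"
    if p: "test_fun \<Omega> \<psi>" for \<psi>
  proof (rule LIMSEQ_le)
    note pH = test_H20[OF p]
    have "(\<lambda>n. a_form \<Omega> (s (r n)) u - (1/2) * a_form \<Omega> u u + b_form \<Omega> (s (r n)) (s (r n)) \<psi>
          - (1/2) * a_form \<Omega> \<psi> \<psi> - L2inner \<Omega> f (s (r n)))
        \<longlonglongrightarrow> a_form \<Omega> u u - (1/2) * a_form \<Omega> u u + b_form \<Omega> u u \<psi> - (1/2) * a_form \<Omega> \<psi> \<psi> - L2inner \<Omega> f u"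
      by (intro tendsto_intros weak u b_form_weak_tendsto[OF sH u bnd weak p] E.bdd_lin_weak_tendsto[OF load weak sH u])
    then show "(\<lambda>n. a_form \<Omega> (s (r n)) u - (1/2) * a_form \<Omega> u u + b_form \<Omega> (s (r n)) (s (r n)) \<psi>
          - (1/2) * a_form \<Omega> \<psi> \<psi> - L2inner \<Omega> f (s (r n)))
        \<longlonglongrightarrow> (1/2) * a_form \<Omega> u u + a_form \<Omega> v \<psi> - (1/2) * a_form \<Omega> \<psi> \<psi> - L2inner \<Omega> f u"
      using vb[OF pH] by simp
    have "(\<lambda>n. m + inverse (real (Suc (r n)))) \<longlonglongrightarrow> m + 0"
      using LIMSEQ_subseq_LIMSEQ[OF LIMSEQ_inverse_real_of_nat r] by (intro tendsto_intros) (simp add: o_def)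
    then show "(\<lambda>n. m + inverse (real (Suc (r n)))) \<longlonglongrightarrow> m" by simp
    have "a_form \<Omega> (s (r n)) u - (1/2) * a_form \<Omega> u u + b_form \<Omega> (s (r n)) (s (r n)) \<psi>
          - (1/2) * a_form \<Omega> \<psi> \<psi> - L2inner \<Omega> f (s (r n)) \<le> m + inverse (real (Suc (r n)))" for n
    proof -
      note G = G_op_props[OF sH[of "r n"]]
      have 1: "0 \<le> a_form \<Omega> (s (r n)) (s (r n)) - 2 * a_form \<Omega> (s (r n)) u + a_form \<Omega> u u"
        using E.form_nonneg[OF E.diff_mem[OF sH u]] E.form_quad_diff[OF sH u] by metis
      have 2: "0 \<le> a_form \<Omega> (G_op \<Omega> (s (r n))) (G_op \<Omega> (s (r n))) - 2 * b_form \<Omega> (s (r n)) (s (r n)) \<psi> + a_form \<Omega> \<psi> \<psi>"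
        using E.form_nonneg[OF E.diff_mem[OF G(1) pH]] E.form_quad_diff[OF G(1) pH] G(2)[OF pH] by simp
      show ?thesis using 1 2 s(2)[of "r n"] unfolding J_def j_fun_eq[OF sH] by linarith
    qed
    then show "\<exists>N. \<forall>n\<ge>N. a_form \<Omega> (s (r n)) u - (1/2) * a_form \<Omega> u u + b_form \<Omega> (s (r n)) (s (r n)) \<psi>
          - (1/2) * a_form \<Omega> \<psi> \<psi> - L2inner \<Omega> f (s (r n)) \<le> m + inverse (real (Suc (r n)))" by blast
  qed
  \<comment> \<open>The best choice of \<open>\<psi>\<close> would be \<open>v\<close>, which need
    not be smooth; test functions tending to it recover
    \<open>(1/2) * a_form \<Omega> v v\<close>.\<close>
  obtain t where t_test: "\<forall>n. test_fun \<Omega> (t n)" and t_lim: "(\<lambda>n. E.nrm (\<lambda>z. t n z - v z)) \<longlonglongrightarrow> 0"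
    using E_dense[OF v] by blast
  have tH: "t n \<in> H20 \<Omega>" for n using t_test test_H20 by blast
  have "(\<lambda>n. a_form \<Omega> v (t n)) \<longlonglongrightarrow> a_form \<Omega> v v"
    by (rule E.bdd_lin_tendsto[OF E.bdd_lin_form[OF v] tH v t_lim])
  moreover have "(\<lambda>n. a_form \<Omega> (t n) (t n)) \<longlonglongrightarrow> a_form \<Omega> v v"
    using tendsto_power[OF E.nrm_tendsto[OF tH v t_lim], of 2] by (simp add: E.nrm_sq tH v)
  ultimately have "(\<lambda>n. (1/2) * a_form \<Omega> u u + a_form \<Omega> v (t n) - (1/2) * a_form \<Omega> (t n) (t n) - L2inner \<Omega> f u)
      \<longlonglongrightarrow> (1/2) * a_form \<Omega> u u + a_form \<Omega> v v - (1/2) * a_form \<Omega> v v - L2inner \<Omega> f u"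
    by (intro tendsto_intros)
  then have "(1/2) * a_form \<Omega> u u + a_form \<Omega> v v - (1/2) * a_form \<Omega> v v - L2inner \<Omega> f u \<le> m"
    by (rule LIMSEQ_le_const2) (use test t_test in blast)
  then have "J u \<le> m" unfolding J_def j_fun_eq[OF u] v_def by simp
  then have "\<forall>\<xi>\<in>K. J u \<le> J \<xi>" using mle by force
  then show ?thesis using uK unfolding J_def K_def by blast
qed

text \<open>Against every member of \<open>H20 \<Omega>\<close>,
  \<open>G_op \<Omega> (\<lambda>z. u z + t * w z)\<close> acts as
  \<open>v + 2 t p + t\<^sup>2 q\<close>, where \<open>p\<close> represents the polarised term
  \<open>b(u, w, .)\<close>. Equality holds only under the form, so the expansion is made by testing
  with \<open>v\<close>, \<open>p\<close>, \<open>q\<close> and the image itself.\<close>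

lemma a_form_G_op_line:
  assumes u: "u \<in> H20 \<Omega>" and w: "w \<in> H20 \<Omega>"
  shows "\<exists>c2 c3 c4. \<forall>t. a_form \<Omega> (G_op \<Omega> (\<lambda>z. u z + t * w z)) (G_op \<Omega> (\<lambda>z. u z + t * w z))
    = a_form \<Omega> (G_op \<Omega> u) (G_op \<Omega> u) + 4 * t * b_form \<Omega> u (G_op \<Omega> u) w + t\<^sup>2 * (c2 + c3 * t + c4 * t\<^sup>2)"
proof -
  define v q where "v = G_op \<Omega> u" and "q = G_op \<Omega> w"
  note v = G_op_props[OF u, folded v_def] and q = G_op_props[OF w, folded q_def]
  obtain p where p: "p \<in> H20 \<Omega>" "\<And>\<psi>. \<psi> \<in> H20 \<Omega> \<Longrightarrow> a_form \<Omega> p \<psi> = b_form \<Omega> u w \<psi>"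
    using b_representation[OF u w] by blast
  have "a_form \<Omega> (G_op \<Omega> (\<lambda>z. u z + t * w z)) (G_op \<Omega> (\<lambda>z. u z + t * w z))
      = a_form \<Omega> v v + 4 * t * b_form \<Omega> u v w
        + t\<^sup>2 * ((4 * a_form \<Omega> p p + 2 * a_form \<Omega> v q) + (4 * a_form \<Omega> p q) * t + a_form \<Omega> q q * t\<^sup>2)" for t
  proof -
    define x where "x = (\<lambda>z. u z + t * w z)"
    have x: "x \<in> H20 \<Omega>" unfolding x_def using H20_lincomb[OF u w, of 1 t] by simp
    note g = G_op_props[OF x]
    have bx: "b_form \<Omega> x x \<psi> = a_form \<Omega> v \<psi> + 2 * t * a_form \<Omega> p \<psi> + t\<^sup>2 * a_form \<Omega> q \<psi>" if "\<psi> \<in> H20 \<Omega>" for \<psi>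
      using b_form_lin1[OF u w x that, of 1 t] b_form_lin2[OF u u w that, of 1 t] b_form_lin2[OF w u w that, of 1 t]
        b_form_commute[of w u \<psi>] that
      by (simp add: x_def[symmetric] v p q power2_eq_square algebra_simps)
    have ag: "a_form \<Omega> (G_op \<Omega> x) \<psi> = a_form \<Omega> v \<psi> + 2 * t * a_form \<Omega> p \<psi> + t\<^sup>2 * a_form \<Omega> q \<psi>" if "\<psi> \<in> H20 \<Omega>" for \<psi>
      using g(2)[OF that] bx[OF that] by simp
    \<comment> \<open>Symmetry in the last two arguments moves the direction \<open>w\<close> into
      the third slot, as the variational inequality requires.\<close>
    have vp: "a_form \<Omega> v p = b_form \<Omega> u v w"
      using p(2)[OF v(1)] b_form_commute23[OF u w v(1)] E.form_sym by metis
    have "a_form \<Omega> (G_op \<Omega> x) (G_op \<Omega> x)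
        = a_form \<Omega> (G_op \<Omega> x) v + 2 * t * a_form \<Omega> (G_op \<Omega> x) p + t\<^sup>2 * a_form \<Omega> (G_op \<Omega> x) q"
      using ag[OF g(1)]
      unfolding E.form_sym[of v "G_op \<Omega> x"] E.form_sym[of p "G_op \<Omega> x"] E.form_sym[of q "G_op \<Omega> x"] .
    also have "\<dots> = a_form \<Omega> v v + 4 * t * a_form \<Omega> v p
        + t\<^sup>2 * ((4 * a_form \<Omega> p p + 2 * a_form \<Omega> v q) + (4 * a_form \<Omega> p q) * t + a_form \<Omega> q q * t\<^sup>2)"
      unfolding ag[OF v(1)] ag[OF p(1)] ag[OF q(1)]
      by (simp add: E.form_sym[of p v] E.form_sym[of q v] E.form_sym[of q p] power2_eq_square algebra_simps)
    finally show ?thesis unfolding x_def vp .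
  qed
  then show ?thesis unfolding v_def by blast
qed

lemma minimizer_variational_inequality:
  assumes f: "L2 \<Omega> f" and u: "u \<in> obstacle_set \<Omega> obs"
    and min: "\<forall>\<xi>\<in>obstacle_set \<Omega> obs. j_fun \<Omega> f u \<le> j_fun \<Omega> f \<xi>"
    and \<phi>: "\<phi> \<in> obstacle_set \<Omega> obs"
  shows "a_form \<Omega> u (\<lambda>z. u z - \<phi> z) + 2 * b_form \<Omega> u (G_op \<Omega> u) (\<lambda>z. u z - \<phi> z) \<le> L2inner \<Omega> f (\<lambda>z. u z - \<phi> z)"
proof -
  have uH: "u \<in> H20 \<Omega>" and pH: "\<phi> \<in> H20 \<Omega>" using u \<phi> by (auto simp: obstacle_set_def)
  define w where "w = (\<lambda>z. \<phi> z - u z)"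
  have w: "w \<in> H20 \<Omega>" unfolding w_def by (rule E.diff_mem[OF pH uH])
  note load = bdd_lin_load[OF f]
  obtain c2 c3 c4 where G: "\<And>t. a_form \<Omega> (G_op \<Omega> (\<lambda>z. u z + t * w z)) (G_op \<Omega> (\<lambda>z. u z + t * w z))
    = a_form \<Omega> (G_op \<Omega> u) (G_op \<Omega> u) + 4 * t * b_form \<Omega> u (G_op \<Omega> u) w + t\<^sup>2 * (c2 + c3 * t + c4 * t\<^sup>2)"
    using a_form_G_op_line[OF uH w] by blast
  \<comment> \<open>The one-sided derivative of \<open>j_fun\<close> at \<open>u\<close> in
    direction \<open>w\<close>; the coefficient 4 from \<open>a_form_G_op_line\<close> is halved.
    All higher terms are collected in \<open>c\<close>.\<close>
  define D where "D = a_form \<Omega> u w + 2 * b_form \<Omega> u (G_op \<Omega> u) w - L2inner \<Omega> f w"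
  define c where "c t = (1/2) * (a_form \<Omega> w w + c2 + c3 * t + c4 * t\<^sup>2)" for t
  have j: "j_fun \<Omega> f (\<lambda>z. u z + t * w z) - j_fun \<Omega> f u = t * (D + t * c t)" for t
  proof -
    have x: "(\<lambda>z. u z + t * w z) \<in> H20 \<Omega>" using H20_lincomb[OF uH w, of 1 t] by simp
    show ?thesis
      using E.form_quad[OF uH w, of 1 t] E.bdd_linD[OF load uH w, of 1 t] G[of t]
      unfolding j_fun_eq[OF uH] j_fun_eq[OF x] D_def c_def by (simp add: power2_eq_square algebra_simps)
  qed
  \<comment> \<open>For \<open>t \<le> 1\<close> convexity keeps the point admissible. Dividing by
    \<open>t\<close> leaves a bound that survives as \<open>t\<close> tends to zero.\<close>
  have pos: "0 \<le> D + t * c t" if "0 < t" "t \<le> 1" for t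
  proof -
    have "(\<lambda>z. u z + t * w z) \<in> obstacle_set \<Omega> obs"
      unfolding w_def using that by (intro obstacle_set_convex u \<phi>) auto
    then have "j_fun \<Omega> f u \<le> j_fun \<Omega> f (\<lambda>z. u z + t * w z)" using min by blast
    then have "0 \<le> t * (D + t * c t)" using j[of t] by linarith
    then show ?thesis using that(1) by (simp add: zero_le_mult_iff)
  qed
  have "(\<lambda>n. D + inverse (real (Suc n)) * c (inverse (real (Suc n)))) \<longlonglongrightarrow> D + 0 * c 0"
    unfolding c_def by (intro tendsto_intros LIMSEQ_inverse_real_of_nat)
  moreover have "0 \<le> D + inverse (real (Suc n)) * c (inverse (real (Suc n)))" for n
    by (rule pos) (auto simp: inverse_le_1_iff)
  ultimately have "0 \<le> D" using LIMSEQ_le_const[of _ "D + 0 * c 0" 0] by auto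
  \<comment> \<open>The direction \<open>w\<close> points from \<open>u\<close> to
    \<open>\<phi>\<close> while the claim is stated with \<open>u - \<phi>\<close>, hence the change
    of sign.\<close>
  moreover have "a_form \<Omega> u (\<lambda>z. u z - \<phi> z) = - a_form \<Omega> u w"
    "b_form \<Omega> u (G_op \<Omega> u) (\<lambda>z. u z - \<phi> z) = - b_form \<Omega> u (G_op \<Omega> u) w"
    "L2inner \<Omega> f (\<lambda>z. u z - \<phi> z) = - L2inner \<Omega> f w"
    using E.bdd_lin_diff[OF E.bdd_lin_form[OF uH] uH pH] E.bdd_lin_diff[OF E.bdd_lin_form[OF uH] pH uH]
      E.bdd_lin_diff[OF bdd_lin_b3[OF uH G_op_props(1)[OF uH]] uH pH] E.bdd_lin_diff[OF bdd_lin_b3[OF uH G_op_props(1)[OF uH]] pH uH]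
      E.bdd_lin_diff[OF load uH pH] E.bdd_lin_diff[OF load pH uH]
    by (simp_all add: w_def)
  ultimately show ?thesis unfolding D_def by simp
qed

end

theorem theorem2p2:
  fixes \<Omega> :: "(real \<times> real) set" and f obs :: "real \<times> real \<Rightarrow> real"
  assumes "polygonal_domain \<Omega>"
    and "L2 \<Omega> f"
    and "obs \<in> H2 \<Omega>"
    and "continuous_on (closure \<Omega>) obs"
    and "\<forall>x\<in>frontier \<Omega>. obs x < 0"
  shows "(\<exists>u\<in>obstacle_set \<Omega> obs. \<forall>\<xi>\<in>obstacle_set \<Omega> obs. j_fun \<Omega> f u \<le> j_fun \<Omega> f \<xi>)
    \<and> (\<forall>u\<in>obstacle_set \<Omega> obs. (\<forall>\<xi>\<in>obstacle_set \<Omega> obs. j_fun \<Omega> f u \<le> j_fun \<Omega> f \<xi>) \<longrightarrow>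
        (let v = G_op \<Omega> u in
          u \<in> obstacle_set \<Omega> obs \<and> v \<in> H20 \<Omega> \<and>
          (\<forall>\<phi>1\<in>obstacle_set \<Omega> obs.
             a_form \<Omega> u (\<lambda>z. u z - \<phi>1 z) + 2 * b_form \<Omega> u v (\<lambda>z. u z - \<phi>1 z)
               \<le> L2inner \<Omega> f (\<lambda>z. u z - \<phi>1 z)) \<and>
          (\<forall>\<phi>2\<in>H20 \<Omega>. a_form \<Omega> v \<phi>2 - b_form \<Omega> u u \<phi>2 = 0)))"
proof -
  interpret bounded_open \<Omega>
    using assms(1) by unfold_locales (auto simp: polygonal_domain_def)
  have H: "u \<in> H20 \<Omega>" if "u \<in> obstacle_set \<Omega> obs" for u
    using that by (simp add: obstacle_set_def)
  show ?thesis
    unfolding Let_def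
    using exists_minimizer[OF assms(2) obstacle_set_nonempty[OF assms(4,5)]]
      minimizer_variational_inequality[OF assms(2)] G_op_props[OF H]
    by (intro conjI ballI impI) (auto simp only: right_minus_eq)
qed

end
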